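(* Let $N$ be a positive integer and let $A$ be a Jacobi matrix with $N$-periodically modulated entries, associated with sequences $(a_n : n \in \mathbb{N}_0)$ and $(b_n : n \in \mathbb{N}_0)$. Let $$\mathcal{X}_0(x) = \lim_{n \to \infty} X_{nN}(x), \qquad X_n(x) = B_{n+N-1}(x) B_{n+N-2}(x) \cdots B_n(x).$$ Suppose that $\mathcal{X}_0(0) = \sigma \operatorname{Id}$ for a certain $\sigma \in \{-1, 1\}$, and that Carleman's condition is not satisfied, i.e. $\sum_{n=0}^\infty \frac{1}{a_n} < \infty$. Assume that there are $i \in \{0, 1, \ldots, N-1\}$ and a sequence of positive numbers $(\gamma_n : n \in \mathbb{N}_0)$ satisfying $$\sum_{n=0}^\infty \frac{1}{\gamma_n} = \infty,$$ such that $R_{nN+i}(0) = \gamma_n\big(X_{nN+i}(0) - \sigma \operatorname{Id}\big)$ converges (as $n\to\infty$) to a non-zero matrix $\mathcal{R}_i$. Suppose that $$\big( R_{nN+i}(0) : n \in \mathbb{N} \big) \in \mathcal{D}_1 \big( \operatorname{Mat}(2, \mathbb{R}) \big).$$ Then (i) if $\operatorname{discr} \mathcal{R}_i < 0$, then $A$ is not self-adjoint; (ii) if $\operatorname{discr} \mathcal{R}_i > 0$, then $\sigma_{\mathrm{ess}}(A) = \emptyset$ provided $A$ is self-adjoint.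
   Context: $\mathbb{N}=\{1,2,\dots\}$, $\mathbb{N}_0=\mathbb{N}\cup\{0\}$. Given $a_n>0$ and $b_n\in\mathbb{R}$ ($n\in\mathbb{N}_0$), the Jacobi matrix $A$ is the closure in $\ell^2(\mathbb{N}_0)$ of the operator acting on finitely supported sequences by the symmetric tridiagonal matrix with diagonal entries $b_0,b_1,\ldots$ and off-diagonal entries $a_0,a_1,\ldots$, i.e. $(Ax)_0=b_0x_0+a_0x_1$ and $(Ax)_n=a_{n-1}x_{n-1}+b_nx_n+a_nx_{n+1}$ for $n\ge1$. $\sigma_{\mathrm{ess}}(A)$ denotes the essential spectrum of a self-adjoint $A$. $A$ has $N$-periodically modulated entries if there are $N$-periodic sequences $(\alpha_n:n\in\mathbb{Z})$ of positive numbers and $(\beta_n:n\in\mathbb{Z})$ of real numbers such that $a_n\to\infty$, $\left|\frac{a_{n-1}}{a_n}-\frac{\alpha_{n-1}}{\alpha_n}\right|\to0$ and $\left|\frac{b_n}{a_n}-\frac{\beta_n}{\alpha_n}\right|\to0$ as $n\to\infty$. (For such $A$ the limit defining $\mathcal{X}_0$ exists and does not depend on $x$.) Transfer matrices: for $j\ge1$, $B_j(x)=\begin{pmatrix}0&1\\-\frac{a_{j-1}}{a_j}&\frac{x-b_j}{a_j}\end{pmatrix}$. For a real $2\times2$ matrix $X$, $\operatorname{discr}X=(\operatorname{tr}X)^2-4\det X$. $\operatorname{Mat}(2,\mathbb{R})$ is the space of real $2\times 2$ matrices with the operator norm. A sequence $(x_n:n\in\mathbb{N})$ in a normed space $V$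 belongs to $\mathcal{D}_1(V)$ if it is bounded and $\sum_{n=1}^\infty\|x_{n+1}-x_n\|<\infty$. *)

theory Defs
  imports "HOL-Analysis.Analysis"
begin

section \<open>The complex Hilbert space of square-summable sequences\<close>

typedef ell2 = "{x :: nat \<Rightarrow> complex. summable (\<lambda>n. (cmod (x n))\<^sup>2)}"
  morphisms coord Abs_ell2
  by (rule exI[of _ "\<lambda>_. 0"]) simp

setup_lifting type_definition_ell2

lemma summable_coord: "summable (\<lambda>n. (cmod (coord x n))\<^sup>2)"
  using coord[of x] by simp

lemma ell2_eqI: "(\<And>n. coord x n = coord y n) \<Longrightarrow> x = y"
  by (metis coord_inject ext)

lemma square_summable_add:
  assumes "summable (\<lambda>n. (cmod (x n))\<^sup>2)" "summable (\<lambda>n. (cmod (y n))\<^sup>2)"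
  shows "summable (\<lambda>n. (cmod (x n + y n))\<^sup>2)"
proof (rule summable_comparison_test')
  show "summable (\<lambda>n. 2 * (cmod (x n))\<^sup>2 + 2 * (cmod (y n))\<^sup>2)"
    using assms by (intro summable_add summable_mult)
  fix n :: nat
  have "(cmod (x n + y n))\<^sup>2 \<le> (cmod (x n) + cmod (y n))\<^sup>2"
    by (intro power_mono norm_triangle_ineq) simp
  also have "\<dots> \<le> 2 * (cmod (x n))\<^sup>2 + 2 * (cmod (y n))\<^sup>2"
    using sum_squares_bound[of "cmod (x n)" "cmod (y n)"] by (simp add: power2_sum)
  finally show "norm ((cmod (x n + y n))\<^sup>2) \<le> 2 * (cmod (x n))\<^sup>2 + 2 * (cmod (y n))\<^sup>2"
    by simp
qed

lemma square_summable_scale: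
  assumes "summable (\<lambda>n. (cmod (x n))\<^sup>2)"
  shows "summable (\<lambda>n. (cmod (c * x n))\<^sup>2)"
  using summable_mult[OF assms, of "(cmod c)\<^sup>2"] by (simp add: norm_mult power_mult_distrib)

lift_definition scaleC_ell2 :: "complex \<Rightarrow> ell2 \<Rightarrow> ell2" is "\<lambda>c x n. c * x n"
  by (simp add: square_summable_scale)

definition cinner_ell2 :: "ell2 \<Rightarrow> ell2 \<Rightarrow> complex" where
  "cinner_ell2 x y = (\<Sum>n. coord x n * cnj (coord y n))"

lemma summable_cinner: "summable (\<lambda>n. coord x n * cnj (coord y n))"
proof (rule summable_comparison_test')
  show "summable (\<lambda>n. (cmod (coord x n))\<^sup>2 + (cmod (coord y n))\<^sup>2)"
    by (intro summable_add summable_coord)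
  fix n :: nat
  have "2 * (cmod (coord x n) * cmod (coord y n)) \<le> (cmod (coord x n))\<^sup>2 + (cmod (coord y n))\<^sup>2"
    using sum_squares_bound[of "cmod (coord x n)" "cmod (coord y n)"] by simp
  moreover have "0 \<le> cmod (coord x n) * cmod (coord y n)" by simp
  ultimately show "norm (coord x n * cnj (coord y n))
      \<le> (cmod (coord x n))\<^sup>2 + (cmod (coord y n))\<^sup>2"
    unfolding norm_mult complex_mod_cnj by linarith
qed

text \<open>
  The instance below makes the norm topology available. It uses the real part of the complex inner
  product, which induces the same norm; orthogonality and adjoints refer to \<^const>\<open>cinner_ell2\<close>.
\<close>

instantiation ell2 :: real_inner
begin

lift_definition zero_ell2 :: ell2 is "\<lambda>_. 0" by simp

lift_definition plus_ell2 :: "ell2 \<Rightarrow> ell2 \<Rightarrow> ell2" is "\<lambda>x y n. x n + y n"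
  by (simp add: square_summable_add)

lift_definition uminus_ell2 :: "ell2 \<Rightarrow> ell2" is "\<lambda>x n. - x n" by simp

lift_definition minus_ell2 :: "ell2 \<Rightarrow> ell2 \<Rightarrow> ell2" is "\<lambda>x y n. x n - y n"
  using square_summable_add[of _ "\<lambda>n. - _ n"] by simp

definition scaleR_ell2 :: "real \<Rightarrow> ell2 \<Rightarrow> ell2" where
  "scaleR_ell2 r x = scaleC_ell2 (complex_of_real r) x"

definition inner_ell2 :: "ell2 \<Rightarrow> ell2 \<Rightarrow> real" where
  "inner_ell2 x y = Re (cinner_ell2 x y)"

definition norm_ell2 :: "ell2 \<Rightarrow> real" where
  "norm_ell2 x = sqrt (\<Sum>n. (cmod (coord x n))\<^sup>2)"

definition sgn_ell2 :: "ell2 \<Rightarrow> ell2" where "sgn_ell2 x = inverse (norm x) *\<^sub>R x"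

definition dist_ell2 :: "ell2 \<Rightarrow> ell2 \<Rightarrow> real" where "dist_ell2 x y = norm (x - y)"

definition uniformity_ell2 :: "(ell2 \<times> ell2) filter" where
  "uniformity_ell2 = (INF e\<in>{0<..}. principal {(x, y). dist x y < e})"

definition open_ell2 :: "ell2 set \<Rightarrow> bool" where
  "open_ell2 U = (\<forall>x\<in>U. \<forall>\<^sub>F (x', y) in uniformity. x' = x \<longrightarrow> y \<in> U)"

lemma coord_simps [simp]:
  "coord 0 n = 0" "coord (x + y) n = coord x n + coord y n" "coord (- x) n = - coord x n"
  "coord (x - y) n = coord x n - coord y n" "coord (scaleC_ell2 c x) n = c * coord x n"
  "coord (r *\<^sub>R x) n = complex_of_real r * coord x n"
  by (simp_all add: zero_ell2.rep_eq plus_ell2.rep_eq uminus_ell2.rep_eq minus_ell2.rep_eq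
      scaleC_ell2.rep_eq scaleR_ell2_def)

lemma inner_ell2_suminf: "inner x y = (\<Sum>n. Re (coord x n * cnj (coord y n)))"
  and summable_inner_ell2: "summable (\<lambda>n. Re (coord x n * cnj (coord y n)))"
  using sums_Re[OF summable_sums[OF summable_cinner[of x y]]]
  by (auto simp: inner_ell2_def cinner_ell2_def sums_iff)

instance
proof
  fix x y z :: ell2 and r s :: real
  show "x + y + z = x + (y + z)" "x + y = y + x" "0 + x = x" "- x + x = 0" "x - y = x + - y"
    "r *\<^sub>R (x + y) = r *\<^sub>R x + r *\<^sub>R y" "(r + s) *\<^sub>R x = r *\<^sub>R x + s *\<^sub>R x"
    "r *\<^sub>R s *\<^sub>R x = (r * s) *\<^sub>R x" "1 *\<^sub>R x = x"
    by (rule ell2_eqI; simp add: algebra_simps)+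
  show "sgn x = inverse (norm x) *\<^sub>R x" by (rule sgn_ell2_def)
  show "dist x y = norm (x - y)" by (rule dist_ell2_def)
  show "uniformity = (INF e\<in>{0<..}. principal {(x, y). dist (x :: ell2) y < e})"
    by (rule uniformity_ell2_def)
  show "open U = (\<forall>x\<in>U. \<forall>\<^sub>F (x', y) in uniformity. x' = x \<longrightarrow> y \<in> U)" for U :: "ell2 set"
    by (rule open_ell2_def)
  show "inner x y = inner y x"
    unfolding inner_ell2_suminf by (simp add: mult.commute)
  show "inner (x + y) z = inner x z + inner y z"
    using suminf_add[OF summable_inner_ell2[of x z] summable_inner_ell2[of y z]]
    unfolding inner_ell2_suminf by (simp add: algebra_simps)
  show "inner (r *\<^sub>R x) y = r * inner x y"
    using suminf_mult[OF summable_inner_ell2[of x y], of r]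
    unfolding inner_ell2_suminf by (simp add: algebra_simps)
  have self: "inner x x = (\<Sum>n. (cmod (coord x n))\<^sup>2)"
    unfolding inner_ell2_suminf cmod_power2 by (simp add: power2_eq_square)
  show "0 \<le> inner x x"
    unfolding self by (intro suminf_nonneg summable_coord) simp
  show "inner x x = 0 \<longleftrightarrow> x = 0"
  proof
    assume "inner x x = 0"
    then have "\<forall>n. (cmod (coord x n))\<^sup>2 = 0"
      using suminf_eq_zero_iff[OF summable_coord[of x]] unfolding self by simp
    then show "x = 0" by (intro ell2_eqI) simp
  next
    assume "x = 0"
    then show "inner x x = 0" unfolding self by simp
  qed
  show "norm x = sqrt (inner x x)"
    unfolding self norm_ell2_def ..
qed

end

interpretation ell2: vector_space scaleC_ell2
  by standard (rule ell2_eqI; simp add: algebra_simps)+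


section \<open>Unbounded operators, given by their graphs\<close>

type_synonym ell2_op = "(ell2 \<times> ell2) set"

text \<open>For a densely defined operator this is the graph of its Hilbert space adjoint.\<close>

definition adjoint_op :: "ell2_op \<Rightarrow> ell2_op" where
  "adjoint_op A = {(y, z). \<forall>(x, w) \<in> A. cinner_ell2 w y = cinner_ell2 x z}"

definition self_adjoint :: "ell2_op \<Rightarrow> bool" where
  "self_adjoint A \<longleftrightarrow> closure (Domain A) = UNIV \<and> adjoint_op A = A"

text \<open>
  The pair \<open>(u, z u + f)\<close> lies in \<open>A\<close> iff \<open>(A - z) u = f\<close>, so the two conjuncts say that
  \<open>A - z\<close> maps its domain bijectively onto the whole space, with bounded inverse.
\<close>

definition resolvent_set :: "ell2_op \<Rightarrow> complex set" where
  "resolvent_set A = {z.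
     (\<forall>f. \<exists>!u. (u, scaleC_ell2 z u + f) \<in> A) \<and>
     (\<exists>C. \<forall>u f. (u, scaleC_ell2 z u + f) \<in> A \<longrightarrow> norm u \<le> C * norm f)}"

definition spectrum :: "ell2_op \<Rightarrow> complex set" where
  "spectrum A = - resolvent_set A"

definition eigenspace :: "ell2_op \<Rightarrow> complex \<Rightarrow> ell2 set" where
  "eigenspace A z = {u. (u, scaleC_ell2 z u) \<in> A}"

definition discrete_spectrum :: "ell2_op \<Rightarrow> complex set" where
  "discrete_spectrum A = {z. z isolated_in spectrum A \<and>
     (\<exists>u \<in> eigenspace A z. u \<noteq> 0) \<and>
     (\<exists>S. finite S \<and> eigenspace A z \<subseteq> ell2.span S)}"

definition essential_spectrum :: "ell2_op \<Rightarrow> complex set" where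
  "essential_spectrum A = spectrum A - discrete_spectrum A"


section \<open>Jacobi matrices\<close>

definition jacobi_action ::
    "(nat \<Rightarrow> real) \<Rightarrow> (nat \<Rightarrow> real) \<Rightarrow> (nat \<Rightarrow> complex) \<Rightarrow> nat \<Rightarrow> complex" where
  "jacobi_action a b x n =
     (if n = 0 then 0 else complex_of_real (a (n - 1)) * x (n - 1))
     + complex_of_real (b n) * x n + complex_of_real (a n) * x (n + 1)"

definition jacobi_finite :: "(nat \<Rightarrow> real) \<Rightarrow> (nat \<Rightarrow> real) \<Rightarrow> ell2_op" where
  "jacobi_finite a b =
     {(x, y). finite {n. coord x n \<noteq> 0} \<and> coord y = jacobi_action a b (coord x)}"

definition jacobi_matrix :: "(nat \<Rightarrow> real) \<Rightarrow> (nat \<Rightarrow> real) \<Rightarrow> ell2_op" where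
  "jacobi_matrix a b = closure (jacobi_finite a b)"

lemma Domain_jacobi_finite: "Domain (jacobi_finite a b) = {x. finite {n. coord x n \<noteq> 0}}"
proof -
  have "\<exists>y. coord y = jacobi_action a b (coord x)" if fin: "finite {n. coord x n \<noteq> 0}" for x
  proof -
    obtain M where M: "\<And>n. coord x n \<noteq> 0 \<Longrightarrow> n < M"
      using fin unfolding finite_nat_set_iff_bounded by auto
    have "jacobi_action a b (coord x) n = 0" if "n \<notin> {..M}" for n
    proof -
      have "coord x (n - 1) = 0" "coord x n = 0" "coord x (n + 1) = 0"
        using M[of "n - 1"] M[of n] M[of "n + 1"] that by fastforce+
      then show ?thesis by (simp add: jacobi_action_def)
    qed
    then have "summable (\<lambda>n. (cmod (jacobi_action a b (coord x) n))\<^sup>2)"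
      by (intro summable_finite[of "{..M}"]) auto
    then show ?thesis
      using Abs_ell2_inverse by (metis mem_Collect_eq)
  qed
  then show ?thesis by (auto simp: jacobi_finite_def)
qed

definition periodically_modulated ::
    "nat \<Rightarrow> (nat \<Rightarrow> real) \<Rightarrow> (nat \<Rightarrow> real) \<Rightarrow> bool" where
  "periodically_modulated N a b \<longleftrightarrow>
     (\<exists>\<alpha> \<beta> :: int \<Rightarrow> real.
        (\<forall>n. \<alpha> (n + int N) = \<alpha> n \<and> \<alpha> n > 0) \<and> (\<forall>n. \<beta> (n + int N) = \<beta> n) \<and>
        filterlim a at_top sequentially \<and>
        (\<lambda>n. \<bar>a (n - 1) / a n - \<alpha> (int n - 1) / \<alpha> (int n)\<bar>) \<longlonglongrightarrow> 0 \<and>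
        (\<lambda>n. \<bar>b n / a n - \<beta> (int n) / \<alpha> (int n)\<bar>) \<longlonglongrightarrow> 0)"

text \<open>Only the indices \<open>j \<ge> 1\<close> are meaningful: \<open>0 - 1 = 0\<close> on naturals.\<close>

definition transfer_matrix ::
    "(nat \<Rightarrow> real) \<Rightarrow> (nat \<Rightarrow> real) \<Rightarrow> nat \<Rightarrow> real \<Rightarrow> real^2^2" where
  "transfer_matrix a b j x =
     vector [vector [0, 1], vector [- (a (j - 1) / a j), (x - b j) / a j]]"

text \<open>\<open>transfer_product a b k n x\<close> is \<open>B (n + k - 1) x ** \<dots> ** B n x\<close>, with \<open>B\<close> the transfer matrices.\<close>

primrec transfer_product ::
    "(nat \<Rightarrow> real) \<Rightarrow> (nat \<Rightarrow> real) \<Rightarrow> nat \<Rightarrow> nat \<Rightarrow> real \<Rightarrow> real^2^2" where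
  "transfer_product a b 0 n x = mat 1"
| "transfer_product a b (Suc k) n x = transfer_matrix a b (n + k) x ** transfer_product a b k n x"

definition discr :: "real^2^2 \<Rightarrow> real" where
  "discr X = (trace X)\<^sup>2 - 4 * det X"

text \<open>Sequences are indexed by the positive integers; the value at \<open>0\<close> is ignored.\<close>

definition D1 :: "(nat \<Rightarrow> 'v::real_normed_vector) set" where
  "D1 = {x. bounded (x ` {1..}) \<and> summable (\<lambda>n. norm (x (n + 2) - x (n + 1)))}"

text \<open>
  The library norm on \<^typ>\<open>real^2^2\<close> is not the operator norm, so matrices are regarded as bounded
  linear maps whenever the norm matters.
\<close>

definition mat_op :: "real^2^2 \<Rightarrow> ((real^2) \<Rightarrow>\<^sub>L (real^2))" where
  "mat_op X = Blinfun ((*v) X)"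

lemma blinfun_apply_mat_op: "blinfun_apply (mat_op X) = (*v) X"
  and norm_mat_op: "norm (mat_op X) = onorm ((*v) X)"
  by (simp_all add: mat_op_def bounded_linear_Blinfun_apply norm_blinfun.rep_eq)

end

theory Submission imports Defs begin

text \<open>
  The recurrence needs to be studied at the spectral parameter \<open>0\<close> only. Real sequences \<open>y\<close> with
  \<open>a (n-1) y (n-1) + b n y n + a n y (n+1) = f n\<close> for \<open>n \<ge> 1\<close> are followed through the vectors
  \<open>w j = sqrt (a (j-1)) (y (j-1), y j)\<close>. In this normalisation the transfer matrices have determinant \<open>1\<close>,
  and since \<open>\<Sum>1/a n\<close> converges, a homogeneous solution is square summable as soon as \<open>w\<close> is bounded. Over one
  period \<open>w\<close> is multiplied by a scalar multiple of \<open>X = \<sigma> + R/\<gamma>\<close>, where the matrices \<open>R\<close> converge and have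
  bounded variation. The point is that \<open>X\<close> commutes with \<open>R\<close>, so the only errors come from replacing
  \<open>R\<close> by its successor, and these are summable.

  If \<open>discr Ri < 0\<close>, the quadratic form \<open>v \<mapsto> det (R v, v)\<close> is definite and invariant under the
  normalised \<open>X\<close>. Gronwall's inequality then keeps \<open>w\<close> bounded (\<open>elliptic_bounded\<close>), so all homogeneous
  solutions are square summable. This is incompatible with self-adjointness
  (\<open>jacobi_not_self_adjoint\<close>): pairing the solution of \<open>J p = 0\<close> with the solution of
  \<open>J h = (1, 0, 0, \<dots>)\<close> would give \<open>0 = 1\<close>.

  If \<open>discr Ri > 0\<close>, the spectral projections of \<open>R\<close> split \<open>w\<close> into a component stretched by some
  \<open>\<kappa> \<ge> 1\<close> and one contracted by \<open>1/\<kappa>\<close>, up to summable errors (\<open>hyperbolic\<close>). By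
  \<open>bounded_or_growing\<close> either \<open>w\<close> stays bounded in terms of the data, or it grows at the maximal rate
  available to homogeneous solutions. If a square summable \<open>y\<close> ever grows in this way, all homogeneous
  solutions are square summable as well, and self-adjointness fails as before. So for self-adjoint \<open>A\<close> every
  \<open>(u, f)\<close> in \<open>A\<close> satisfies \<open>a n |u n|\<^sup>2 \<le> C (\<parallel>u\<parallel>\<^sup>2 + \<parallel>f\<parallel>\<^sup>2)\<close> for large \<open>n\<close>. Summability of
  \<open>1/a n\<close> makes the tails of \<open>u\<close> small uniformly in the graph norm, while the recurrence bounds finitely
  many coordinates by the first one; hence \<open>\<parallel>u\<parallel> \<le> C (|u 0| + \<parallel>(A - z) u\<parallel>)\<close>, uniformly for bounded \<open>z\<close>
  (\<open>jacobi_norm_bound\<close>). For a self-adjoint operator this one estimate forces the spectrum to consist of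
  isolated simple eigenvalues (\<open>essential_spectrum_empty\<close>).
\<close>

section \<open>Completeness and inner product of the sequence space\<close>

lemma norm_ell2_sq: "(norm x)\<^sup>2 = (\<Sum>n. (cmod (coord x n))\<^sup>2)"
  unfolding norm_ell2_def by (intro real_sqrt_pow2 suminf_nonneg summable_coord) simp

lemma sum_coord_le_norm_sq:
  assumes "finite I" shows "(\<Sum>n\<in>I. (cmod (coord x n))\<^sup>2) \<le> (norm x)\<^sup>2"
  unfolding norm_ell2_sq by (intro sum_le_suminf summable_coord assms) simp

lemma cmod_coord_le_norm: "cmod (coord x n) \<le> norm x"
  using sum_coord_le_norm_sq[of "{n}" x] by (simp add: power2_le_iff_abs_le)

lemma tendsto_coord:
  assumes "(X \<longlongrightarrow> x) F" shows "((\<lambda>k. coord (X k) n) \<longlongrightarrow> coord x n) F"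
proof (rule tendsto_dist_iff[THEN iffD2])
  have "((\<lambda>k. dist (X k) x) \<longlongrightarrow> 0) F" using assms by (rule tendsto_dist_iff[THEN iffD1])
  then show "((\<lambda>k. dist (coord (X k) n) (coord x n)) \<longlongrightarrow> 0) F"
    by (rule Lim_null_comparison[rotated])
       (use cmod_coord_le_norm[of "X _ - x" n] in \<open>simp add: dist_norm eventually_mono\<close>)
qed

text \<open>Summability and the norm bound come from the same finite estimates; this is how limits of partial sums
  are turned into elements of the space.\<close>

lemma ell2_of_partial_sums:
  assumes "\<And>M. (\<Sum>n<M. (cmod (x n))\<^sup>2) \<le> B\<^sup>2" "0 \<le> B"
  obtains u where "coord u = x" "norm u \<le> B"
proof -
  have s: "summable (\<lambda>n. (cmod (x n))\<^sup>2)"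
    by (rule summableI_nonneg_bounded[OF _ assms(1)]) simp
  obtain u where u: "coord u = x" using Abs_ell2_inverse[of x] s by auto
  have "(norm u)\<^sup>2 \<le> B\<^sup>2"
    unfolding norm_ell2_sq u by (rule suminf_le_const[OF s assms(1)])
  with u assms(2) show thesis by (intro that[of u]) (simp_all add: power2_le_iff_abs_le)
qed

instance ell2 :: complete_space
proof
  fix X :: "nat \<Rightarrow> ell2" assume X: "Cauchy X"
  have "Cauchy (\<lambda>k. coord (X k) n)" for n
  proof (rule metric_CauchyI)
    fix e :: real assume "0 < e"
    then obtain K where K: "\<forall>m\<ge>K. \<forall>k\<ge>K. dist (X m) (X k) < e"
      using metric_CauchyD[OF X] by blast
    show "\<exists>K. \<forall>m\<ge>K. \<forall>k\<ge>K. dist (coord (X m) n) (coord (X k) n) < e"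
    proof (intro exI[of _ K] allI impI)
      fix m k assume "m \<ge> K" "k \<ge> K"
      with K have "norm (X m - X k) < e" by (simp add: dist_norm)
      with cmod_coord_le_norm[of "X m - X k" n]
      show "dist (coord (X m) n) (coord (X k) n) < e" by (simp add: dist_norm)
    qed
  qed
  then have "\<exists>l. (\<lambda>k. coord (X k) n) \<longlonglongrightarrow> l" for n
    by (simp add: Cauchy_convergent_iff convergent_def)
  then obtain l where l: "\<And>n. (\<lambda>k. coord (X k) n) \<longlonglongrightarrow> l n" by metis
  \<comment> \<open>Letting the second index of the Cauchy condition tend to infinity inside each partial sum.\<close>
  have tail: "\<exists>K. \<forall>m\<ge>K. \<exists>u. coord u = (\<lambda>n. coord (X m) n - l n) \<and> norm u \<le> e" if e: "0 < e" for e
  proof -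
    obtain K where K: "\<forall>m\<ge>K. \<forall>k\<ge>K. dist (X m) (X k) < e"
      using metric_CauchyD[OF X e] by blast
    have "\<exists>u. coord u = (\<lambda>n. coord (X m) n - l n) \<and> norm u \<le> e" if m: "m \<ge> K" for m
    proof -
      have "(\<Sum>n<M. (cmod (coord (X m) n - l n))\<^sup>2) \<le> e\<^sup>2" for M
      proof (rule LIMSEQ_le_const2)
        show "(\<lambda>k. \<Sum>n<M. (cmod (coord (X m) n - coord (X k) n))\<^sup>2)
            \<longlonglongrightarrow> (\<Sum>n<M. (cmod (coord (X m) n - l n))\<^sup>2)"
          by (intro tendsto_intros l)
        have "(\<Sum>n<M. (cmod (coord (X m) n - coord (X k) n))\<^sup>2) \<le> e\<^sup>2" if "k \<ge> K" for k
        proof -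
          have "(\<Sum>n<M. (cmod (coord (X m - X k) n))\<^sup>2) \<le> (norm (X m - X k))\<^sup>2"
            by (rule sum_coord_le_norm_sq) simp
          also have "\<dots> \<le> e\<^sup>2"
            using K m that by (intro power_mono) (auto simp: dist_norm less_imp_le)
          finally show ?thesis by simp
        qed
        then show "\<exists>K. \<forall>k\<ge>K. (\<Sum>n<M. (cmod (coord (X m) n - coord (X k) n))\<^sup>2) \<le> e\<^sup>2"
          by blast
      qed
      then show ?thesis by (rule ell2_of_partial_sums) (use e in auto)
    qed
    then show ?thesis by blast
  qed
  obtain K u where u: "coord u = (\<lambda>n. coord (X K) n - l n)"
    using tail[of 1] by auto
  define x where "x = X K - u"
  have x: "coord x n = l n" for n by (simp add: x_def u)
  have "X \<longlonglongrightarrow> x"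
  proof (rule metric_LIMSEQ_I)
    fix e :: real assume e: "0 < e"
    then obtain K where K: "\<forall>m\<ge>K. \<exists>u. coord u = (\<lambda>n. coord (X m) n - l n) \<and> norm u \<le> e/2"
      using tail[of "e/2"] by auto
    have "dist (X m) x < e" if m: "m \<ge> K" for m
    proof -
      obtain v where v: "coord v = (\<lambda>n. coord (X m) n - l n)" "norm v \<le> e/2" using K m by blast
      then have "v = X m - x" by (intro ell2_eqI) (simp add: x)
      with v e show ?thesis by (simp add: dist_norm)
    qed
    then show "\<exists>K. \<forall>m\<ge>K. dist (X m) x < e" by blast
  qed
  then show "convergent X" by (rule convergentI)
qed

lemma cinner_add_left: "cinner_ell2 (x + y) z = cinner_ell2 x z + cinner_ell2 y z"
  unfolding cinner_ell2_def
  by (subst suminf_add) (simp_all add: summable_cinner algebra_simps)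

lemma cinner_scaleC_left: "cinner_ell2 (scaleC_ell2 c x) y = c * cinner_ell2 x y"
  unfolding cinner_ell2_def
  by (subst suminf_mult[symmetric]) (simp_all add: summable_cinner algebra_simps)

lemma cinner_commute: "cinner_ell2 y x = cnj (cinner_ell2 x y)"
proof -
  have "(\<lambda>n. cnj (coord x n * cnj (coord y n))) sums cnj (cinner_ell2 x y)"
    unfolding cinner_ell2_def sums_cnj by (rule summable_sums[OF summable_cinner])
  then show ?thesis unfolding cinner_ell2_def by (simp add: sums_iff mult.commute)
qed

lemma cinner_add_right: "cinner_ell2 x (y + z) = cinner_ell2 x y + cinner_ell2 x z"
  by (metis cinner_add_left cinner_commute complex_cnj_add complex_cnj_cnj)

lemma cinner_scaleC_right: "cinner_ell2 x (scaleC_ell2 c y) = cnj c * cinner_ell2 x y"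
  by (metis cinner_scaleC_left cinner_commute complex_cnj_mult)

lemma cinner_zero [simp]: "cinner_ell2 0 x = 0" "cinner_ell2 x 0 = 0"
  by (simp_all add: cinner_ell2_def)

lemma norm_scaleC: "norm (scaleC_ell2 c x) = cmod c * norm x"
proof -
  have "(norm (scaleC_ell2 c x))\<^sup>2 = (cmod c * norm x)\<^sup>2"
    unfolding power_mult_distrib norm_ell2_sq
    by (subst suminf_mult[symmetric]) (simp_all add: summable_coord norm_mult power_mult_distrib)
  then show ?thesis by (simp add: power2_eq_iff_nonneg)
qed

lemma bounded_linear_scaleC: "bounded_linear (scaleC_ell2 c)"
  by (rule bounded_linear_intro[where K = "cmod c"])
     (auto intro: ell2_eqI simp: algebra_simps norm_scaleC)

text \<open>The imaginary part is the real inner product with a rotated vector. This transfers continuity and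
  orthogonality statements between the two products.\<close>

lemma cinner_eq_inner:
  "cinner_ell2 x y = Complex (inner x y) (inner (scaleC_ell2 (- \<i>) x) y)"
  unfolding inner_ell2_def cinner_scaleC_left by (rule complex_eqI) simp_all

lemma tendsto_cinner_left:
  assumes "(X \<longlongrightarrow> x) F" shows "((\<lambda>k. cinner_ell2 (X k) y) \<longlongrightarrow> cinner_ell2 x y) F"
  unfolding cinner_eq_inner
  by (intro tendsto_intros bounded_linear.tendsto[OF bounded_linear_scaleC] assms)

lemma tendsto_cinner_right:
  assumes "(X \<longlongrightarrow> x) F" shows "((\<lambda>k. cinner_ell2 y (X k)) \<longlongrightarrow> cinner_ell2 y x) F"
  unfolding cinner_commute[where y = y] by (intro tendsto_intros tendsto_cinner_left assms)

lemma cinner_self: "cinner_ell2 x x = complex_of_real ((norm x)\<^sup>2)"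
proof (rule complex_eqI)
  show "Re (cinner_ell2 x x) = Re (complex_of_real ((norm x)\<^sup>2))"
    by (simp add: inner_ell2_def[symmetric] power2_norm_eq_inner)
  show "Im (cinner_ell2 x x) = Im (complex_of_real ((norm x)\<^sup>2))"
    using arg_cong[OF cinner_commute[of x x], of Im] by simp
qed

text \<open>The witness is the difference between \<open>x\<close> and its nearest point in \<open>S\<close>. A minimising sequence is
  Cauchy by the parallelogram identity, so completeness can replace compactness.\<close>

lemma exists_orthogonal_to_closed_subspace:
  fixes S :: "'a :: {real_inner, complete_space} set"
  assumes S: "subspace S" and closed: "closed S" and x: "x \<notin> S"
  obtains y where "y \<noteq> 0" "\<And>s. s \<in> S \<Longrightarrow> inner s y = 0"
proof -
  define d where "d = infdist x S"
  have ne: "S \<noteq> {}" using subspace_0[OF S] by auto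
  have d: "0 \<le> d" by (simp add: d_def infdist_nonneg)
  have dle: "d \<le> norm (x - s)" if "s \<in> S" for s
    using infdist_le[OF that, of x] by (simp add: d_def dist_norm)
  have "\<exists>s\<in>S. norm (x - s) < d + 1 / (Suc k)" for k :: nat
  proof -
    have "(INF s\<in>S. dist x s) < d + 1 / Suc k" using ne by (simp add: d_def infdist_def)
    then show ?thesis
      by (subst (asm) cINF_less_iff[OF ne]) (auto simp: dist_norm intro!: bdd_belowI[of _ 0])
  qed
  then obtain s where sS: "\<And>k. s k \<in> S" and s: "\<And>k. norm (x - s k) < d + 1 / real (Suc k)"
    by metis
  have diff: "(norm (s k - s l))\<^sup>2 \<le> (8 * d + 4) / Suc K" if "k \<ge> K" "l \<ge> K" for k l K
  proof -
    let ?e = "1 / real (Suc K)"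
    have le: "(norm (x - s k))\<^sup>2 \<le> (d + ?e)\<^sup>2" if "k \<ge> K" for k
    proof (intro power_mono)
      have "1 / real (Suc k) \<le> ?e" using that by (simp add: divide_simps)
      then show "norm (x - s k) \<le> d + ?e" using s[of k] by simp
    qed simp
    have mid: "(1/2) *\<^sub>R (s k + s l) \<in> S"
      by (intro subspace_scale[OF S] subspace_add[OF S] sS)
    have par: "(norm (s k - s l))\<^sup>2
        = 2 * (norm (x - s k))\<^sup>2 + 2 * (norm (x - s l))\<^sup>2
          - 4 * (norm (x - (1/2) *\<^sub>R (s k + s l)))\<^sup>2"
      unfolding power2_norm_eq_inner
      by (simp add: inner_diff_left inner_diff_right inner_add_left inner_add_right inner_commute
          algebra_simps)
    have "d\<^sup>2 \<le> (norm (x - (1/2) *\<^sub>R (s k + s l)))\<^sup>2"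
      using dle[OF mid] d by (intro power_mono)
    then have "(norm (s k - s l))\<^sup>2 \<le> 4 * (d + ?e)\<^sup>2 - 4 * d\<^sup>2"
      using par le[OF that(1)] le[OF that(2)] by linarith
    also have "\<dots> = 8 * d * ?e + 4 * (?e * ?e)" by (simp add: power2_eq_square algebra_simps)
    also have "\<dots> \<le> 8 * d * ?e + 4 * (?e * 1)"
      by (intro add_left_mono mult_left_mono) (auto simp: divide_simps)
    finally show ?thesis by (simp add: algebra_simps add_divide_distrib)
  qed
  have "Cauchy s"
  proof (rule metric_CauchyI)
    fix e :: real assume e: "0 < e"
    obtain K :: nat where "(8 * d + 4) / e\<^sup>2 < real K" using reals_Archimedean2 by blast
    then have "(8 * d + 4) / e\<^sup>2 < real (Suc K)" by simp
    then have K: "(8 * d + 4) / Suc K < e\<^sup>2" using e by (simp add: divide_simps mult.commute)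
    have "dist (s k) (s l) < e" if "k \<ge> K" "l \<ge> K" for k l
      using diff[OF that] K e by (auto simp: dist_norm intro: power2_less_imp_less)
    then show "\<exists>K. \<forall>k\<ge>K. \<forall>l\<ge>K. dist (s k) (s l) < e" by blast
  qed
  then obtain p where p: "s \<longlonglongrightarrow> p" using Cauchy_convergent convergent_def by blast
  have pS: "p \<in> S" using closed_sequentially[OF closed] sS p by blast
  have "norm (x - p) \<le> d"
  proof (rule LIMSEQ_le)
    show "(\<lambda>k. norm (x - s k)) \<longlonglongrightarrow> norm (x - p)" by (intro tendsto_intros p)
    have "(\<lambda>k. d + 1 / real (Suc k)) \<longlonglongrightarrow> d + 0"
      by (intro tendsto_intros LIMSEQ_Suc[OF lim_1_over_n])
    then show "(\<lambda>k. d + 1 / real (Suc k)) \<longlonglongrightarrow> d" by simp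
  qed (use s in \<open>auto intro: less_imp_le\<close>)
  with dle[OF pS] have dp: "norm (x - p) = d" by simp
  have "inner t (x - p) = 0" if t: "t \<in> S" for t
  proof -
    \<comment> \<open>First variation of the distance in the direction \<open>t\<close>, then the optimal step \<open>r\<close>.\<close>
    have ineq: "2 * r * inner t (x - p) \<le> r\<^sup>2 * inner t t" for r
    proof -
      have "d\<^sup>2 \<le> (norm (x - (p + r *\<^sub>R t)))\<^sup>2"
        by (intro power_mono dle d subspace_add[OF S] subspace_scale[OF S] pS t)
      also have "\<dots> = d\<^sup>2 - 2 * r * inner t (x - p) + r\<^sup>2 * inner t t"
        unfolding dp[symmetric] power2_norm_eq_inner
        by (simp add: inner_diff_left inner_diff_right inner_add_left inner_add_right inner_commute
            algebra_simps power2_eq_square)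
      finally show ?thesis by simp
    qed
    show ?thesis
    proof (cases "inner t t = 0")
      case False
      have "2 * ((inner t (x - p))\<^sup>2 / inner t t) \<le> (inner t (x - p))\<^sup>2 / inner t t"
        using ineq[of "inner t (x - p) / inner t t"] False by (simp add: power2_eq_square)
      then have "(inner t (x - p))\<^sup>2 / inner t t \<le> 0" by simp
      then show ?thesis using False inner_ge_zero[of t] by (simp add: divide_le_0_iff)
    qed simp
  qed
  moreover have "x - p \<noteq> 0" using x pS by auto
  ultimately show thesis using that by blast
qed


section \<open>Spectrum of a self-adjoint operator controlled by one coordinate\<close>

text \<open>An intersection of closed conditions, one for each pair in the graph.\<close>

lemma closed_adjoint_op: "closed (adjoint_op A)"
proof -
  have eq: "adjoint_op A = (\<Inter>(x, w)\<in>A. {p. cinner_ell2 w (fst p) = cinner_ell2 x (snd p)})"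
    by (auto simp: adjoint_op_def)
  have cont: "continuous_on UNIV (\<lambda>p. cinner_ell2 x (f p))"
    if "continuous_on UNIV f" for f :: "ell2 \<times> ell2 \<Rightarrow> ell2" and x
    using that unfolding continuous_on_def by (auto intro: tendsto_cinner_right)
  show ?thesis
    unfolding eq by (intro closed_INT ballI) (auto intro!: closed_Collect_eq cont continuous_intros)
qed

lemma adjoint_op_add:
  "(u, f) \<in> adjoint_op A \<Longrightarrow> (v, g) \<in> adjoint_op A \<Longrightarrow> (u + v, f + g) \<in> adjoint_op A"
  by (fastforce simp: adjoint_op_def cinner_add_right)

lemma adjoint_op_scaleC:
  "(u, f) \<in> adjoint_op A \<Longrightarrow> (scaleC_ell2 c u, scaleC_ell2 c f) \<in> adjoint_op A"
  by (fastforce simp: adjoint_op_def cinner_scaleC_right)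

lemma Cauchy_of_diff_bound:
  fixes u :: "nat \<Rightarrow> 'a :: real_normed_vector" and f :: "nat \<Rightarrow> 'b :: real_normed_vector"
  assumes bound: "\<And>k l. norm (u k - u l) \<le> C * norm (f k - f l)" and f: "Cauchy f"
  shows "Cauchy u"
proof (rule metric_CauchyI)
  fix e :: real assume "0 < e"
  then obtain K where K: "\<forall>k\<ge>K. \<forall>l\<ge>K. dist (f k) (f l) < e / max C 1"
    using metric_CauchyD[OF f, of "e / max C 1"] by auto
  have "dist (u k) (u l) < e" if "k \<ge> K" "l \<ge> K" for k l
  proof -
    have "norm (u k - u l) \<le> max C 1 * norm (f k - f l)"
      by (rule order_trans[OF bound]) (simp add: mult_right_mono)
    also have "\<dots> < e"
      using K that by (simp add: dist_norm pos_less_divide_eq mult.commute)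
    finally show ?thesis by (simp add: dist_norm)
  qed
  then show "\<exists>K. \<forall>k\<ge>K. \<forall>l\<ge>K. dist (u k) (u l) < e" by blast
qed

text \<open>
  The bound says that, up to finite rank, \<open>A - z\<close> is bounded below: modulo \<open>(A - z) u\<close> the vector \<open>u\<close> is
  controlled by the single functional \<open>u \<mapsto> u 0\<close>. It is the form in which compactness of the resolvent
  is used below.
\<close>

locale self_adjoint_coordinate_bound =
  fixes A :: ell2_op
  assumes self_adjoint: "self_adjoint A"
    and coordinate_bound: "\<And>\<rho>. \<exists>C. \<forall>z u f. cmod z \<le> \<rho> \<longrightarrow> (u, scaleC_ell2 z u + f) \<in> A \<longrightarrow>
      norm u \<le> C * (cmod (coord u 0) + norm f)"
begin

lemma adjoint_eq: "adjoint_op A = A"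
  using self_adjoint by (simp add: self_adjoint_def)

lemma closed: "closed A"
  using closed_adjoint_op[of A] by (simp add: adjoint_eq)

lemma add: "(u, f) \<in> A \<Longrightarrow> (v, g) \<in> A \<Longrightarrow> (u + v, f + g) \<in> A"
  and scaleC: "(u, f) \<in> A \<Longrightarrow> (scaleC_ell2 c u, scaleC_ell2 c f) \<in> A"
  using adjoint_op_add[of u f A v g] adjoint_op_scaleC[of u f A c] by (simp_all add: adjoint_eq)

lemma symmetric: "(u, f) \<in> A \<Longrightarrow> (v, g) \<in> A \<Longrightarrow> cinner_ell2 f v = cinner_ell2 u g"
  using adjoint_eq by (force simp: adjoint_op_def)

lemma add_shifted:
  assumes "(u, scaleC_ell2 z u + f) \<in> A" "(v, scaleC_ell2 z v + g) \<in> A"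
  shows "(u + v, scaleC_ell2 z (u + v) + (f + g)) \<in> A"
proof -
  have "scaleC_ell2 z u + f + (scaleC_ell2 z v + g) = scaleC_ell2 z (u + v) + (f + g)"
    by (rule ell2_eqI) (simp add: algebra_simps)
  with add[OF assms] show ?thesis by simp
qed

lemma scaleC_shifted:
  assumes "(u, scaleC_ell2 z u + f) \<in> A"
  shows "(scaleC_ell2 c u, scaleC_ell2 z (scaleC_ell2 c u) + scaleC_ell2 c f) \<in> A"
proof -
  have "scaleC_ell2 c (scaleC_ell2 z u + f) = scaleC_ell2 z (scaleC_ell2 c u) + scaleC_ell2 c f"
    by (rule ell2_eqI) (simp add: algebra_simps)
  with scaleC[OF assms, of c] show ?thesis by simp
qed

lemma diff_shifted:
  assumes "(u, scaleC_ell2 z u + f) \<in> A" "(v, scaleC_ell2 z v + g) \<in> A"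
  shows "(u - v, scaleC_ell2 z (u - v) + (f - g)) \<in> A"
proof -
  have m: "scaleC_ell2 (-1) x = - x" for x by (rule ell2_eqI) simp
  show ?thesis using add_shifted[OF assms(1) scaleC_shifted[OF assms(2), of "-1"]] by (simp add: m)
qed

lemma shifted_limit:
  assumes "\<And>k. (u k, scaleC_ell2 z (u k) + f k) \<in> A" "u \<longlonglongrightarrow> u'" "f \<longlonglongrightarrow> f'"
  shows "(u', scaleC_ell2 z u' + f') \<in> A"
proof -
  have "(\<lambda>k. (u k, scaleC_ell2 z (u k) + f k)) \<longlonglongrightarrow> (u', scaleC_ell2 z u' + f')"
    by (intro tendsto_intros bounded_linear.tendsto[OF bounded_linear_scaleC] assms)
  then show ?thesis by (rule closed_sequentially[OF closed assms(1)])
qed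

lemma eigenvalue_real:
  assumes "(u, scaleC_ell2 z u) \<in> A" "u \<noteq> 0" shows "cnj z = z"
  using symmetric[OF assms(1,1)] assms(2)
  by (simp add: cinner_scaleC_left cinner_scaleC_right cinner_self)

lemma eigenvectors_orthogonal:
  assumes "(u, scaleC_ell2 z u) \<in> A" "(v, scaleC_ell2 z' v) \<in> A" "v \<noteq> 0" "z \<noteq> z'"
  shows "cinner_ell2 u v = 0"
  using symmetric[OF assms(1,2)] eigenvalue_real[OF assms(2,3)] assms(4)
  by (simp add: cinner_scaleC_left cinner_scaleC_right)

lemma eigenvector_coord_0:
  assumes "(u, scaleC_ell2 z u) \<in> A" "coord u 0 = 0" shows "u = 0"
proof -
  obtain C where "\<forall>z' u f. cmod z' \<le> cmod z \<longrightarrow> (u, scaleC_ell2 z' u + f) \<in> A \<longrightarrow>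
      norm u \<le> C * (cmod (coord u 0) + norm f)"
    using coordinate_bound by blast
  from this[rule_format, of z u 0] assms show ?thesis by simp
qed

text \<open>Otherwise there are approximate eigenvectors. Normalised to have first coordinate \<open>1\<close>, their
  differences have first coordinate \<open>0\<close>, so the coordinate bound makes them a Cauchy sequence, whose
  limit is an eigenvector.\<close>

lemma bounded_below:
  assumes no_ev: "\<And>u. (u, scaleC_ell2 z u) \<in> A \<Longrightarrow> u = 0"
  shows "\<exists>C. \<forall>u f. (u, scaleC_ell2 z u + f) \<in> A \<longrightarrow> norm u \<le> C * norm f"
proof (rule ccontr)
  assume neg: "\<not> ?thesis"
  obtain C where C: "\<And>u f. (u, scaleC_ell2 z u + f) \<in> A \<Longrightarrow> norm u \<le> C * (cmod (coord u 0) + norm f)"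
    using coordinate_bound[of "cmod z"] by blast
  define C' where "C' = max C 1"
  have C': "norm u \<le> C' * (cmod (coord u 0) + norm f)" if "(u, scaleC_ell2 z u + f) \<in> A" for u f
    by (rule order_trans[OF C[OF that]]) (simp add: C'_def mult_right_mono)
  have C'1: "C' \<ge> 1" by (simp add: C'_def)
  have "\<exists>v g. (v, scaleC_ell2 z v + g) \<in> A \<and> coord v 0 = 1 \<and> norm g \<le> 1 / Suc k" for k
  proof -
    \<comment> \<open>The constant is chosen so that the coordinate bound leaves \<open>Suc k * norm f < cmod (coord u 0)\<close>.\<close>
    obtain u f where uf: "(u, scaleC_ell2 z u + f) \<in> A" "\<not> norm u \<le> (C' + C' * Suc k) * norm f"
      using neg by blast
    have gt: "(C' + C' * Suc k) * norm f < C' * (cmod (coord u 0) + norm f)"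
      using C'[OF uf(1)] uf(2) by linarith
    then have "C' * (Suc k * norm f) < C' * cmod (coord u 0)" by (simp add: algebra_simps)
    then have lt: "Suc k * norm f < cmod (coord u 0)" using C'1 by simp
    then have ne: "coord u 0 \<noteq> 0"
      by (metis norm_ge_zero norm_zero not_le of_nat_0_le_iff mult_nonneg_nonneg)
    let ?c = "1 / coord u 0"
    have "norm (scaleC_ell2 ?c f) \<le> 1 / Suc k"
      using lt ne by (simp add: norm_scaleC norm_divide divide_simps mult.commute)
    with scaleC_shifted[OF uf(1), of ?c] ne show ?thesis
      by (intro exI[of _ "scaleC_ell2 ?c u"] exI[of _ "scaleC_ell2 ?c f"]) simp
  qed
  then obtain v g where vg: "\<And>k. (v k, scaleC_ell2 z (v k) + g k) \<in> A"
    and v0: "\<And>k. coord (v k) 0 = 1" and g: "\<And>k. norm (g k) \<le> 1 / Suc k" by metis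
  have g0: "g \<longlonglongrightarrow> 0"
    by (rule Lim_null_comparison[OF always_eventually[OF allI[OF g]] LIMSEQ_Suc[OF lim_1_over_n]])
  have "Cauchy v"
  proof (rule Cauchy_of_diff_bound[OF _ LIMSEQ_imp_Cauchy[OF g0]])
    show "norm (v k - v l) \<le> C' * norm (g k - g l)" for k l
      using C'[OF diff_shifted[OF vg[of k] vg[of l]]] by (simp add: v0)
  qed
  then obtain v' where v': "v \<longlonglongrightarrow> v'" using Cauchy_convergent convergent_def by blast
  have "v' = 0"
    using shifted_limit[OF vg v' g0] no_ev by simp
  moreover have "(\<lambda>k. coord (v k) 0) \<longlonglongrightarrow> coord v' 0" by (rule tendsto_coord[OF v'])
  ultimately show False by (simp add: v0 LIMSEQ_const_iff)
qed

text \<open>The range of \<open>A - z\<close> is closed because \<open>A - z\<close> is bounded below and \<open>A\<close> is closed. A vector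
  orthogonal to it is an eigenvector of \<open>A\<close> for \<open>cnj z\<close>; eigenvalues being real, it would be one for \<open>z\<close>.\<close>

lemma non_eigenvalue_in_resolvent_set:
  assumes no_ev: "\<And>u. (u, scaleC_ell2 z u) \<in> A \<Longrightarrow> u = 0"
  shows "z \<in> resolvent_set A"
proof -
  obtain C where C: "\<And>u f. (u, scaleC_ell2 z u + f) \<in> A \<Longrightarrow> norm u \<le> C * norm f"
    using bounded_below[OF no_ev] by blast
  define S where "S = {f. \<exists>u. (u, scaleC_ell2 z u + f) \<in> A}"
  have zero: "(0, 0) \<in> A"
    using adjoint_eq by (force simp: adjoint_op_def)
  have sub: "subspace S"
  proof (rule subspaceI)
    show "0 \<in> S" using zero by (auto simp: S_def intro!: exI[of _ 0])
    show "f + g \<in> S" if "f \<in> S" "g \<in> S" for f g 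
      using that unfolding S_def mem_Collect_eq by (blast intro: add_shifted)
    show "c *\<^sub>R f \<in> S" if "f \<in> S" for c f
      using that unfolding S_def mem_Collect_eq scaleR_ell2_def by (blast intro: scaleC_shifted)
  qed
  have "closed S"
    unfolding closed_sequential_limits
  proof (intro allI impI, elim conjE)
    fix f f' assume fS: "\<forall>k. f k \<in> S" and f: "f \<longlonglongrightarrow> f'"
    then obtain u where u: "\<And>k. (u k, scaleC_ell2 z (u k) + f k) \<in> A" unfolding S_def by auto metis
    have "Cauchy u"
      by (rule Cauchy_of_diff_bound[OF C[OF diff_shifted[OF u u]] LIMSEQ_imp_Cauchy[OF f]])
    then obtain u' where "u \<longlonglongrightarrow> u'" using Cauchy_convergent convergent_def by blast
    from shifted_limit[OF u this f] show "f' \<in> S" by (auto simp: S_def)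
  qed
  have "f \<in> S" for f
  proof (rule ccontr)
    assume "f \<notin> S"
    with exists_orthogonal_to_closed_subspace[OF sub \<open>closed S\<close>]
    obtain y where y: "y \<noteq> 0" "\<And>s. s \<in> S \<Longrightarrow> inner s y = 0" by metis
    have orth: "cinner_ell2 s y = 0" if s: "s \<in> S" for s
    proof -
      have "scaleC_ell2 (- \<i>) s \<in> S" using s scaleC_shifted unfolding S_def by blast
      with y(2) s show ?thesis by (simp add: cinner_eq_inner Complex_eq_0 del: ell2.scale_minus_left)
    qed
    have "(y, scaleC_ell2 (cnj z) y) \<in> adjoint_op A"
      unfolding adjoint_op_def
    proof clarify
      fix x w assume xw: "(x, w) \<in> A"
      then have "w - scaleC_ell2 z x \<in> S" by (auto simp: S_def intro!: exI[of _ x])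
      then have "cinner_ell2 (w - scaleC_ell2 z x) y = 0" by (rule orth)
      moreover have "w = (w - scaleC_ell2 z x) + scaleC_ell2 z x" by simp
      ultimately have "cinner_ell2 w y = cinner_ell2 (scaleC_ell2 z x) y"
        by (metis add_0 cinner_add_left)
      then show "cinner_ell2 w y = cinner_ell2 x (scaleC_ell2 (cnj z) y)"
        by (simp add: cinner_scaleC_left cinner_scaleC_right)
    qed
    then have ev: "(y, scaleC_ell2 (cnj z) y) \<in> A" by (simp add: adjoint_eq)
    from eigenvalue_real[OF this y(1)] have "cnj z = z" by simp
    with ev no_ev y(1) show False by simp
  qed
  moreover have "u = v" if "(u, scaleC_ell2 z u + f) \<in> A" "(v, scaleC_ell2 z v + f) \<in> A" for u v f
    using no_ev[of "u - v"] diff_shifted[OF that] by simp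
  ultimately have "\<exists>!u. (u, scaleC_ell2 z u + f) \<in> A" for f
    unfolding S_def by blast
  then show ?thesis using C unfolding resolvent_set_def by blast
qed

lemma normalised_eigenvector:
  assumes "z \<in> spectrum A"
  obtains u where "(u, scaleC_ell2 z u) \<in> A" "coord u 0 = 1"
proof -
  obtain u where u: "(u, scaleC_ell2 z u) \<in> A" "u \<noteq> 0"
    using assms non_eigenvalue_in_resolvent_set unfolding spectrum_def by blast
  then have "coord u 0 \<noteq> 0" using eigenvector_coord_0 by blast
  with u show thesis
    using scaleC_shifted[of u z 0 "1 / coord u 0"] by (intro that[of "scaleC_ell2 (1 / coord u 0) u"]) simp_all
qed

text \<open>An eigenvector is determined by its first coordinate, so eigenspaces are lines. If \<open>z'\<close> is an eigenvalue
  close to \<open>z\<close>, then eigenvectors \<open>u\<close>, \<open>v\<close> with first coordinate \<open>1\<close> are close by the coordinate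
  bound, yet they are orthogonal and have norm at least \<open>1\<close>.\<close>

theorem essential_spectrum_empty: "essential_spectrum A = {}"
proof -
  have "z \<in> discrete_spectrum A" if z: "z \<in> spectrum A" for z
  proof -
    obtain u where u: "(u, scaleC_ell2 z u) \<in> A" "coord u 0 = 1"
      by (rule normalised_eigenvector[OF z])
    then have u_ne: "u \<noteq> 0" by auto
    obtain C where C: "\<And>z' u f. cmod z' \<le> cmod z + 1 \<Longrightarrow> (u, scaleC_ell2 z' u + f) \<in> A \<Longrightarrow>
        norm u \<le> C * (cmod (coord u 0) + norm f)"
      using coordinate_bound[of "cmod z + 1"] by blast
    have un: "1 \<le> norm u" using cmod_coord_le_norm[of u 0] u(2) by simp
    have C1: "1 \<le> C" using C[of z u 0] u un by simp
    \<comment> \<open>\<open>v - u\<close> solves the equation for \<open>z\<close> with right side \<open>(z' - z) v\<close>, and \<open>norm v \<le> C\<close>: this gives \<open>C\<^sup>2\<close>.\<close>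
    have isolated: "z' = z" if z': "z' \<in> spectrum A" "dist z z' < 1 / C\<^sup>2" for z'
    proof (rule ccontr)
      assume ne: "z' \<noteq> z"
      have "1 / C\<^sup>2 \<le> 1" using C1 by simp
      then have "cmod (z' - z) \<le> 1" using z'(2) by (simp add: dist_norm norm_minus_commute)
      then have le: "cmod z' \<le> cmod z + 1" using norm_triangle_sub[of z' z] by simp
      obtain v where v: "(v, scaleC_ell2 z' v) \<in> A" "coord v 0 = 1"
        by (rule normalised_eigenvector[OF z'(1)])
      have nv: "norm v \<le> C" using C[OF le, of v 0] v by simp
      have eq: "scaleC_ell2 z' v = scaleC_ell2 z v + scaleC_ell2 (z' - z) v"
        by (rule ell2_eqI) (simp add: algebra_simps)
      have "(v - u, scaleC_ell2 z (v - u) + (scaleC_ell2 (z' - z) v - 0)) \<in> A"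
        by (rule diff_shifted) (use v u in \<open>simp_all add: eq\<close>)
      then have "norm (v - u) \<le> C * (cmod (coord (v - u) 0) + norm (scaleC_ell2 (z' - z) v - 0))"
        by (rule C[rotated]) simp
      then have "norm (v - u) \<le> C * (cmod (z' - z) * norm v)" using v u by (simp add: norm_scaleC)
      also have "\<dots> \<le> C * (cmod (z' - z) * C)"
        using nv C1 by (intro mult_left_mono) auto
      also have "\<dots> < 1"
        using z'(2) C1 by (simp add: dist_norm norm_minus_commute power2_eq_square divide_simps mult_ac)
      finally have "norm (v - u) < 1" .
      then have "(norm (v - u))\<^sup>2 < 1" by (simp add: power_less_one_iff abs_square_less_1)
      moreover have "inner v u = 0"
        using eigenvectors_orthogonal[OF v(1) u(1) u_ne ne] by (simp add: inner_ell2_def)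
      then have "(norm (v - u))\<^sup>2 = (norm v)\<^sup>2 + (norm u)\<^sup>2"
        by (simp add: power2_norm_eq_inner inner_diff_left inner_diff_right inner_commute)
      moreover have "1 \<le> (norm u)\<^sup>2" using un by (simp add: one_le_power)
      ultimately show False by (smt (verit) zero_le_power2)
    qed
    have "z isolated_in spectrum A"
      unfolding isolated_in_dist_Ex_iff
      using z isolated C1 by (intro conjI exI[of _ "1 / C\<^sup>2"]) auto
    moreover have "eigenspace A z \<subseteq> ell2.span {u}"
    proof
      fix w assume "w \<in> eigenspace A z"
      then have w: "(w, scaleC_ell2 z w) \<in> A" by (simp add: eigenspace_def)
      have "(w - scaleC_ell2 (coord w 0) u, scaleC_ell2 z (w - scaleC_ell2 (coord w 0) u) + (0 - scaleC_ell2 (coord w 0) 0)) \<in> A"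
        by (intro diff_shifted scaleC_shifted) (use w u in simp_all)
      then have "w - scaleC_ell2 (coord w 0) u = 0"
        by (intro eigenvector_coord_0[of _ z]) (simp_all add: u)
      then have "w = scaleC_ell2 (coord w 0) u" by simp
      then show "w \<in> ell2.span {u}"
        by (metis ell2.span_base ell2.span_scale singletonI)
    qed
    ultimately show ?thesis
      unfolding discrete_spectrum_def using u u_ne by (auto simp: eigenspace_def)
  qed
  then show ?thesis by (auto simp: essential_spectrum_def)
qed

end


section \<open>The Jacobi operator\<close>

lemma jacobi_matrix_action:
  assumes "(u, f) \<in> jacobi_matrix a b" shows "coord f = jacobi_action a b (coord u)"
proof -
  obtain x where x: "\<And>k. x k \<in> jacobi_finite a b" "x \<longlonglongrightarrow> (u, f)"
    using assms unfolding jacobi_matrix_def closure_sequential by blast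
  have u: "(\<lambda>k. fst (x k)) \<longlonglongrightarrow> u" and f: "(\<lambda>k. snd (x k)) \<longlonglongrightarrow> f"
    using tendsto_fst[OF x(2)] tendsto_snd[OF x(2)] by simp_all
  have "coord f n = jacobi_action a b (coord u) n" for n
  proof (rule LIMSEQ_unique)
    show "(\<lambda>k. coord (snd (x k)) n) \<longlonglongrightarrow> coord f n" by (rule tendsto_coord[OF f])
    have "coord (snd (x k)) n = jacobi_action a b (coord (fst (x k))) n" for k
      using x(1)[of k] by (auto simp: jacobi_finite_def)
    moreover have "(\<lambda>k. jacobi_action a b (coord (fst (x k))) n) \<longlonglongrightarrow> jacobi_action a b (coord u) n"
      unfolding jacobi_action_def by (cases "n = 0") (auto intro!: tendsto_intros tendsto_coord[OF u])
    ultimately show "(\<lambda>k. coord (snd (x k)) n) \<longlonglongrightarrow> jacobi_action a b (coord u) n" by simp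
  qed
  then show ?thesis by blast
qed

text \<open>Green's formula: the symmetric difference telescopes to a Wronskian at the right end.\<close>

lemma jacobi_action_Green:
  "(\<Sum>n<Suc k. jacobi_action a b x n * cnj (y n) - x n * cnj (jacobi_action a b y n))
    = of_real (a k) * (x (Suc k) * cnj (y k) - x k * cnj (y (Suc k)))"
  by (induction k) (simp_all add: jacobi_action_def algebra_simps)

text \<open>The maximal operator lies in the adjoint: on finitely supported vectors the boundary term of Green's
  formula vanishes, and the identity extends to the closure by continuity.\<close>

lemma in_adjoint_jacobi_matrix:
  assumes "coord f = jacobi_action a b (coord u)"
  shows "(u, f) \<in> adjoint_op (jacobi_matrix a b)"
proof -
  have fin: "cinner_ell2 w u = cinner_ell2 x f" if "(x, w) \<in> jacobi_finite a b" for x w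
  proof -
    have w: "coord w = jacobi_action a b (coord x)" and "finite {n. coord x n \<noteq> 0}"
      using that by (auto simp: jacobi_finite_def)
    then obtain M where M: "\<And>n. coord x n \<noteq> 0 \<Longrightarrow> n < M"
      unfolding finite_nat_set_iff_bounded by auto
    let ?d = "\<lambda>n. coord w n * cnj (coord u n) - coord x n * cnj (coord f n)"
    have "(\<Sum>n<Suc k. ?d n) = 0" if "k \<ge> M" for k
    proof -
      have "coord x k = 0" "coord x (Suc k) = 0" using M that by (meson not_less le_SucI)+
      then show ?thesis unfolding w assms jacobi_action_Green by simp
    qed
    then have "\<forall>\<^sub>F k in sequentially. (\<Sum>n<Suc k. ?d n) = 0"
      unfolding eventually_sequentially by blast
    then have "(\<lambda>k. \<Sum>n<Suc k. ?d n) \<longlonglongrightarrow> 0" by (rule tendsto_eventually)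
    then have "?d sums 0" unfolding sums_def by (rule LIMSEQ_imp_Suc)
    moreover have "?d sums (cinner_ell2 w u - cinner_ell2 x f)"
      unfolding cinner_ell2_def by (intro sums_diff summable_sums summable_cinner)
    ultimately show ?thesis using sums_unique2 by fastforce
  qed
  have "cinner_ell2 w u = cinner_ell2 x f" if xw: "(x, w) \<in> jacobi_matrix a b" for x w
  proof -
    obtain p where p: "\<And>k. p k \<in> jacobi_finite a b" "p \<longlonglongrightarrow> (x, w)"
      using xw[unfolded jacobi_matrix_def closure_sequential] by blast
    have x: "(\<lambda>k. fst (p k)) \<longlonglongrightarrow> x" and w: "(\<lambda>k. snd (p k)) \<longlonglongrightarrow> w"
      using tendsto_fst[OF p(2)] tendsto_snd[OF p(2)] by simp_all
    have "cinner_ell2 (snd (p k)) u = cinner_ell2 (fst (p k)) f" for k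
      using fin[of "fst (p k)" "snd (p k)"] p(1)[of k] by simp
    then have "(\<lambda>k. cinner_ell2 (snd (p k)) u) \<longlonglongrightarrow> cinner_ell2 x f"
      using tendsto_cinner_left[OF x, of f] by simp
    then show ?thesis using tendsto_cinner_left[OF w, of u] LIMSEQ_unique by blast
  qed
  then show ?thesis by (auto simp: adjoint_op_def)
qed

text \<open>The vectors \<open>u\<close> and \<open>v\<close> span the sequences whose rows of index \<open>n \<ge> 1\<close> vanish. Both belong to the adjoint;
  if the adjoint were symmetric, then \<open>0 = \<langle>J u, v\<rangle> = \<langle>u, J v\<rangle> = u 0 = 1\<close>.\<close>

lemma jacobi_not_self_adjoint:
  assumes u: "\<And>n. jacobi_action a b (coord u) n = 0" "coord u 0 = 1"
    and v: "\<And>n. jacobi_action a b (coord v) n = (if n = 0 then 1 else 0)"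
  shows "\<not> self_adjoint (jacobi_matrix a b)"
proof
  assume sa: "self_adjoint (jacobi_matrix a b)"
  have "summable (\<lambda>n. (cmod (if n = 0 then 1 else 0))\<^sup>2)"
    by (rule summable_finite[of "{0}"]) auto
  then obtain e where e: "coord e = (\<lambda>n. if n = 0 then 1 else 0)"
    using Abs_ell2_inverse[of "\<lambda>n. if n = 0 then 1 else 0"] by auto
  have "(u, 0) \<in> adjoint_op (jacobi_matrix a b)"
    by (rule in_adjoint_jacobi_matrix) (simp add: u fun_eq_iff)
  then have "(u, 0) \<in> jacobi_matrix a b" using sa by (simp add: self_adjoint_def)
  moreover have "(v, e) \<in> adjoint_op (jacobi_matrix a b)"
    by (rule in_adjoint_jacobi_matrix) (simp add: v e fun_eq_iff)
  ultimately have "cinner_ell2 0 v = cinner_ell2 u e" by (fastforce simp: adjoint_op_def)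
  moreover have "cinner_ell2 u e = 1"
    unfolding cinner_ell2_def e using suminf_finite[of "{0}" "\<lambda>n. coord u n * cnj (if n = 0 then 1 else 0)"]
    by (simp add: u)
  ultimately show False by simp
qed

text \<open>The recurrence expresses each coordinate by the two preceding ones and \<open>(A - z) u\<close>, so every coordinate
  is controlled by the first one.\<close>

lemma jacobi_coord_bound:
  assumes a: "\<And>n. a n > 0"
  shows "\<exists>c\<ge>0. \<forall>z u f. cmod z \<le> \<rho> \<longrightarrow> coord (scaleC_ell2 z u + f) = jacobi_action a b (coord u) \<longrightarrow>
    cmod (coord u n) \<le> c * (cmod (coord u 0) + norm f)"
proof (induction n rule: less_induct)
  case (less n)
  show ?case
  proof (cases n)
    case 0
    then show ?thesis by (intro exI[of _ 1]) simp
  next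
    case (Suc m)
    have m: "m < n" and m1: "m - 1 < n" using Suc by simp_all
    obtain c1 where c1: "c1 \<ge> 0"
      "\<And>z u f. cmod z \<le> \<rho> \<Longrightarrow> coord (scaleC_ell2 z u + f) = jacobi_action a b (coord u) \<Longrightarrow>
        cmod (coord u m) \<le> c1 * (cmod (coord u 0) + norm f)"
      using less[OF m] by blast
    obtain c2 where c2: "c2 \<ge> 0"
      "\<And>z u f. cmod z \<le> \<rho> \<Longrightarrow> coord (scaleC_ell2 z u + f) = jacobi_action a b (coord u) \<Longrightarrow>
        cmod (coord u (m - 1)) \<le> c2 * (cmod (coord u 0) + norm f)"
      using less[OF m1] by blast
    define c where "c = (1 + (\<bar>\<rho>\<bar> + \<bar>b m\<bar>) * c1 + a (m - 1) * c2) / a m"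
    have "cmod (coord u n) \<le> c * (cmod (coord u 0) + norm f)"
      if z: "cmod z \<le> \<rho>" and eq: "coord (scaleC_ell2 z u + f) = jacobi_action a b (coord u)" for z u f
    proof -
      let ?E = "cmod (coord u 0) + norm f"
      let ?t = "if m = 0 then 0 else complex_of_real (a (m - 1)) * coord u (m - 1)"
      have "of_real (a m) * coord u n = coord f m + (z - of_real (b m)) * coord u m - ?t"
        using fun_cong[OF eq, of m] Suc by (simp add: jacobi_action_def algebra_simps)
      then have "a m * cmod (coord u n) = cmod (coord f m + (z - of_real (b m)) * coord u m - ?t)"
        using a[of m] by (metis norm_mult norm_of_real abs_of_pos)
      also have "\<dots> \<le> cmod (coord f m) + cmod ((z - of_real (b m)) * coord u m) + cmod ?t"
        by (meson norm_triangle_ineq norm_triangle_ineq4 order_trans add_right_mono)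
      also have "cmod (coord f m) \<le> 1 * ?E"
        using cmod_coord_le_norm[of f m] by (simp add: add_increasing)
      also have "cmod ((z - of_real (b m)) * coord u m) \<le> (\<bar>\<rho>\<bar> + \<bar>b m\<bar>) * (c1 * ?E)"
        unfolding norm_mult
      proof (intro mult_mono c1(2)[OF z eq])
        show "cmod (z - of_real (b m)) \<le> \<bar>\<rho>\<bar> + \<bar>b m\<bar>"
          using norm_triangle_ineq4[of z "of_real (b m)"] z by simp
      qed auto
      also have "cmod ?t \<le> a (m - 1) * (c2 * ?E)"
        using c2 a[of "m - 1"] mult_left_mono[OF c2(2)[OF z eq], of "a (m - 1)"]
        by (auto simp: norm_mult)
      finally have "a m * cmod (coord u n) \<le> a m * (c * ?E)"
        using a[of m] by (simp add: c_def algebra_simps add_divide_distrib)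
      then show ?thesis using a[of m] by simp
    qed
    moreover have "c \<ge> 0"
      unfolding c_def using a[of m] a[of "m - 1"] c1(1) c2(1) by (simp add: less_imp_le)
    ultimately show ?thesis by blast
  qed
qed

text \<open>Beyond a suitable index \<open>M'\<close> the decay hypothesis and the convergence of \<open>\<Sum>1/a n\<close> make the tail at
  most \<open>(\<parallel>u\<parallel>\<^sup>2 + \<parallel>f\<parallel>\<^sup>2)/2\<close>. The first half is absorbed into the left side, and the coordinates
  below \<open>M'\<close> are bounded by the previous lemma.\<close>

lemma jacobi_norm_bound:
  assumes a: "\<And>n. a n > 0" and sum_a: "summable (\<lambda>n. 1 / a n)"
    and decay: "\<And>u f n. (u, f) \<in> jacobi_matrix a b \<Longrightarrow> n \<ge> n1 \<Longrightarrow>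
      a n * (cmod (coord u n))\<^sup>2 \<le> C * ((norm u)\<^sup>2 + (norm f)\<^sup>2)"
  shows "\<exists>C. \<forall>z u f. cmod z \<le> \<rho> \<longrightarrow> (u, scaleC_ell2 z u + f) \<in> jacobi_matrix a b \<longrightarrow>
      norm u \<le> C * (cmod (coord u 0) + norm f)"
proof -
  \<comment> \<open>\<open>D\<close> bounds the decay constant after replacing \<open>A u\<close> by \<open>z u + f\<close>; the summand \<open>1\<close> keeps it positive.\<close>
  define D where "D = \<bar>C\<bar> * (2 + 2 * \<rho>\<^sup>2) + 1"
  have D: "D > 0" unfolding D_def by (intro add_nonneg_pos mult_nonneg_nonneg) auto
  obtain M where M0: "\<And>m. m \<ge> M \<Longrightarrow> norm (\<Sum>i. 1 / a (i + m)) < 1 / (2 * D)"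
    using suminf_exist_split[OF _ sum_a, of "1 / (2 * D)"] D by auto
  define M' where "M' = max M n1"
  have tail: "(\<Sum>i. 1 / a (i + M')) \<le> 1 / (2 * D)" using M0[of M'] by (simp add: M'_def)
  have "\<exists>c. \<forall>n. c n \<ge> 0 \<and> (\<forall>z u f. cmod z \<le> \<rho> \<longrightarrow>
      coord (scaleC_ell2 z u + f) = jacobi_action a b (coord u) \<longrightarrow>
      cmod (coord u n) \<le> c n * (cmod (coord u 0) + norm f))"
    by (rule choice) (intro allI jacobi_coord_bound a)
  then obtain c where c: "\<And>n. c n \<ge> 0"
    "\<And>n z u f. cmod z \<le> \<rho> \<Longrightarrow> coord (scaleC_ell2 z u + f) = jacobi_action a b (coord u) \<Longrightarrow>
      cmod (coord u n) \<le> c n * (cmod (coord u 0) + norm f)"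
    by blast
  define K where "K = 2 * (\<Sum>n<M'. (c n)\<^sup>2) + 1"
  have K: "K \<ge> 0" unfolding K_def by (intro add_nonneg_nonneg mult_nonneg_nonneg sum_nonneg) auto
  have absorb: "x \<le> 2 * p + y" if "x \<le> (x + y) / 2 + p" for x y p :: real
    using that by (simp add: field_simps)
  have "norm u \<le> sqrt K * (cmod (coord u 0) + norm f)"
    if z: "cmod z \<le> \<rho>" and A: "(u, scaleC_ell2 z u + f) \<in> jacobi_matrix a b" for z u f
  proof -
    let ?E = "cmod (coord u 0) + norm f"
    have "(norm (scaleC_ell2 z u + f))\<^sup>2 \<le> (\<rho> * norm u + norm f)\<^sup>2"
      using norm_triangle_ineq[of "scaleC_ell2 z u" f] mult_right_mono[OF z norm_ge_zero[of u]]
      by (intro power_mono) (auto simp: norm_scaleC)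
    also have "\<dots> \<le> 2 * \<rho>\<^sup>2 * (norm u)\<^sup>2 + 2 * (norm f)\<^sup>2"
      using sum_squares_bound[of "\<rho> * norm u" "norm f"] by (simp add: power2_sum power_mult_distrib)
    finally have nf: "(norm u)\<^sup>2 + (norm (scaleC_ell2 z u + f))\<^sup>2
        \<le> (2 + 2 * \<rho>\<^sup>2) * ((norm u)\<^sup>2 + (norm f)\<^sup>2)"
      using mult_nonneg_nonneg[OF zero_le_power2[of \<rho>] zero_le_power2[of "norm f"]]
        zero_le_power2[of "norm u"]
      unfolding distrib_left distrib_right by linarith
    have coordn: "(cmod (coord u (i + M')))\<^sup>2 \<le> D * ((norm u)\<^sup>2 + (norm f)\<^sup>2) * (1 / a (i + M'))" for i
    proof -
      have "a (i + M') * (cmod (coord u (i + M')))\<^sup>2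
          \<le> C * ((norm u)\<^sup>2 + (norm (scaleC_ell2 z u + f))\<^sup>2)"
        by (rule decay[OF A]) (simp add: M'_def)
      also have "\<dots> \<le> \<bar>C\<bar> * ((2 + 2 * \<rho>\<^sup>2) * ((norm u)\<^sup>2 + (norm f)\<^sup>2))"
        using nf by (intro mult_mono) auto
      also have "\<dots> \<le> D * ((norm u)\<^sup>2 + (norm f)\<^sup>2)"
        unfolding D_def by (simp add: algebra_simps)
      finally show ?thesis using a[of "i + M'"] by (simp add: divide_simps mult.commute)
    qed
    have sh: "summable (\<lambda>i. 1 / a (i + M'))" by (rule summable_ignore_initial_segment[OF sum_a])
    have "(norm u)\<^sup>2 = (\<Sum>i. (cmod (coord u (i + M')))\<^sup>2) + (\<Sum>n<M'. (cmod (coord u n))\<^sup>2)"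
      unfolding norm_ell2_sq by (rule suminf_split_initial_segment[OF summable_coord])
    also have "(\<Sum>i. (cmod (coord u (i + M')))\<^sup>2)
        \<le> (\<Sum>i. D * ((norm u)\<^sup>2 + (norm f)\<^sup>2) * (1 / a (i + M')))"
      by (intro suminf_le coordn summable_mult sh summable_ignore_initial_segment summable_coord)
    also have "\<dots> = D * ((norm u)\<^sup>2 + (norm f)\<^sup>2) * (\<Sum>i. 1 / a (i + M'))"
      by (rule suminf_mult[OF sh])
    also have "\<dots> \<le> D * ((norm u)\<^sup>2 + (norm f)\<^sup>2) * (1 / (2 * D))"
      using D by (intro mult_left_mono tail) auto
    also have "\<dots> = ((norm u)\<^sup>2 + (norm f)\<^sup>2) / 2" using D by simp
    also have "(\<Sum>n<M'. (cmod (coord u n))\<^sup>2) \<le> (\<Sum>n<M'. (c n)\<^sup>2 * ?E\<^sup>2)"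
      unfolding power_mult_distrib[symmetric]
      by (intro sum_mono power_mono c(2)[OF z jacobi_matrix_action[OF A]]) simp
    finally have "(norm u)\<^sup>2 \<le> ((norm u)\<^sup>2 + (norm f)\<^sup>2) / 2 + (\<Sum>n<M'. (c n)\<^sup>2) * ?E\<^sup>2"
      by (simp add: sum_distrib_right[symmetric])
    then have "(norm u)\<^sup>2 \<le> 2 * ((\<Sum>n<M'. (c n)\<^sup>2) * ?E\<^sup>2) + (norm f)\<^sup>2"
      by (rule absorb)
    also have "(norm f)\<^sup>2 \<le> ?E\<^sup>2" by (intro power_mono) auto
    finally have "(norm u)\<^sup>2 \<le> K * ?E\<^sup>2"
      by (simp add: K_def distrib_right)
    also have "\<dots> = (sqrt K * ?E)\<^sup>2"
      using K by (simp add: power_mult_distrib)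
    finally have "(norm u)\<^sup>2 \<le> (sqrt K * ?E)\<^sup>2" .
    then show ?thesis by (rule power2_le_imp_le) (use K in simp)
  qed
  then show ?thesis by blast
qed

section \<open>Asymptotics of hyperbolic linear recurrences\<close>

lemma discrete_Gronwall:
  fixes x \<delta> \<Gamma> :: "nat \<Rightarrow> real"
  assumes step: "\<And>n. n \<ge> m \<Longrightarrow> x (Suc n) \<le> (1 + \<delta> n) * x n + \<Gamma> n"
    and nonneg: "\<And>n. n \<ge> m \<Longrightarrow> 0 \<le> \<delta> n" "\<And>n. n \<ge> m \<Longrightarrow> 0 \<le> \<Gamma> n" "0 \<le> x m"
    and "n \<ge> m"
  shows "x n \<le> (x m + sum \<Gamma> {m..<n}) * exp (sum \<delta> {m..<n})"
  using \<open>n \<ge> m\<close>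
proof (induction n rule: dec_induct)
  case (step n)
  let ?S = "x m + sum \<Gamma> {m..<n}" and ?D = "sum \<delta> {m..<n}"
  have \<delta>: "0 \<le> \<delta> n" and \<Gamma>: "0 \<le> \<Gamma> n" using nonneg step.hyps by auto
  have S: "0 \<le> ?S" "0 \<le> ?D" using nonneg by (auto intro!: add_nonneg_nonneg sum_nonneg)
  have "x (Suc n) \<le> (1 + \<delta> n) * x n + \<Gamma> n" using assms(1) step.hyps by simp
  also have "\<dots> \<le> exp (\<delta> n) * (?S * exp ?D) + exp (\<delta> n) * (\<Gamma> n * exp ?D)"
  proof (rule add_mono)
    show "(1 + \<delta> n) * x n \<le> exp (\<delta> n) * (?S * exp ?D)"
      by (rule order_trans[OF mult_left_mono[OF step.IH]])
         (use \<delta> S in \<open>auto intro!: mult_right_mono exp_ge_add_one_self\<close>)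
    have "1 * (\<Gamma> n * 1) \<le> exp (\<delta> n) * (\<Gamma> n * exp ?D)"
      using \<delta> \<Gamma> S by (intro mult_mono) auto
    then show "\<Gamma> n \<le> exp (\<delta> n) * (\<Gamma> n * exp ?D)" by simp
  qed
  also have "\<dots> = (x m + sum \<Gamma> {m..<Suc n}) * exp (sum \<delta> {m..<Suc n})"
    using step.hyps by (simp add: exp_add algebra_simps)
  finally show ?case .
qed simp

lemma exp_eighth_le_2: "x \<le> 1/8 \<Longrightarrow> exp x \<le> (2::real)"
  using exp_bound[of "1/8"]
  by (intro order_trans[of "exp x" "exp (1/8)" 2]) (auto simp: power2_eq_square)

text \<open>
  The sizes \<open>s\<close>, \<open>t\<close> of a stretched and a contracted component, coupled by a summable relative error \<open>\<delta>\<close>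
  and a summable absolute error \<open>\<Gamma>\<close>. Any bound on \<open>\<Sum>\<delta>\<close> below a small constant would do; with
  \<open>1/16\<close> the Gronwall factor \<open>exp (2 \<Sum>\<delta>)\<close> is at most \<open>2\<close>.
\<close>

locale perturbed_hyperbola =
  fixes s t \<kappa> \<delta> \<Gamma> :: "nat \<Rightarrow> real" and G :: real and m :: nat
  assumes nonneg: "\<And>n. 0 \<le> s n" "\<And>n. 0 \<le> t n" "\<And>n. 0 \<le> \<delta> n" "\<And>n. 0 \<le> \<Gamma> n"
    and \<kappa>: "\<And>n. n \<ge> m \<Longrightarrow> 1 \<le> \<kappa> n"
    and s: "\<And>n. n \<ge> m \<Longrightarrow> \<bar>s (Suc n) - \<kappa> n * s n\<bar> \<le> \<delta> n * (s n + t n) + \<Gamma> n"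
    and t: "\<And>n. n \<ge> m \<Longrightarrow> \<bar>t (Suc n) - t n / \<kappa> n\<bar> \<le> \<delta> n * (s n + t n) + \<Gamma> n"
    and sum_\<delta>: "\<And>n. sum \<delta> {m..<n} \<le> 1/16"
    and sum_\<Gamma>: "\<And>n. sum \<Gamma> {m..<n} \<le> G"
begin

definition K :: "nat \<Rightarrow> real" where "K n = prod \<kappa> {m..<n}"

lemma K_Suc: "n \<ge> m \<Longrightarrow> K (Suc n) = \<kappa> n * K n"
  by (simp add: K_def)

lemma K_ge_1: "n \<ge> m \<Longrightarrow> 1 \<le> K n"
  unfolding K_def using \<kappa> by (intro prod_ge_1) auto

lemma G_nonneg: "0 \<le> G" using sum_\<Gamma>[of m] by simp

text \<open>After division by the accumulated stretching \<open>K\<close> the stretched component only drifts by the errors and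
  the contracted one can only gain from them. Since \<open>\<kappa> \<ge> 1\<close>, the division does not enlarge the errors.\<close>

lemma scaled_step:
  assumes n: "n \<ge> m"
  defines "x \<equiv> \<lambda>n. s n / K n" and "y \<equiv> \<lambda>n. t n / K n"
  shows "x (Suc n) \<le> x n + (\<delta> n * (x n + y n) + \<Gamma> n)"
    and "x (Suc n) \<ge> x n - (\<delta> n * (x n + y n) + \<Gamma> n)"
    and "y (Suc n) \<le> y n + (\<delta> n * (x n + y n) + \<Gamma> n)"
proof -
  note k = \<kappa>[OF n] and K = K_ge_1[OF n]
  have e: "0 \<le> \<delta> n * (s n + t n)" "0 \<le> \<Gamma> n" using nonneg by simp_all
  have kK: "K n \<le> \<kappa> n * K n" "1 \<le> \<kappa> n * K n"
    using k K mult_mono[of 1 "\<kappa> n" "K n" "K n"] mult_mono[of 1 "\<kappa> n" 1 "K n"] by auto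
  have err: "(\<delta> n * (s n + t n) + \<Gamma> n) / (\<kappa> n * K n) \<le> \<delta> n * (x n + y n) + \<Gamma> n"
  proof -
    have "(\<delta> n * (s n + t n)) / (\<kappa> n * K n) \<le> (\<delta> n * (s n + t n)) / K n"
      using kK e K by (intro divide_left_mono) auto
    moreover have "\<Gamma> n / (\<kappa> n * K n) \<le> \<Gamma> n / 1"
      using kK e by (intro divide_left_mono) auto
    moreover have "\<delta> n * (x n + y n) = \<delta> n * (s n + t n) / K n"
      unfolding x_def y_def add_divide_distrib[symmetric] by simp
    ultimately show ?thesis
      unfolding add_divide_distrib[of "\<delta> n * (s n + t n)" "\<Gamma> n"] by simp
  qed
  have split: "z / (\<kappa> n * K n) + w / (\<kappa> n * K n) = (z + w) / (\<kappa> n * K n)" for z w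
    by (simp add: add_divide_distrib)
  have kx: "\<kappa> n * s n / (\<kappa> n * K n) = x n" using k by (simp add: x_def)
  have "s (Suc n) / (\<kappa> n * K n) \<le> (\<kappa> n * s n + (\<delta> n * (s n + t n) + \<Gamma> n)) / (\<kappa> n * K n)"
    using s[OF n] kK by (intro divide_right_mono) auto
  then show "x (Suc n) \<le> x n + (\<delta> n * (x n + y n) + \<Gamma> n)"
    using err kx by (simp add: K_Suc[OF n] x_def[of] split[symmetric])
  have "(\<kappa> n * s n - (\<delta> n * (s n + t n) + \<Gamma> n)) / (\<kappa> n * K n) \<le> s (Suc n) / (\<kappa> n * K n)"
    using s[OF n] kK by (intro divide_right_mono) auto
  then show "x (Suc n) \<ge> x n - (\<delta> n * (x n + y n) + \<Gamma> n)"
    using err kx by (simp add: K_Suc[OF n] x_def diff_divide_distrib)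
  have "t (Suc n) / (\<kappa> n * K n) \<le> (t n / \<kappa> n + (\<delta> n * (s n + t n) + \<Gamma> n)) / (\<kappa> n * K n)"
    using t[OF n] kK by (intro divide_right_mono) auto
  also have "\<dots> = t n / \<kappa> n / (\<kappa> n * K n) + (\<delta> n * (s n + t n) + \<Gamma> n) / (\<kappa> n * K n)"
    by (rule add_divide_distrib)
  also have "t n / \<kappa> n / (\<kappa> n * K n) \<le> t n / 1 / K n"
    using k K kK nonneg(2)[of n] by (intro frac_le) auto
  finally show "y (Suc n) \<le> y n + (\<delta> n * (x n + y n) + \<Gamma> n)"
    using err by (simp add: K_Suc[OF n] y_def)
qed

lemma upper_bound:
  assumes n: "n \<ge> m"
  shows "s n + t n \<le> 2 * (s m + t m + 2 * G) * K n"
proof -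
  let ?x = "\<lambda>n. s n / K n + t n / K n"
  have "?x n \<le> (?x m + sum (\<lambda>k. 2 * \<Gamma> k) {m..<n}) * exp (sum (\<lambda>k. 2 * \<delta> k) {m..<n})"
  proof (rule discrete_Gronwall[OF _ _ _ _ n])
    show "?x (Suc n) \<le> (1 + 2 * \<delta> n) * ?x n + 2 * \<Gamma> n" if "n \<ge> m" for n
    proof -
      have eq: "(1 + 2 * \<delta> n) * ?x n + 2 * \<Gamma> n = ?x n + 2 * (\<delta> n * ?x n + \<Gamma> n)"
        by (simp add: algebra_simps)
      have add: "x' + y' \<le> x + y + 2 * e" if "x' \<le> x + e" "y' \<le> y + e" for x x' y y' e :: real
        using that by simp
      show ?thesis unfolding eq by (rule add[OF scaled_step(1,3)[OF that]])
    qed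
    show "0 \<le> ?x m" using nonneg K_ge_1[of m] by simp
  qed (use nonneg in auto)
  also have "\<dots> \<le> (s m + t m + 2 * G) * 2"
  proof (rule mult_mono)
    show "?x m + sum (\<lambda>k. 2 * \<Gamma> k) {m..<n} \<le> s m + t m + 2 * G"
      using sum_\<Gamma>[of n] by (simp add: K_def sum_distrib_left[symmetric])
    show "exp (sum (\<lambda>k. 2 * \<delta> k) {m..<n}) \<le> 2"
      using sum_\<delta>[of n] by (intro exp_eighth_le_2) (simp add: sum_distrib_left[symmetric])
  qed (use nonneg G_nonneg in auto)
  finally show ?thesis
    using K_ge_1[OF n] by (simp add: add_divide_distrib[symmetric] pos_divide_le_eq mult_ac)
qed

text \<open>Once the stretched component dominates, the total drift of \<open>s/K\<close> is at most half of its size, because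
  \<open>upper_bound\<close> controls \<open>s + t\<close> in every error term.\<close>

lemma lower_bound:
  assumes dom: "s m > t m + 4 * G" and n: "n \<ge> m"
  shows "s n \<ge> s m / 2 * K n"
proof -
  have sm: "4 * G \<le> s m" "t m \<le> s m" "s m \<ge> 0" using dom nonneg(2)[of m] G_nonneg by linarith+
  have "s n / K n \<ge> s m - sum (\<lambda>k. \<delta> k * (4 * s m) + \<Gamma> k) {m..<n}"
    using n
  proof (induction n rule: dec_induct)
    case base
    then show ?case by (simp add: K_def)
  next
    case (step n)
    have "s n / K n + t n / K n \<le> 2 * (s m + t m + 2 * G)"
      using upper_bound[of n] K_ge_1[of n] step.hyps
      by (simp add: add_divide_distrib[symmetric] pos_divide_le_eq)
    also have "\<dots> \<le> 4 * s m" using dom G_nonneg by simp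
    finally have "\<delta> n * (s n / K n + t n / K n) \<le> \<delta> n * (4 * s m)"
      using nonneg by (intro mult_left_mono)
    with scaled_step(2)[of n] step show ?case by simp
  qed
  moreover have "sum (\<lambda>k. \<delta> k * (4 * s m) + \<Gamma> k) {m..<n} \<le> s m / 2"
  proof -
    have "sum (\<lambda>k. \<delta> k * (4 * s m) + \<Gamma> k) {m..<n} = sum \<delta> {m..<n} * (4 * s m) + sum \<Gamma> {m..<n}"
      by (simp add: sum.distrib sum_distrib_right)
    also have "\<dots> \<le> 1/16 * (4 * s m) + G"
      using sm by (intro add_mono mult_right_mono sum_\<delta> sum_\<Gamma>) auto
    finally show ?thesis using sm by simp
  qed
  ultimately have "s m / 2 \<le> s n / K n" by linarith
  then show ?thesis using K_ge_1[OF n] by (simp add: pos_le_divide_eq)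
qed

text \<open>As long as the stretched component is slaved to the contracted one, the latter satisfies a Gronwall
  inequality on its own, in which \<open>\<kappa>\<close> only helps.\<close>

lemma bounded_if_not_dominated:
  assumes dom: "\<And>n. n \<ge> m \<Longrightarrow> s n \<le> t n + 4 * G" and n: "n \<ge> m"
  shows "s n + t n \<le> 4 * t m + 12 * G"
proof -
  have "t n \<le> (t m + sum (\<lambda>k. 4 * G * \<delta> k + \<Gamma> k) {m..<n}) * exp (sum (\<lambda>k. 2 * \<delta> k) {m..<n})"
  proof (rule discrete_Gronwall[OF _ _ _ _ n])
    show "t (Suc n) \<le> (1 + 2 * \<delta> n) * t n + (4 * G * \<delta> n + \<Gamma> n)" if n: "n \<ge> m" for n
    proof -
      have "t n / \<kappa> n \<le> t n / 1" using \<kappa>[OF n] nonneg by (intro divide_left_mono) auto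
      moreover have "\<delta> n * (s n + t n) \<le> \<delta> n * (2 * t n + 4 * G)"
        using dom[OF n] nonneg by (intro mult_left_mono) auto
      ultimately show ?thesis using t[OF n] by (simp add: algebra_simps)
    qed
  qed (use nonneg G_nonneg in auto)
  also have "\<dots> \<le> (t m + 2 * G) * 2"
  proof (rule mult_mono)
    have "sum (\<lambda>k. 4 * G * \<delta> k + \<Gamma> k) {m..<n} \<le> 4 * G * (1/16) + G"
      unfolding sum.distrib sum_distrib_left[symmetric]
      using G_nonneg by (intro add_mono mult_left_mono sum_\<delta> sum_\<Gamma>) auto
    then show "t m + sum (\<lambda>k. 4 * G * \<delta> k + \<Gamma> k) {m..<n} \<le> t m + 2 * G" using G_nonneg by simp
    show "exp (sum (\<lambda>k. 2 * \<delta> k) {m..<n}) \<le> 2"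
      using sum_\<delta>[of n] by (intro exp_eighth_le_2) (simp add: sum_distrib_left[symmetric])
  qed (use nonneg G_nonneg in auto)
  finally show ?thesis using dom[OF n] by simp
qed

end

text \<open>
  One step is \<open>c + d T\<close>, where the involution \<open>T\<close> has eigenvalues \<open>\<plusminus>1\<close>; thus \<open>v + T v\<close> and
  \<open>v - T v\<close> are (twice) the spectral components of \<open>v\<close>, multiplied by \<open>c + d\<close> and \<open>c - d\<close>. The relation
  \<open>|c - d| = 1/|c + d|\<close> is the normalisation of the determinant. Working with \<open>T\<close> instead of eigenvectors
  avoids choosing bases that vary with \<open>n\<close>.
\<close>

locale hyperbolic_recurrence =
  fixes T :: "nat \<Rightarrow> 'v \<Rightarrow> 'v :: real_normed_vector" and c d \<kappa> \<delta> :: "nat \<Rightarrow> real"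
    and \<tau> L :: real and m :: nat
  assumes linear: "\<And>n. linear (T n)"
    and involution: "\<And>n v. n \<ge> m \<Longrightarrow> T n (T n v) = v"
    and T_bound: "\<And>n v. n \<ge> m \<Longrightarrow> norm (T n v) \<le> \<tau> * norm v"
    and T_variation: "\<And>n v. n \<ge> m \<Longrightarrow> norm (T (Suc n) v - T n v) \<le> \<delta> n * norm v"
    and eigenvalues: "\<And>n. n \<ge> m \<Longrightarrow> \<bar>c n + d n\<bar> = \<kappa> n" "\<And>n. n \<ge> m \<Longrightarrow> \<bar>c n - d n\<bar> = 1 / \<kappa> n"
    and \<kappa>: "\<And>n. n \<ge> m \<Longrightarrow> 1 \<le> \<kappa> n"
    and step_bound: "\<And>n v. n \<ge> m \<Longrightarrow> norm (c n *\<^sub>R v + d n *\<^sub>R T n v) \<le> L * norm v"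
    and pos: "\<tau> \<ge> 0" "L \<ge> 1" "\<And>n. 0 \<le> \<delta> n"
    and sum_\<delta>: "\<And>n. L * sum \<delta> {m..<n} \<le> 1/16"
begin

lemma \<delta>_le_1: assumes "n \<ge> m" shows "\<delta> n \<le> 1"
proof -
  have "\<delta> n \<le> sum \<delta> {m..<Suc n}"
    using assms pos by (intro member_le_sum) auto
  also have "\<dots> \<le> L * sum \<delta> {m..<Suc n}"
    using pos mult_right_mono[of 1 L "sum \<delta> {m..<Suc n}"] by (simp add: sum_nonneg)
  finally show ?thesis using sum_\<delta>[of "Suc n"] by simp
qed

lemma norm_plus_minus: 
  assumes n: "n \<ge> m"
  shows "norm v \<le> norm (v + T n v) + norm (v - T n v)"
    and "norm (v + T n v) \<le> (1 + \<tau>) * norm v" "norm (v - T n v) \<le> (1 + \<tau>) * norm v"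
proof -
  have "2 * norm v = norm ((v + T n v) + (v - T n v))" by (simp add: scaleR_2[symmetric])
  also have "\<dots> \<le> norm (v + T n v) + norm (v - T n v)" by (rule norm_triangle_ineq)
  finally show "norm v \<le> norm (v + T n v) + norm (v - T n v)" using norm_ge_zero[of v] by linarith
  show "norm (v + T n v) \<le> (1 + \<tau>) * norm v" "norm (v - T n v) \<le> (1 + \<tau>) * norm v"
    using norm_triangle_ineq[of v "T n v"] norm_triangle_ineq4[of v "T n v"] T_bound[OF n, of v]
    by (simp_all add: algebra_simps)
qed

text \<open>Applying \<open>1 \<plusminus> T n\<close> to the recurrence gives the exact stretching; passing to \<open>1 \<plusminus> T (Suc n)\<close> costs the
  variation of \<open>T\<close>, that is a relative error \<open>\<delta>\<close>. The starting index \<open>k\<close> is arbitrary, since the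
  moment at which the stretched component becomes dominant is not known in advance.\<close>

lemma hyperbola:
  assumes w: "\<And>n. n \<ge> m \<Longrightarrow> w (Suc n) = c n *\<^sub>R w n + d n *\<^sub>R T n (w n) + g n"
    and g: "\<And>n. sum (\<lambda>k. norm (g k)) {m..<n} \<le> G"
    and k: "k \<ge> m"
  shows "perturbed_hyperbola (\<lambda>n. norm (w n + T n (w n))) (\<lambda>n. norm (w n - T n (w n))) \<kappa>
    (\<lambda>n. L * \<delta> n) (\<lambda>n. (2 + \<tau>) * norm (g n)) ((2 + \<tau>) * G) k"
proof
  have T: "T n (x + y) = T n x + T n y" "T n (x - y) = T n x - T n y" "T n (r *\<^sub>R x) = r *\<^sub>R T n x" for n x y r
    using linear[of n] by (simp_all add: linear_add linear_diff linear_scale)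
  \<comment> \<open>Both components at once: \<open>e = 1\<close> is the stretched one, \<open>e = -1\<close> the contracted one.\<close>
  have close: "\<bar>norm (w (Suc n) + e *\<^sub>R T (Suc n) (w (Suc n))) - \<bar>c n + e * d n\<bar> * norm (w n + e *\<^sub>R T n (w n))\<bar>
      \<le> L * \<delta> n * (norm (w n + T n (w n)) + norm (w n - T n (w n))) + (2 + \<tau>) * norm (g n)"
    if n: "n \<ge> m" and e: "e * e = 1" "\<bar>e\<bar> = 1" for n e
  proof -
    let ?w = "w n" and ?w' = "w (Suc n)"
    have "?w' + e *\<^sub>R T n ?w' = (c n + e * d n) *\<^sub>R (?w + e *\<^sub>R T n ?w) + (g n + e *\<^sub>R T n (g n))"
      using e by (simp add: w[OF n] T involution[OF n] algebra_simps)
    then have eq: "?w' + e *\<^sub>R T (Suc n) ?w' - (c n + e * d n) *\<^sub>R (?w + e *\<^sub>R T n ?w)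
        = e *\<^sub>R (T (Suc n) ?w' - T n ?w') + (g n + e *\<^sub>R T n (g n))"
      by (simp add: algebra_simps)
    let ?s = "norm (?w + T n ?w)" and ?t = "norm (?w - T n ?w)"
    have "norm (e *\<^sub>R (T (Suc n) ?w' - T n ?w') + (g n + e *\<^sub>R T n (g n)))
        \<le> norm (e *\<^sub>R (T (Suc n) ?w' - T n ?w')) + (norm (g n) + norm (e *\<^sub>R T n (g n)))"
      by (intro order_trans[OF norm_triangle_ineq] add_left_mono norm_triangle_ineq)
    moreover have "norm (e *\<^sub>R (T (Suc n) ?w' - T n ?w')) \<le> \<delta> n * norm ?w'"
      using T_variation[OF n, of ?w'] e by simp
    moreover have "norm (e *\<^sub>R T n (g n)) \<le> \<tau> * norm (g n)"
      using T_bound[OF n, of "g n"] e by simp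
    moreover have "\<delta> n * norm ?w' \<le> L * \<delta> n * norm ?w + \<delta> n * norm (g n)"
    proof -
      have "norm ?w' \<le> L * norm ?w + norm (g n)"
        unfolding w[OF n] by (rule order_trans[OF norm_triangle_ineq add_right_mono[OF step_bound[OF n]]])
      from mult_left_mono[OF this pos(3)[of n]] show ?thesis by (simp add: algebra_simps)
    qed
    moreover have "\<delta> n * norm (g n) \<le> norm (g n)"
      using mult_right_mono[OF \<delta>_le_1[OF n] norm_ge_zero[of "g n"]] by simp
    moreover have "L * \<delta> n * norm ?w \<le> L * \<delta> n * (?s + ?t)"
      using pos by (intro mult_left_mono norm_plus_minus(1) n) auto
    moreover have "(2 + \<tau>) * norm (g n) = 2 * norm (g n) + \<tau> * norm (g n)"
      by (simp add: algebra_simps)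
    ultimately have "norm (?w' + e *\<^sub>R T (Suc n) ?w' - (c n + e * d n) *\<^sub>R (?w + e *\<^sub>R T n ?w))
        \<le> L * \<delta> n * (?s + ?t) + (2 + \<tau>) * norm (g n)"
      unfolding eq by linarith
    moreover have "\<bar>norm (?w' + e *\<^sub>R T (Suc n) ?w') - norm ((c n + e * d n) *\<^sub>R (?w + e *\<^sub>R T n ?w))\<bar>
        \<le> norm (?w' + e *\<^sub>R T (Suc n) ?w' - (c n + e * d n) *\<^sub>R (?w + e *\<^sub>R T n ?w))"
      by (rule norm_triangle_ineq3)
    ultimately show ?thesis by simp
  qed
  fix n
  show "\<bar>norm (w (Suc n) + T (Suc n) (w (Suc n))) - \<kappa> n * norm (w n + T n (w n))\<bar>
      \<le> L * \<delta> n * (norm (w n + T n (w n)) + norm (w n - T n (w n))) + (2 + \<tau>) * norm (g n)" if "k \<le> n"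
    using close[of n 1] that k eigenvalues(1)[of n] by simp
  show "\<bar>norm (w (Suc n) - T (Suc n) (w (Suc n))) - norm (w n - T n (w n)) / \<kappa> n\<bar>
      \<le> L * \<delta> n * (norm (w n + T n (w n)) + norm (w n - T n (w n))) + (2 + \<tau>) * norm (g n)" if "k \<le> n"
    using close[of n "-1"] that k eigenvalues(2)[of n] by simp
  show "1 \<le> \<kappa> n" if "k \<le> n" using that k by (intro \<kappa>) simp
  have "(\<Sum>n = k..<n. L * \<delta> n) \<le> (\<Sum>n = m..<n. L * \<delta> n)"
    using k pos by (intro sum_mono2) auto
  then show "(\<Sum>n = k..<n. L * \<delta> n) \<le> 1 / 16"
    using sum_\<delta>[of n] by (simp add: sum_distrib_left)
  have "(\<Sum>n = k..<n. (2 + \<tau>) * norm (g n)) \<le> (\<Sum>n = m..<n. (2 + \<tau>) * norm (g n))"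
    using k pos by (intro sum_mono2) auto
  also have "\<dots> \<le> (2 + \<tau>) * G"
    unfolding sum_distrib_left[symmetric] using pos by (intro mult_left_mono g) auto
  finally show "(\<Sum>n = k..<n. (2 + \<tau>) * norm (g n)) \<le> (2 + \<tau>) * G" .
qed (use pos in auto)

lemma homogeneous_upper_bound:
  assumes w: "\<And>n. n \<ge> m \<Longrightarrow> w (Suc n) = c n *\<^sub>R w n + d n *\<^sub>R T n (w n)" and n: "n \<ge> m"
  shows "norm (w n) \<le> 4 * (1 + \<tau>) * norm (w m) * prod \<kappa> {m..<n}"
proof -
  interpret perturbed_hyperbola "\<lambda>n. norm (w n + T n (w n))" "\<lambda>n. norm (w n - T n (w n))" \<kappa>
    "\<lambda>n. L * \<delta> n" "\<lambda>n. (2 + \<tau>) * norm (0 :: 'v)" "(2 + \<tau>) * 0" m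
    by (rule hyperbola[where g = "\<lambda>_. 0"]) (use w in auto)
  have "norm (w n) \<le> norm (w n + T n (w n)) + norm (w n - T n (w n))"
    by (rule norm_plus_minus(1)[OF n])
  also have "\<dots> \<le> 2 * (norm (w m + T m (w m)) + norm (w m - T m (w m)) + 2 * ((2 + \<tau>) * 0)) * K n"
    by (rule upper_bound[OF n])
  also have "\<dots> \<le> 2 * (2 * ((1 + \<tau>) * norm (w m))) * K n"
    using norm_plus_minus(2,3)[of m "w m"] K_ge_1[OF n] by (intro mult_right_mono) auto
  finally show ?thesis by (simp add: K_def algebra_simps)
qed

text \<open>The alternative is whether the stretched component ever exceeds the contracted one by more than the
  inhomogeneity can account for. If it does, \<open>lower_bound\<close> applies from then on; the rate
  \<open>prod \<kappa>\<close> is the one of \<open>homogeneous_upper_bound\<close>.\<close>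

lemma bounded_or_growing:
  assumes w: "\<And>n. n \<ge> m \<Longrightarrow> w (Suc n) = c n *\<^sub>R w n + d n *\<^sub>R T n (w n) + g n"
    and g: "\<And>n. sum (\<lambda>k. norm (g k)) {m..<n} \<le> G"
  shows "(\<forall>n\<ge>m. norm (w n) \<le> 12 * (2 + \<tau>) * (norm (w m) + G)) \<or>
    (\<exists>k\<ge>m. \<exists>e>0. \<forall>n\<ge>k. norm (w n) \<ge> e * prod \<kappa> {m..<n})"
proof (cases "\<exists>k\<ge>m. norm (w k + T k (w k)) > norm (w k - T k (w k)) + 4 * ((2 + \<tau>) * G)")
  case True
  then obtain k where k: "k \<ge> m" "norm (w k + T k (w k)) > norm (w k - T k (w k)) + 4 * ((2 + \<tau>) * G)"
    by blast
  interpret perturbed_hyperbola "\<lambda>n. norm (w n + T n (w n))" "\<lambda>n. norm (w n - T n (w n))" \<kappa>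
    "\<lambda>n. L * \<delta> n" "\<lambda>n. (2 + \<tau>) * norm (g n)" "(2 + \<tau>) * G" k
    by (rule hyperbola[OF w g k(1)])
  let ?s = "norm (w k + T k (w k))"
  define P where "P = prod \<kappa> {m..<k}"
  define Q where "Q = (1 + \<tau>) * P"
  define e where "e = ?s / 2 / Q"
  have P: "P \<ge> 1" unfolding P_def by (intro prod_ge_1) (use hyperbolic_recurrence.\<kappa>[OF hyperbolic_recurrence_axioms] in auto)
  have Q: "Q > 0" using P pos by (simp add: Q_def)
  have s: "?s > 0" using k(2) G_nonneg norm_ge_zero[of "w k - T k (w k)"] by linarith
  have "norm (w n) \<ge> e * prod \<kappa> {m..<n}" if n: "n \<ge> k" for n
  proof -
    have "prod \<kappa> {m..<n} = P * K n"
      using k n by (simp add: P_def K_def prod.atLeastLessThan_concat)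
    moreover have "e * Q = ?s / 2" using Q by (simp add: e_def)
    ultimately have "e * prod \<kappa> {m..<n} * (1 + \<tau>) = ?s / 2 * K n"
      by (simp add: Q_def mult_ac)
    also have "\<dots> \<le> norm (w n + T n (w n))" by (rule lower_bound[OF k(2) n])
    also have "\<dots> \<le> norm (w n) * (1 + \<tau>)"
      using norm_plus_minus(2)[of n "w n"] n k by (simp add: mult.commute)
    finally show ?thesis using pos by simp
  qed
  moreover have "e > 0" unfolding e_def using s Q by simp
  ultimately show ?thesis using k by blast
next
  case False
  interpret perturbed_hyperbola "\<lambda>n. norm (w n + T n (w n))" "\<lambda>n. norm (w n - T n (w n))" \<kappa>
    "\<lambda>n. L * \<delta> n" "\<lambda>n. (2 + \<tau>) * norm (g n)" "(2 + \<tau>) * G" m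
    by (rule hyperbola[OF w g order_refl])
  have "norm (w n) \<le> 12 * (2 + \<tau>) * (norm (w m) + G)" if n: "n \<ge> m" for n
  proof -
    have "norm (w n) \<le> norm (w n + T n (w n)) + norm (w n - T n (w n))"
      by (rule norm_plus_minus(1)[OF n])
    also have "\<dots> \<le> 4 * norm (w m - T m (w m)) + 12 * ((2 + \<tau>) * G)"
      by (rule bounded_if_not_dominated[OF _ n]) (use False in force)
    also have "\<dots> \<le> 4 * ((1 + \<tau>) * norm (w m)) + 12 * ((2 + \<tau>) * G)"
      using norm_plus_minus(3)[of m "w m"] by simp
    also have "\<dots> \<le> 12 * (2 + \<tau>) * (norm (w m) + G)"
      using mult_nonneg_nonneg[OF pos(1) norm_ge_zero[of "w m"]] norm_ge_zero[of "w m"]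
      unfolding distrib_left distrib_right by linarith
    finally show ?thesis .
  qed
  then show ?thesis by blast
qed

end

section \<open>Two-by-two matrices\<close>

lemma norm_matrix_vector_mult_le:
  fixes M :: "real^'n^'m" shows "norm (M *v v) \<le> norm M * norm v"
proof -
  have "norm (M *v v) = L2_set (\<lambda>i. norm ((M *v v) $ i)) UNIV" by (simp add: norm_vec_def)
  also have "\<dots> \<le> L2_set (\<lambda>i. norm (M $ i) * norm v) UNIV"
    by (intro L2_set_mono) (auto simp: matrix_vector_mul_component Cauchy_Schwarz_ineq2)
  also have "\<dots> = norm M * norm v" by (simp add: norm_vec_def[of M] L2_set_left_distrib)
  finally show ?thesis .
qed

text \<open>Together with \<open>mat_op_diff\<close> this transfers bounded variation from the operator norm to the norm of
  \<open>real^2^2\<close>, in which the later estimates are made.\<close>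

lemma norm_le_norm_mat_op: "norm M \<le> 4 * norm (mat_op M)"
proof -
  have entry: "norm (M $ i $ j) \<le> norm (mat_op M)" for i j
  proof -
    have "M $ i $ j = blinfun_apply (mat_op M) (axis j 1) $ i"
      by (simp add: blinfun_apply_mat_op matrix_vector_mult_basis column_def)
    also have "norm \<dots> \<le> norm (blinfun_apply (mat_op M) (axis j 1))" by (rule Finite_Cartesian_Product.norm_nth_le)
    also have "\<dots> \<le> norm (mat_op M)" using norm_blinfun[of "mat_op M" "axis j 1"] by simp
    finally show ?thesis .
  qed
  have "norm M \<le> (\<Sum>i\<in>UNIV. norm (M $ i))"
    unfolding norm_vec_def[of M] by (rule L2_set_le_sum) simp
  also have "\<dots> \<le> (\<Sum>i\<in>(UNIV :: 2 set). \<Sum>j\<in>(UNIV :: 2 set). norm (M $ i $ j))"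
    unfolding norm_vec_def by (intro sum_mono L2_set_le_sum) simp
  also have "\<dots> \<le> 4 * norm (mat_op M)"
    using entry[of 1 1] entry[of 1 2] entry[of 2 1] entry[of 2 2] by (simp add: sum_2)
  finally show ?thesis .
qed

lemma mat_op_diff: "mat_op X - mat_op Y = mat_op (X - Y)"
  by (rule blinfun_eqI)
    (simp add: blinfun_apply_mat_op blinfun.diff_left matrix_vector_mult_diff_rdistrib)

lemma D1_imp_summable_variation:
  assumes "(\<lambda>n. mat_op (R n)) \<in> D1"
  shows "summable (\<lambda>n. norm (R (Suc n) - R n))"
proof -
  have "summable (\<lambda>n. 4 * norm (mat_op (R (n + 2)) - mat_op (R (n + 1))))"
    using assms by (intro summable_mult) (simp add: D1_def)
  then have "summable (\<lambda>n. norm (R (Suc (n + 1)) - R (n + 1)))"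
    by (rule summable_comparison_test_ev[rotated])
      (simp add: mat_op_diff norm_le_norm_mat_op)
  then show ?thesis using summable_iff_shift[of "\<lambda>n. norm (R (Suc n) - R n)" 1] by simp
qed

lemma summable_variation_prod:
  assumes "bounded_bilinear B"
    and f: "summable (\<lambda>n. norm (f (Suc n) - f n))" and bf: "Bseq f"
    and g: "summable (\<lambda>n. norm (g (Suc n) - g n))" and bg: "Bseq g"
  shows "summable (\<lambda>n. norm (B (f (Suc n)) (g (Suc n)) - B (f n) (g n)))"
proof -
  interpret bounded_bilinear B by fact
  obtain K where K: "0 < K" "\<And>a b. norm (B a b) \<le> norm a * norm b * K"
    using pos_bounded by blast
  obtain F where F: "\<And>n. norm (f n) \<le> F" using bf by (auto simp: Bseq_def)
  obtain G where G: "\<And>n. norm (g n) \<le> G" using bg by (auto simp: Bseq_def)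
  have dominant: "summable (\<lambda>n. F * K * norm (g (Suc n) - g n) + G * K * norm (f (Suc n) - f n))"
    by (intro summable_add summable_mult f g)
  have "norm (B (f (Suc n)) (g (Suc n)) - B (f n) (g n))
      \<le> F * K * norm (g (Suc n) - g n) + G * K * norm (f (Suc n) - f n)" for n
  proof -
    have "B (f (Suc n)) (g (Suc n)) - B (f n) (g n)
        = B (f (Suc n)) (g (Suc n) - g n) + B (f (Suc n) - f n) (g n)"
      by (simp add: diff_left diff_right)
    also have "norm \<dots> \<le> norm (f (Suc n)) * norm (g (Suc n) - g n) * K
        + norm (f (Suc n) - f n) * norm (g n) * K"
      by (intro order_trans[OF norm_triangle_ineq] add_mono K)
    also have "\<dots> \<le> F * norm (g (Suc n) - g n) * K + norm (f (Suc n) - f n) * G * K"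
      using K(1) F G order_trans[OF norm_ge_zero F] order_trans[OF norm_ge_zero G]
      by (intro add_mono mult_mono) auto
    finally show ?thesis by (simp add: mult_ac)
  qed
  then show ?thesis by (intro summable_comparison_test'[OF dominant, of 0]) simp
qed

lemma inverse_sqrt_Lipschitz:
  assumes "0 < \<epsilon>" "\<epsilon> \<le> x" "\<epsilon> \<le> y"
  shows "\<bar>1 / sqrt x - 1 / sqrt y\<bar> \<le> (1 / (\<epsilon> * sqrt \<epsilon>)) * \<bar>x - (y::real)\<bar>"
proof -
  have pos: "sqrt \<epsilon> > 0" "sqrt \<epsilon> \<le> sqrt x" "sqrt \<epsilon> \<le> sqrt y" using assms by auto
  then have pos': "sqrt x > 0" "sqrt y > 0" by linarith+
  have "1 / p - 1 / q = (q\<^sup>2 - p\<^sup>2) / (p * q * (p + q))" if "p > 0" "q > 0" for p q :: real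
  proof -
    have "(q\<^sup>2 - p\<^sup>2) / (p * q * (p + q)) = ((q - p) * (p + q)) / ((p * q) * (p + q))"
      by (simp add: power2_eq_square algebra_simps)
    also have "\<dots> = (q - p) / (p * q)" using that by simp
    finally show ?thesis using that by (simp add: diff_divide_distrib)
  qed
  from this[OF pos'] have "1 / sqrt x - 1 / sqrt y = (y - x) / (sqrt x * sqrt y * (sqrt x + sqrt y))"
    using assms by simp
  then have "\<bar>1 / sqrt x - 1 / sqrt y\<bar> = \<bar>x - y\<bar> / (sqrt x * sqrt y * (sqrt x + sqrt y))"
    using pos' by (simp add: abs_mult abs_minus_commute)
  also have "\<dots> \<le> \<bar>x - y\<bar> / (sqrt \<epsilon> * sqrt \<epsilon> * sqrt \<epsilon>)"
    using pos pos' add_mono[OF pos(2), of 0 "sqrt y"]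
    by (intro divide_left_mono mult_mono mult_pos_pos add_pos_pos) auto
  finally show ?thesis using assms by (simp add: mult.commute)
qed

text \<open>By Cayley and Hamilton the square of the traceless part is the discriminant. Hence, for a positive
  discriminant, it becomes an involution after division by the root, and a polynomial in \<open>R\<close>: it
  commutes with everything that \<open>R\<close> commutes with.\<close>

definition traceless_part :: "real^2^2 \<Rightarrow> real^2^2" where
  "traceless_part R = 2 *\<^sub>R R - trace R *\<^sub>R mat 1"

text \<open>The sign \<open>\<sigma>\<close> orders the eigenspaces so that \<open>\<sigma> + R/\<gamma>\<close> has its eigenvalue of larger modulus on the
  space where the involution is \<open>1\<close>.\<close>

definition spectral_involution :: "real \<Rightarrow> real^2^2 \<Rightarrow> real^2^2" where
  "spectral_involution \<sigma> R = (\<sigma> / sqrt (discr R)) *\<^sub>R traceless_part R"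

lemmas mat2_simps = vec_eq_iff forall_2 matrix_vector_mult_def matrix_matrix_mult_def sum_2
  trace_def det_2 mat_def discr_def

lemma traceless_part_square: "traceless_part R *v (traceless_part R *v v) = discr R *\<^sub>R v"
proof -
  have "(traceless_part R *v (traceless_part R *v v)) $ 1 = (discr R *\<^sub>R v) $ 1"
    by (simp add: traceless_part_def mat2_simps power2_eq_square) algebra
  moreover have "(traceless_part R *v (traceless_part R *v v)) $ 2 = (discr R *\<^sub>R v) $ 2"
    by (simp add: traceless_part_def mat2_simps power2_eq_square) algebra
  ultimately show ?thesis by (simp add: vec_eq_iff forall_2)
qed

lemma spectral_involution_involutive:
  assumes "discr R > 0" "\<sigma>\<^sup>2 = 1"
  shows "spectral_involution \<sigma> R *v (spectral_involution \<sigma> R *v v) = v"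
proof -
  have "spectral_involution \<sigma> R *v (spectral_involution \<sigma> R *v v)
      = (\<sigma> / sqrt (discr R))\<^sup>2 *\<^sub>R (traceless_part R *v (traceless_part R *v v))"
    by (simp add: spectral_involution_def scaleR_matrix_vector_assoc[symmetric]
        matrix_vector_mult_scaleR power2_eq_square)
  then show ?thesis using assms by (simp add: traceless_part_square power_divide)
qed

lemma spectral_decomposition:
  assumes R: "R = \<gamma> *\<^sub>R (X - \<sigma> *\<^sub>R mat 1)" and \<gamma>: "\<gamma> > 0" and \<sigma>: "\<sigma>\<^sup>2 = 1" and discr: "discr R > 0"
  defines "c \<equiv> trace X / 2" and "d \<equiv> \<sigma> * sqrt (discr R) / (2 * \<gamma>)"
  shows "X *v v = c *\<^sub>R v + d *\<^sub>R (spectral_involution \<sigma> R *v v)"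
    and "c\<^sup>2 - d\<^sup>2 = det X"
proof -
  have "d * (\<sigma> / sqrt (discr R)) = 1 / (2 * \<gamma>)"
    using discr \<sigma> by (simp add: d_def power2_eq_square field_simps)
  then have "d *\<^sub>R (spectral_involution \<sigma> R *v v) = (1 / (2 * \<gamma>)) *\<^sub>R (traceless_part R *v v)"
    by (simp add: spectral_involution_def scaleR_matrix_vector_assoc[symmetric])
  moreover have "(1 / (2 * \<gamma>)) *\<^sub>R traceless_part R = X - c *\<^sub>R mat 1"
    using \<gamma> unfolding R c_def traceless_part_def by (simp add: mat2_simps field_simps)
  moreover have "(c *\<^sub>R mat 1) *v v = c *\<^sub>R v" by (simp add: scaleR_matrix_vector_assoc[symmetric])
  ultimately show "X *v v = c *\<^sub>R v + d *\<^sub>R (spectral_involution \<sigma> R *v v)"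
    by (simp add: scaleR_matrix_vector_assoc matrix_vector_mult_diff_rdistrib)
  have "discr R = \<gamma>\<^sup>2 * discr X"
    unfolding R by (simp add: mat2_simps power2_eq_square) algebra
  then have "d\<^sup>2 = discr X / 4"
    using discr \<gamma> \<sigma> by (simp add: d_def power_mult_distrib power_divide)
  then show "c\<^sup>2 - d\<^sup>2 = det X" by (simp add: c_def discr_def power_divide field_simps)
qed

lemma tendsto_trace: "(f \<longlongrightarrow> A) F \<Longrightarrow> ((\<lambda>n. trace (f n :: real^2^2)) \<longlongrightarrow> trace A) F"
  unfolding trace_def sum_2 by (intro tendsto_intros)

lemma tendsto_discr: "(f \<longlongrightarrow> A) F \<Longrightarrow> ((\<lambda>n. discr (f n)) \<longlongrightarrow> discr A) F"
  unfolding discr_def trace_def sum_2 det_2 by (intro tendsto_intros)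

lemma LIMSEQ_imp_Bseq: "f \<longlonglongrightarrow> l \<Longrightarrow> Bseq f" for f :: "nat \<Rightarrow> 'a :: real_normed_vector"
  by (rule convergent_imp_Bseq[OF convergentI])

lemma small_tail:
  fixes \<delta> :: "nat \<Rightarrow> real"
  assumes "summable \<delta>" "e > 0"
  shows "\<exists>M. \<forall>m\<ge>M. \<forall>n. sum \<delta> {m..<n} < e"
proof -
  obtain M where "\<And>m n. m \<ge> M \<Longrightarrow> norm (sum \<delta> {m..<n}) < e"
    using assms unfolding summable_Cauchy by blast
  then show ?thesis by (intro exI[of _ M]) (force simp: abs_less_iff)
qed

text \<open>The determinant of the pair \<open>(A v, v)\<close>.\<close>

definition area_form :: "real^2^2 \<Rightarrow> real^2 \<Rightarrow> real" where
  "area_form A v = A$1$2 * (v$2)\<^sup>2 + (A$1$1 - A$2$2) * (v$1 * v$2) - A$2$1 * (v$1)\<^sup>2"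

text \<open>\<open>X\<close> commutes with \<open>R\<close>, so \<open>det (R X v, X v) = det (X R v, X v) = det X \<cdot> det (R v, v)\<close>.\<close>

lemma area_form_invariant:
  assumes "R = \<gamma> *\<^sub>R (X - \<sigma> *\<^sub>R mat 1)"
  shows "area_form R (X *v v) = det X * area_form R v"
  unfolding area_form_def assms by (simp add: mat2_simps power2_eq_square) algebra

lemma area_form_scale: "area_form A (c *\<^sub>R v) = c\<^sup>2 * area_form A v"
  unfolding area_form_def by (simp add: power2_eq_square algebra_simps)

lemma area_form_diff: "area_form (A - B) v = area_form A v - area_form B v"
  unfolding area_form_def by (simp add: algebra_simps)

lemma entry_le_norm: "\<bar>A$i$j\<bar> \<le> norm (A :: real^2^2)"
  using Finite_Cartesian_Product.norm_nth_le[of "A$i" j] Finite_Cartesian_Product.norm_nth_le[of A i] by simp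

lemma norm_vec2_sq: "(norm (v :: real^2))\<^sup>2 = (v$1)\<^sup>2 + (v$2)\<^sup>2"
  by (simp add: norm_vec_def L2_set_def sum_2)

lemma area_form_le: "\<bar>area_form A v\<bar> \<le> 2 * norm A * (norm v)\<^sup>2"
proof -
  have "\<bar>A$1$2 * (v$2)\<^sup>2\<bar> \<le> norm A * (v$2)\<^sup>2" "\<bar>A$2$1 * (v$1)\<^sup>2\<bar> \<le> norm A * (v$1)\<^sup>2"
    unfolding abs_mult using entry_le_norm by (auto intro!: mult_mono)
  moreover have "\<bar>(A$1$1 - A$2$2) * (v$1 * v$2)\<bar> \<le> (2 * norm A) * (((v$1)\<^sup>2 + (v$2)\<^sup>2) / 2)"
    unfolding abs_mult[of "A$1$1 - A$2$2"]
  proof (rule mult_mono)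
    show "\<bar>A$1$1 - A$2$2\<bar> \<le> 2 * norm A"
      using entry_le_norm[of A 1 1] entry_le_norm[of A 2 2] by linarith
    show "\<bar>v$1 * v$2\<bar> \<le> ((v$1)\<^sup>2 + (v$2)\<^sup>2) / 2"
      using sum_squares_bound[of "\<bar>v$1\<bar>" "\<bar>v$2\<bar>"] by (simp add: abs_mult)
  qed auto
  moreover have "2 * norm A * (((v$1)\<^sup>2 + (v$2)\<^sup>2) / 2) = norm A * (v$1)\<^sup>2 + norm A * (v$2)\<^sup>2"
    by (simp add: field_simps)
  moreover have "\<bar>p + q - r\<bar> \<le> \<bar>p\<bar> + \<bar>q\<bar> + \<bar>r\<bar>" for p q r :: real by linarith
  moreover have "2 * norm A * ((v$1)\<^sup>2 + (v$2)\<^sup>2) = 2 * (norm A * (v$1)\<^sup>2) + 2 * (norm A * (v$2)\<^sup>2)"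
    by (simp add: algebra_simps)
  ultimately show ?thesis unfolding area_form_def norm_vec2_sq by (smt (verit))
qed

text \<open>Completing the square in either variable: \<open>- discr A\<close> is four times the determinant of the form.\<close>

lemma area_form_definite:
  assumes "discr A \<le> - \<epsilon>" "norm A \<le> B"
  shows "\<epsilon> * (norm v)\<^sup>2 \<le> 8 * B * \<bar>area_form A v\<bar>"
proof -
  let ?x = "v$1" and ?y = "v$2" and ?q = "area_form A v"
  have eps: "\<epsilon> * z\<^sup>2 \<le> - discr A * z\<^sup>2" for z using assms(1) by (intro mult_right_mono) auto
  have "4 * A$1$2 * ?q = (2 * A$1$2 * ?y + (A$1$1 - A$2$2) * ?x)\<^sup>2 - discr A * ?x\<^sup>2"
    unfolding area_form_def discr_def trace_def sum_2 det_2 by (simp add: power2_eq_square algebra_simps)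
  then have x: "\<epsilon> * ?x\<^sup>2 \<le> 4 * A$1$2 * ?q"
    using eps[of ?x] zero_le_power2[of "2 * A$1$2 * ?y + (A$1$1 - A$2$2) * ?x"] by linarith
  have "- 4 * A$2$1 * ?q = (2 * A$2$1 * ?x - (A$1$1 - A$2$2) * ?y)\<^sup>2 - discr A * ?y\<^sup>2"
    unfolding area_form_def discr_def trace_def sum_2 det_2 by (simp add: power2_eq_square algebra_simps)
  then have y: "\<epsilon> * ?y\<^sup>2 \<le> - 4 * A$2$1 * ?q"
    using eps[of ?y] zero_le_power2[of "2 * A$2$1 * ?x - (A$1$1 - A$2$2) * ?y"] by linarith
  have le: "\<bar>A$i$j * ?q\<bar> \<le> B * \<bar>?q\<bar>" for i j
    unfolding abs_mult using assms(2) entry_le_norm[of A i j] by (intro mult_right_mono) auto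
  show ?thesis
    unfolding norm_vec2_sq distrib_left using x y le[of 1 2] le[of 2 1] by (simp add: abs_le_iff)
qed

section \<open>Products of perturbations of a scalar matrix\<close>

text \<open>
  The factor \<open>r\<close> normalises the determinant of \<open>X\<close> to \<open>1\<close>. The assumptions that involve \<open>r\<close> start at
  \<open>n = 1\<close> because for the block of index \<open>0\<close> the entry before the block need not exist.
\<close>

locale perturbed_identity =
  fixes X R :: "nat \<Rightarrow> real^2^2" and Ri :: "real^2^2" and \<gamma> r :: "nat \<Rightarrow> real" and \<sigma> L :: real
  assumes R: "\<And>n. R n = \<gamma> n *\<^sub>R (X n - \<sigma> *\<^sub>R mat 1)"
    and \<gamma>: "\<And>n. \<gamma> n > 0"
    and \<sigma>: "\<sigma>\<^sup>2 = 1"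
    and lim_X: "X \<longlonglongrightarrow> \<sigma> *\<^sub>R mat 1"
    and lim_R: "R \<longlonglongrightarrow> Ri"
    and variation: "summable (\<lambda>n. norm (R (Suc n) - R n))"
    and det: "\<And>n. n \<ge> 1 \<Longrightarrow> (r n)\<^sup>2 * det (X n) = 1"
    and bound: "\<And>n v. n \<ge> 1 \<Longrightarrow> norm (r n *\<^sub>R (X n *v v)) \<le> L * norm v"
    and L: "L \<ge> 1"
begin

lemma Bseq_R: "Bseq R" using lim_R by (rule LIMSEQ_imp_Bseq)

text \<open>The area form of \<open>R n\<close> is exactly preserved by one step, so its value along the solution only changes
  through the variation of \<open>R\<close>; by definiteness this change is a summable multiple of the value itself.\<close>

lemma elliptic_bounded:
  assumes neg: "discr Ri < 0"
    and w: "\<And>n. n \<ge> 1 \<Longrightarrow> w (Suc n) = r n *\<^sub>R (X n *v w n)"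
  shows "\<exists>B m. \<forall>n\<ge>m. norm (w n) \<le> B"
proof -
  define \<epsilon> where "\<epsilon> = - discr Ri / 2"
  have \<epsilon>: "\<epsilon> > 0" using neg by (simp add: \<epsilon>_def)
  have "\<forall>\<^sub>F n in sequentially. discr (R n) < - \<epsilon>"
    by (rule order_tendstoD(2)[OF tendsto_discr[OF lim_R]]) (use neg in \<open>simp add: \<epsilon>_def\<close>)
  then obtain m0 where m0: "\<And>n. n \<ge> m0 \<Longrightarrow> discr (R n) < - \<epsilon>"
    unfolding eventually_sequentially by blast
  define m where "m = max m0 1"
  obtain B where B: "B > 0" "\<And>n. norm (R n) \<le> B" using Bseq_R by (auto simp: Bseq_def)
  define C where "C = 8 * B / \<epsilon>"
  have C: "C > 0" using B \<epsilon> by (simp add: C_def)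
  define q where "q n = \<bar>area_form (R n) (w n)\<bar>" for n
  have wq: "(norm (w n))\<^sup>2 \<le> C * q n" if "n \<ge> m" for n
    using area_form_definite[of "R n" \<epsilon> B "w n"] m0[of n] that B(2)[of n] \<epsilon>
    by (simp add: C_def q_def m_def field_simps)
  define \<eta> where "\<eta> n = 2 * L\<^sup>2 * C * norm (R (Suc n) - R n)" for n
  have \<eta>: "summable \<eta>" "\<And>n. \<eta> n \<ge> 0"
    unfolding \<eta>_def using C by (auto intro!: summable_mult variation)
  have step: "q (Suc n) \<le> (1 + \<eta> n) * q n + 0" if n: "n \<ge> m" for n
  proof -
    have n1: "n \<ge> 1" using n by (simp add: m_def)
    have "area_form (R n) (w (Suc n)) = area_form (R n) (w n)"
      using det[OF n1] by (simp add: w[OF n1] area_form_scale area_form_invariant[OF R] mult.assoc[symmetric])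
    then have "q (Suc n) \<le> q n + \<bar>area_form (R (Suc n) - R n) (w (Suc n))\<bar>"
      unfolding q_def area_form_diff by linarith
    also have "\<bar>area_form (R (Suc n) - R n) (w (Suc n))\<bar> \<le> 2 * norm (R (Suc n) - R n) * (norm (w (Suc n)))\<^sup>2"
      by (rule area_form_le)
    also have "(norm (w (Suc n)))\<^sup>2 \<le> L\<^sup>2 * (C * q n)"
    proof -
      have "(norm (w (Suc n)))\<^sup>2 \<le> (L * norm (w n))\<^sup>2"
        unfolding w[OF n1] by (intro power_mono bound n1) simp
      also have "\<dots> \<le> L\<^sup>2 * (C * q n)"
        unfolding power_mult_distrib by (intro mult_left_mono wq n) simp
      finally show ?thesis .
    qed
    finally have "q (Suc n) \<le> q n + 2 * norm (R (Suc n) - R n) * (L\<^sup>2 * (C * q n))"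
      by (simp add: mult_left_mono)
    then show ?thesis by (simp add: \<eta>_def algebra_simps)
  qed
  have "norm (w n) \<le> sqrt (C * (q m * exp (suminf \<eta>)))" if n: "n \<ge> m" for n
  proof -
    have "q n \<le> (q m + sum (\<lambda>_. 0) {m..<n}) * exp (sum \<eta> {m..<n})"
      using step by (rule discrete_Gronwall) (use \<eta> n in \<open>auto simp: q_def\<close>)
    also have "\<dots> \<le> q m * exp (suminf \<eta>)"
      using \<eta> by (auto simp: q_def intro!: mult_left_mono sum_le_suminf)
    finally have "C * q n \<le> C * (q m * exp (suminf \<eta>))" using C by simp
    with wq[OF n] have "(norm (w n))\<^sup>2 \<le> C * (q m * exp (suminf \<eta>))" by linarith
    then show ?thesis by (simp add: real_le_rsqrt)
  qed
  then show ?thesis by blast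
qed

text \<open>The involutions are smooth functions of \<open>R\<close> near the limit and inherit bounded variation. The
  eigenvalues \<open>c \<plusminus> d\<close> of the normalised step have product \<open>1\<close>, and \<open>c d > 0\<close> since
  \<open>\<sigma> trace X\<close> tends to \<open>2\<close>; this makes \<open>|c + d|\<close> the larger one for all large \<open>n\<close>.\<close>

lemma hyperbolic:
  assumes pos: "discr Ri > 0"
  shows "\<exists>T c d \<kappa> \<delta> \<tau> m. hyperbolic_recurrence T c d \<kappa> \<delta> \<tau> L m \<and> m \<ge> 1 \<and>
    (\<forall>n\<ge>m. \<forall>v. r n *\<^sub>R (X n *v v) = c n *\<^sub>R v + d n *\<^sub>R T n v)"
proof -
  define \<epsilon> where "\<epsilon> = discr Ri / 2"
  have \<epsilon>: "\<epsilon> > 0" using pos by (simp add: \<epsilon>_def)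
  define S where "S n = spectral_involution \<sigma> (R n)" for n
  define \<delta> where "\<delta> n = norm (S (Suc n) - S n)" for n
  define c where "c n = r n * (trace (X n) / 2)" for n
  define d where "d n = r n * (\<sigma> * sqrt (discr (R n)) / (2 * \<gamma> n))" for n
  have "\<forall>\<^sub>F n in sequentially. discr (R n) > \<epsilon>"
    by (rule order_tendstoD(1)[OF tendsto_discr[OF lim_R]]) (use pos in \<open>simp add: \<epsilon>_def\<close>)
  then obtain m1 where m1: "\<And>n. n \<ge> m1 \<Longrightarrow> discr (R n) > \<epsilon>"
    unfolding eventually_sequentially by blast
  have "(\<lambda>n. \<sigma> * trace (X n)) \<longlonglongrightarrow> \<sigma> * trace (\<sigma> *\<^sub>R mat 1 :: real^2^2)"
    by (intro tendsto_intros tendsto_trace lim_X)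
  moreover have "\<sigma> * trace (\<sigma> *\<^sub>R mat 1 :: real^2^2) = 2"
    using \<sigma> by (simp add: trace_def sum_2 mat_def power2_eq_square)
  ultimately have "\<forall>\<^sub>F n in sequentially. \<sigma> * trace (X n) > 0"
    by (intro order_tendstoD(1)) auto
  then obtain m2 where m2: "\<And>n. n \<ge> m2 \<Longrightarrow> \<sigma> * trace (X n) > 0"
    unfolding eventually_sequentially by blast
  have lim_inv: "(\<lambda>n. \<sigma> / sqrt (discr (R n))) \<longlonglongrightarrow> \<sigma> / sqrt (discr Ri)"
    using pos by (intro tendsto_intros tendsto_discr lim_R) auto
  have lim_tr: "(\<lambda>n. traceless_part (R n)) \<longlonglongrightarrow> traceless_part Ri"
    unfolding traceless_part_def by (intro tendsto_intros tendsto_trace lim_R)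
  have var_entry: "summable (\<lambda>n. norm (R (Suc n) $ i $ j - R n $ i $ j))" for i j
    using entry_le_norm[of "R (Suc _) - R _" i j]
    by (intro summable_comparison_test'[OF variation, of 0]) simp
  have B_entry: "Bseq (\<lambda>n. R n $ i $ j)" for i j
    by (rule LIMSEQ_imp_Bseq[OF tendsto_vec_nth[OF tendsto_vec_nth[OF lim_R]]])
  have var_trace: "summable (\<lambda>n. norm (trace (R (Suc n)) - trace (R n)))"
  proof (rule summable_comparison_test'[of _ 0])
    show "summable (\<lambda>n. norm (R (Suc n) $ 1 $ 1 - R n $ 1 $ 1) + norm (R (Suc n) $ 2 $ 2 - R n $ 2 $ 2))"
      by (intro summable_add var_entry)
  qed (simp add: trace_def sum_2)
  have var_tr: "summable (\<lambda>n. norm (traceless_part (R (Suc n)) - traceless_part (R n)))"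
  proof (rule summable_comparison_test'[of _ 0])
    show "summable (\<lambda>n. 2 * norm (R (Suc n) - R n)
        + norm (trace (R (Suc n)) - trace (R n)) * norm (mat 1 :: real^2^2))"
      by (intro summable_add summable_mult summable_mult2 variation var_trace)
    fix n
    have "traceless_part (R (Suc n)) - traceless_part (R n)
        = 2 *\<^sub>R (R (Suc n) - R n) - (trace (R (Suc n)) - trace (R n)) *\<^sub>R mat 1"
      by (simp add: traceless_part_def algebra_simps)
    also have "norm \<dots> \<le> 2 * norm (R (Suc n) - R n)
        + norm (trace (R (Suc n)) - trace (R n)) * norm (mat 1 :: real^2^2)"
      by (rule order_trans[OF norm_triangle_ineq4]) simp
    finally show "norm (norm (traceless_part (R (Suc n)) - traceless_part (R n))) \<le> \<dots>" by simp
  qed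
  have discr_eq: "discr A = (trace A) * (trace A) - 4 * (A$1$1 * A$2$2) + 4 * (A$1$2 * A$2$1)" for A
    by (simp add: discr_def det_2 power2_eq_square)
  have var_discr: "summable (\<lambda>n. norm (discr (R (Suc n)) - discr (R n)))"
  proof (rule summable_comparison_test'[of _ 0])
    note P = summable_variation_prod[OF bounded_bilinear_mult]
    show "summable (\<lambda>n. norm (trace (R (Suc n)) * trace (R (Suc n)) - trace (R n) * trace (R n))
        + 4 * norm (R (Suc n)$1$1 * R (Suc n)$2$2 - R n$1$1 * R n$2$2)
        + 4 * norm (R (Suc n)$1$2 * R (Suc n)$2$1 - R n$1$2 * R n$2$1))"
      by (intro summable_add summable_mult P var_entry var_trace B_entry)
         (rule LIMSEQ_imp_Bseq, rule tendsto_trace, rule lim_R)+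
    have gen: "\<bar>(x' - 4 * y' + 4 * z') - (x - 4 * y + 4 * z)\<bar> \<le> \<bar>x' - x\<bar> + 4 * \<bar>y' - y\<bar> + 4 * \<bar>z' - z\<bar>"
      for x y z x' y' z' :: real by (smt (verit))
    show "norm (norm (discr (R (Suc n)) - discr (R n)))
        \<le> norm (trace (R (Suc n)) * trace (R (Suc n)) - trace (R n) * trace (R n))
        + 4 * norm (R (Suc n)$1$1 * R (Suc n)$2$2 - R n$1$1 * R n$2$2)
        + 4 * norm (R (Suc n)$1$2 * R (Suc n)$2$1 - R n$1$2 * R n$2$1)" for n
      unfolding discr_eq real_norm_def abs_idempotent by (rule gen)
  qed
  have var_inv: "summable (\<lambda>n. norm (\<sigma> / sqrt (discr (R (Suc n))) - \<sigma> / sqrt (discr (R n))))"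
  proof (rule summable_comparison_test'[of _ m1])
    show "summable (\<lambda>n. \<bar>\<sigma>\<bar> * ((1 / (\<epsilon> * sqrt \<epsilon>)) * norm (discr (R (Suc n)) - discr (R n))))"
      by (intro summable_mult var_discr)
    fix n assume n: "n \<ge> m1"
    have "\<sigma> / sqrt (discr (R (Suc n))) - \<sigma> / sqrt (discr (R n))
        = \<sigma> * (1 / sqrt (discr (R (Suc n))) - 1 / sqrt (discr (R n)))"
      by (simp add: algebra_simps)
    also have "norm \<dots> \<le> \<bar>\<sigma>\<bar> * ((1 / (\<epsilon> * sqrt \<epsilon>)) * norm (discr (R (Suc n)) - discr (R n)))"
      unfolding real_norm_def abs_mult[of \<sigma>]
      by (intro mult_left_mono inverse_sqrt_Lipschitz \<epsilon> less_imp_le[OF m1]) (use n in auto)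
    finally show "norm (norm (\<sigma> / sqrt (discr (R (Suc n))) - \<sigma> / sqrt (discr (R n)))) \<le> \<dots>" by simp
  qed
  have \<delta>: "summable \<delta>"
    unfolding \<delta>_def S_def spectral_involution_def
    by (intro summable_variation_prod[OF bounded_bilinear_scaleR] var_inv var_tr)
       (rule LIMSEQ_imp_Bseq, rule lim_inv lim_tr)+
  have "Bseq S"
    unfolding S_def spectral_involution_def
    by (rule LIMSEQ_imp_Bseq, rule tendsto_scaleR[OF lim_inv lim_tr])
  then obtain \<tau> where \<tau>: "\<tau> > 0" "\<And>n. norm (S n) \<le> \<tau>" by (auto simp: Bseq_def)
  obtain m3 where m3: "\<And>m n. m \<ge> m3 \<Longrightarrow> sum \<delta> {m..<n} < 1 / (16 * L)"
    using small_tail[OF \<delta>, of "1 / (16 * L)"] L by auto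
  define m where "m = max (max m1 m2) (max m3 1)"
  have m: "m \<ge> m1" "m \<ge> m2" "m \<ge> m3" "m \<ge> 1" by (simp_all add: m_def)
  have decomp: "r n *\<^sub>R (X n *v v) = c n *\<^sub>R v + d n *\<^sub>R (S n *v v)" if "n \<ge> m" for n v
  proof -
    have "discr (R n) > 0" using m1[of n] \<epsilon> that m by simp
    from spectral_decomposition(1)[OF R \<gamma> \<sigma> this, of v] show ?thesis
      by (simp add: c_def d_def S_def scaleR_add_right)
  qed
  have sq: "(c n)\<^sup>2 - (d n)\<^sup>2 = 1" and cd: "c n * d n > 0" if "n \<ge> m" for n
  proof -
    have dpos: "discr (R n) > 0" and n1: "n \<ge> 1" using m1[of n] \<epsilon> that m by simp_all
    show "(c n)\<^sup>2 - (d n)\<^sup>2 = 1"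
      unfolding c_def d_def power_mult_distrib[of "r n"] right_diff_distrib[symmetric]
        spectral_decomposition(2)[OF R \<gamma> \<sigma> dpos]
      by (rule det[OF n1])
    have r: "(r n)\<^sup>2 > 0" using det[OF n1] by (metis mult_zero_left zero_less_power2 zero_neq_one power_zero_numeral)
    have "c n * d n = (r n)\<^sup>2 * ((\<sigma> * trace (X n)) * (sqrt (discr (R n)) / (4 * \<gamma> n)))"
      by (simp add: c_def d_def power2_eq_square)
    also have "\<dots> > 0"
    proof (rule mult_pos_pos[OF r mult_pos_pos])
      show "\<sigma> * trace (X n) > 0" using m2[of n] that m by simp
      show "sqrt (discr (R n)) / (4 * \<gamma> n) > 0" using dpos \<gamma>[of n] by simp
    qed
    finally show "c n * d n > 0" .
  qed
  have "hyperbolic_recurrence (\<lambda>n v. S n *v v) c d (\<lambda>n. \<bar>c n + d n\<bar>) \<delta> \<tau> L m"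
  proof (rule hyperbolic_recurrence.intro)
    show "linear ((*v) (S n))" for n by simp
    show "S n *v (S n *v v) = v" if "n \<ge> m" for n v
      unfolding S_def using m1[of n] \<epsilon> that m by (intro spectral_involution_involutive \<sigma>) simp
    show "norm (S n *v v) \<le> \<tau> * norm v" for n v
      by (rule order_trans[OF norm_matrix_vector_mult_le]) (intro mult_right_mono \<tau> norm_ge_zero)
    show "norm (S (Suc n) *v v - S n *v v) \<le> \<delta> n * norm v" for n v
      unfolding matrix_vector_mult_diff_rdistrib[symmetric] \<delta>_def by (rule norm_matrix_vector_mult_le)
    show "norm (c n *\<^sub>R v + d n *\<^sub>R (S n *v v)) \<le> L * norm v" if "n \<ge> m" for n v
      unfolding decomp[OF that, symmetric] using that m by (intro bound) simp
    show "\<tau> \<ge> 0" "L \<ge> 1" using \<tau> L by simp_all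
    show "0 \<le> \<delta> n" for n by (simp add: \<delta>_def)
    show "L * sum \<delta> {m..<n} \<le> 1 / 16" for n
      using m3[of m n] m L by (simp add: field_simps)
    fix n assume n: "n \<ge> m"
    have prod: "\<bar>c n + d n\<bar> * \<bar>c n - d n\<bar> = 1"
      using sq[OF n] by (simp add: abs_mult[symmetric] power2_eq_square algebra_simps)
    have "\<bar>c n - d n\<bar>\<^sup>2 \<le> \<bar>c n + d n\<bar>\<^sup>2"
      using cd[OF n] by (simp add: power2_eq_square algebra_simps)
    then have le: "\<bar>c n - d n\<bar> \<le> \<bar>c n + d n\<bar>" by (rule power2_le_imp_le) simp
    show ge: "1 \<le> \<bar>c n + d n\<bar>"
    proof (rule ccontr)
      assume "\<not> 1 \<le> \<bar>c n + d n\<bar>"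
      then have lt: "\<bar>c n + d n\<bar> < 1" and "\<bar>c n - d n\<bar> \<le> 1" using le by linarith+
      then have "\<bar>c n + d n\<bar> * \<bar>c n - d n\<bar> \<le> \<bar>c n + d n\<bar> * 1" by (intro mult_left_mono) auto
      with prod lt show False by simp
    qed
    show "\<bar>c n - d n\<bar> = 1 / \<bar>c n + d n\<bar>" using prod ge by (simp add: field_simps)
  qed simp
  then show ?thesis using decomp m by blast
qed

end

section \<open>The three-term recurrence in weighted coordinates\<close>

text \<open>
  Uniform bounds for one step make the state at any index comparable with the state at the start of its
  block; the second one does this for the weights \<open>sqrt (a j)\<close>.
\<close>

locale jacobi_recurrence =
  fixes a b :: "nat \<Rightarrow> real" and L :: real
  assumes a_pos: "\<And>n. a n > 0"
    and L_ge_1: "L \<ge> 1"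
    and transfer_bound: "\<And>j v. j \<ge> 1 \<Longrightarrow> norm (transfer_matrix a b j 0 *v v) \<le> L * norm v"
    and sqrt_a_bound: "\<And>j. j \<ge> 1 \<Longrightarrow> sqrt (a j) \<le> L * sqrt (a (j - 1))"
begin

definition solves :: "(nat \<Rightarrow> real) \<Rightarrow> (nat \<Rightarrow> real) \<Rightarrow> bool" where
  "solves f y \<longleftrightarrow> (\<forall>n\<ge>1. a (n - 1) * y (n - 1) + b n * y n + a n * y (n + 1) = f n)"

definition state :: "(nat \<Rightarrow> real) \<Rightarrow> nat \<Rightarrow> real^2" where
  "state y j = vector [y (j - 1), y j]"

definition wstate :: "(nat \<Rightarrow> real) \<Rightarrow> nat \<Rightarrow> real^2" where
  "wstate y j = sqrt (a (j - 1)) *\<^sub>R state y j"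

definition wstep :: "nat \<Rightarrow> real^2 \<Rightarrow> real^2" where
  "wstep j v = (sqrt (a j) / sqrt (a (j - 1))) *\<^sub>R (transfer_matrix a b j 0 *v v)"

definition wproduct :: "nat \<Rightarrow> nat \<Rightarrow> real^2 \<Rightarrow> real^2" where
  "wproduct j k v = (sqrt (a (j + k - 1)) / sqrt (a (j - 1))) *\<^sub>R (transfer_product a b k j 0 *v v)"

lemma a_simps [simp]: "0 < a n" "0 \<le> a n" "a n \<noteq> 0"
  using a_pos[of n] by auto

lemma sqrt_a_pos [simp]: "sqrt (a n) > 0" "sqrt (a n) \<noteq> 0"
  using a_pos[of n] by auto

lemma state_Suc:
  assumes "solves f y" "j \<ge> 1"
  shows "state y (Suc j) = transfer_matrix a b j 0 *v state y j + vector [0, f j / a j]"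
proof -
  have "a (j - 1) * y (j - 1) + b j * y j + a j * y (Suc j) = f j"
    using assms by (simp add: solves_def)
  then have "y (Suc j) = (f j - a (j - 1) * y (j - 1) - b j * y j) / a j"
    using a_pos[of j] by (simp add: field_simps)
  then show ?thesis
    by (simp add: state_def transfer_matrix_def vec_eq_iff forall_2 matrix_vector_mult_def sum_2
        diff_divide_distrib)
qed

lemma wstate_Suc:
  assumes "solves f y" "j \<ge> 1"
  shows "wstate y (Suc j) = wstep j (wstate y j) + vector [0, f j / sqrt (a j)]"
proof -
  have "wstep j (wstate y j) = sqrt (a j) *\<^sub>R (transfer_matrix a b j 0 *v state y j)"
    by (simp add: wstep_def wstate_def matrix_vector_mult_scaleR)
  moreover have "sqrt (a j) *\<^sub>R vector [0, f j / a j] = (vector [0, f j / sqrt (a j)] :: real^2)"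
    using a_pos[of j] by (simp add: vec_eq_iff forall_2 field_simps)
  ultimately show ?thesis
    by (simp add: wstate_def state_Suc[OF assms] scaleR_add_right)
qed

lemma norm_wstep_le:
  assumes "j \<ge> 1" shows "norm (wstep j v) \<le> L\<^sup>2 * norm v"
proof -
  have "norm (wstep j v) = sqrt (a j) / sqrt (a (j - 1)) * norm (transfer_matrix a b j 0 *v v)"
    using a_pos by (simp add: wstep_def less_imp_le)
  also have "\<dots> \<le> L * (L * norm v)"
    using sqrt_a_bound[OF assms] transfer_bound[OF assms] L_ge_1
    by (intro mult_mono) (auto simp: pos_divide_le_eq)
  finally show ?thesis by (simp add: power2_eq_square)
qed

lemma wstep_diff: "wstep j v - wstep j w = wstep j (v - w)"
  by (simp add: wstep_def matrix_vector_mult_diff_distrib scaleR_diff_right)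

lemma wproduct_0: "wproduct j 0 v = v"
  by (simp add: wproduct_def)

lemma wproduct_Suc: "j \<ge> 1 \<Longrightarrow> wproduct j (Suc k) v = wstep (j + k) (wproduct j k v)"
  by (simp add: wproduct_def wstep_def matrix_vector_mult_scaleR matrix_vector_mul_assoc)

lemma norm_wproduct_le: "j \<ge> 1 \<Longrightarrow> norm (wproduct j k v) \<le> (L\<^sup>2) ^ k * norm v"
proof (induction k)
  case (Suc k)
  have "norm (wproduct j (Suc k) v) \<le> L\<^sup>2 * norm (wproduct j k v)"
    unfolding wproduct_Suc[OF Suc.prems] using Suc.prems by (intro norm_wstep_le) simp
  also have "\<dots> \<le> L\<^sup>2 * ((L\<^sup>2) ^ k * norm v)" using Suc by (intro mult_left_mono) auto
  finally show ?case by simp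
qed (simp add: wproduct_0)

text \<open>Duhamel's formula over \<open>k\<close> steps: the inhomogeneity enters with weight \<open>1/sqrt (a l)\<close>, which is square
  summable when \<open>\<Sum>1/a l\<close> converges.\<close>

lemma wstate_deviation:
  assumes y: "solves f y" and j: "j \<ge> 1"
  shows "norm (wstate y (j + k) - wproduct j k (wstate y j))
    \<le> (L\<^sup>2) ^ k * (\<Sum>l=j..<j+k. \<bar>f l\<bar> / sqrt (a l))"
proof (induction k)
  case (Suc k)
  let ?S = "\<Sum>l=j..<j+k. \<bar>f l\<bar> / sqrt (a l)" and ?e = "\<bar>f (j + k)\<bar> / sqrt (a (j + k))"
  have jk: "j + k \<ge> 1" using j by simp
  have e: "norm (vector [0, f (j + k) / sqrt (a (j + k))] :: real^2) = ?e"
    by (simp add: norm_vec_def L2_set_def sum_2 abs_of_nonneg)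
  have "wstate y (j + Suc k) - wproduct j (Suc k) (wstate y j)
      = wstep (j + k) (wstate y (j + k) - wproduct j k (wstate y j)) + vector [0, f (j + k) / sqrt (a (j + k))]"
    using wstate_Suc[OF y jk] by (simp add: wproduct_Suc[OF j] wstep_diff[symmetric])
  also have "norm \<dots> \<le> L\<^sup>2 * norm (wstate y (j + k) - wproduct j k (wstate y j)) + ?e"
    unfolding e[symmetric] by (rule order_trans[OF norm_triangle_ineq add_right_mono[OF norm_wstep_le[OF jk]]])
  also have "\<dots> \<le> L\<^sup>2 * ((L\<^sup>2) ^ k * ?S) + (L\<^sup>2) ^ Suc k * ?e"
  proof (rule add_mono)
    have "1 * ?e \<le> (L\<^sup>2) ^ Suc k * ?e"
      using L_ge_1 a_pos by (intro mult_right_mono one_le_power) (auto simp: less_imp_le)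
    then show "?e \<le> (L\<^sup>2) ^ Suc k * ?e" by simp
  qed (use Suc in \<open>auto intro: mult_left_mono\<close>)
  also have "\<dots> = (L\<^sup>2) ^ Suc k * (\<Sum>l=j..<j+Suc k. \<bar>f l\<bar> / sqrt (a l))"
    by (simp add: algebra_simps)
  finally show ?case .
qed (simp add: wproduct_0)

lemma norm_state_growth:
  assumes y: "solves (\<lambda>_. 0) y" and j: "j \<ge> 1"
  shows "norm (state y (j + k)) \<le> L ^ k * norm (state y j)"
proof (induction k)
  case (Suc k)
  have z: "vector [0, 0] = (0 :: real^2)" by (simp add: vec_eq_iff forall_2)
  have "norm (state y (j + Suc k)) \<le> L * norm (state y (j + k))"
    using transfer_bound[of "j + k"] j state_Suc[OF y, of "j + k"] by (simp add: z)
  also have "\<dots> \<le> L * (L ^ k * norm (state y j))" using Suc L_ge_1 by (intro mult_left_mono) auto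
  finally show ?case by simp
qed simp

lemma norm_state_sq: "(norm (state y j))\<^sup>2 = (y (j - 1))\<^sup>2 + (y j)\<^sup>2"
  by (simp add: state_def norm_vec_def L2_set_def sum_2)

lemma norm_wstate: "norm (wstate y j) = sqrt (a (j - 1)) * norm (state y j)"
  using a_pos by (simp add: wstate_def less_imp_le)

text \<open>The determinants \<open>a (n-1) / a n\<close> of the factors telescope.\<close>

lemma det_transfer_product:
  "j \<ge> 1 \<Longrightarrow> det (transfer_product a b k j x) = a (j - 1) / a (j + k - 1)"
proof (induction k)
  case (Suc k)
  have "det (transfer_matrix a b (j + k) x) = a (j + k - 1) / a (j + k)"
    by (simp add: transfer_matrix_def det_2)
  then show ?case using Suc a_pos[of "j + k - 1"] by (simp add: det_mul)
qed (use a_pos[of "j - 1"] in simp)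

end

lemma sum_blocks:
  fixes h :: "nat \<Rightarrow> real"
  assumes "m \<le> k"
  shows "(\<Sum>n=m..<k. sum h {n*N+i..<n*N+i+N}) = sum h {m*N+i..<k*N+i}"
  using assms
proof (induction k rule: dec_induct)
  case (step k)
  have "sum h {m*N+i..<k*N+i} + sum h {k*N+i..<k*N+i+N} = sum h {m*N+i..<k*N+i+N}"
    using step.hyps by (intro sum.atLeastLessThan_concat) auto
  then show ?case using step by (simp add: add_ac)
qed simp

lemma summable_div_index:
  fixes u :: "nat \<Rightarrow> real"
  assumes u: "summable u" "\<And>n. 0 \<le> u n" and N: "N \<ge> 1"
  shows "summable (\<lambda>j. u (j div N))"
proof (rule summableI_nonneg_bounded)
  fix M
  have "(\<Sum>j<M. u (j div N)) \<le> (\<Sum>j<M*N. u (j div N))"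
    using u(2) N by (intro sum_mono2) auto
  also have "\<dots> = (\<Sum>n<M. \<Sum>j=n*N..<n*N+N. u (j div N))" by (rule sum.nat_group[symmetric])
  also have "\<dots> = (\<Sum>n<M. \<Sum>j=n*N..<n*N+N. u n)"
  proof (intro sum.cong refl)
    fix n j assume "j \<in> {n*N..<n*N+N}"
    then have "j div N = n" by (intro div_nat_eqI) (auto simp: mult.commute)
    then show "u (j div N) = u n" by simp
  qed
  also have "\<dots> = real N * (\<Sum>n<M. u n)" by (simp add: sum_distrib_left)
  also have "\<dots> \<le> real N * suminf u" using u by (intro mult_left_mono sum_le_suminf) auto
  finally show "(\<Sum>j<M. u (j div N)) \<le> real N * suminf u" .
qed (use u in simp)

lemma summable_arith_progression:
  fixes u :: "nat \<Rightarrow> real"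
  assumes u: "summable u" "\<And>n. 0 \<le> u n" and N: "N \<ge> 1"
  shows "summable (\<lambda>n. u (n * N + i - 1))"
proof -
  have "summable (u \<circ> (\<lambda>n. Suc n * N + i - 1))"
  proof (rule summable_reindex[OF u(1) _ u(2)])
    show "inj (\<lambda>n. Suc n * N + i - 1)"
    proof (rule injI)
      fix x y assume "Suc x * N + i - 1 = Suc y * N + i - 1"
      then have "x * N = y * N" using N unfolding mult_Suc by linarith
      then show "x = y" using N by simp
    qed
  qed
  then show ?thesis using summable_Suc_iff[of "\<lambda>n. u (n * N + i - 1)"] by (simp add: o_def)
qed

locale jacobi_blocks = jacobi_recurrence +
  fixes N i :: nat and \<gamma> :: "nat \<Rightarrow> real" and \<sigma> :: real and R :: "nat \<Rightarrow> real^2^2" and Ri :: "real^2^2"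
  assumes N: "N \<ge> 1"
    and R: "\<And>n. R n = \<gamma> n *\<^sub>R (transfer_product a b N (n * N + i) 0 - \<sigma> *\<^sub>R mat 1)"
    and \<gamma>: "\<And>n. \<gamma> n > 0"
    and \<sigma>: "\<sigma>\<^sup>2 = 1"
    and lim_X: "(\<lambda>n. transfer_product a b N (n * N + i) 0) \<longlonglongrightarrow> \<sigma> *\<^sub>R mat 1"
    and lim_R: "R \<longlonglongrightarrow> Ri"
    and variation: "summable (\<lambda>n. norm (R (Suc n) - R n))"
    and summable_inverse_a: "summable (\<lambda>n. 1 / a n)"
begin

abbreviation start :: "nat \<Rightarrow> nat" where "start n \<equiv> n * N + i"

lemma start_ge_1: "n \<ge> 1 \<Longrightarrow> start n \<ge> 1"
  using N by (simp add: Suc_le_eq)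

text \<open>The weights \<open>sqrt (a (j-1))\<close> are exactly what normalises the determinants of the block products.\<close>

sublocale perturbed_identity "\<lambda>n. transfer_product a b N (start n) 0" R Ri \<gamma>
  "\<lambda>n. sqrt (a (start n + N - 1)) / sqrt (a (start n - 1))" \<sigma> "(L\<^sup>2) ^ N"
proof
  fix n v assume n: "(n :: nat) \<ge> 1"
  show "(sqrt (a (start n + N - 1)) / sqrt (a (start n - 1)))\<^sup>2 * det (transfer_product a b N (start n) 0) = 1"
    using a_pos[of "start n - 1"] a_pos[of "start n + N - 1"]
    by (simp add: det_transfer_product[OF start_ge_1[OF n]] power_divide)
  show "norm ((sqrt (a (start n + N - 1)) / sqrt (a (start n - 1))) *\<^sub>R (transfer_product a b N (start n) 0 *v v))
      \<le> (L\<^sup>2) ^ N * norm v"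
    using norm_wproduct_le[OF start_ge_1[OF n], of N v] by (simp add: wproduct_def)
next
  show "(L\<^sup>2) ^ N \<ge> 1" using L_ge_1 by (intro one_le_power) auto
qed (use R \<gamma> \<sigma> lim_X lim_R variation L_ge_1 in \<open>auto intro: one_le_power\<close>)

text \<open>Inside a block a homogeneous solution is dominated by its state at the start of the block.\<close>

lemma square_summable_if_blocks:
  assumes y: "solves (\<lambda>_. 0) y" and u: "summable u" "\<And>n. 0 \<le> u n"
    and bound: "\<And>n. n \<ge> m \<Longrightarrow> (norm (state y (start n)))\<^sup>2 \<le> u n"
  shows "summable (\<lambda>j. (y j)\<^sup>2)"
proof -
  have "summable (\<lambda>j. (y (j + i))\<^sup>2)"
  proof (rule summable_comparison_test')
    show "summable (\<lambda>j. (L ^ N)\<^sup>2 * u (j div N))"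
      by (intro summable_mult summable_div_index u N)
    fix j assume j: "j \<ge> max m 1 * N"
    let ?n = "j div N" and ?l = "j mod N"
    have n: "?n \<ge> m" "?n \<ge> 1"
      using div_le_mono[OF j, of N] N by auto
    have eq: "j + i = start ?n + ?l" by simp
    have "(y (j + i))\<^sup>2 \<le> (norm (state y (j + i)))\<^sup>2" by (simp add: norm_state_sq)
    also have "\<dots> \<le> (L ^ ?l * norm (state y (start ?n)))\<^sup>2"
      unfolding eq by (intro power_mono norm_state_growth[OF y start_ge_1[OF n(2)]]) simp
    also have "\<dots> = (L ^ ?l)\<^sup>2 * (norm (state y (start ?n)))\<^sup>2" by (rule power_mult_distrib)
    also have "\<dots> \<le> (L ^ N)\<^sup>2 * u ?n"
    proof (rule mult_mono[OF _ bound[OF n(1)]])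
      show "(L ^ ?l)\<^sup>2 \<le> (L ^ N)\<^sup>2"
        using L_ge_1 N by (intro power_mono power_increasing) (auto intro: less_imp_le)
    qed auto
    finally show "norm ((y (j + i))\<^sup>2) \<le> (L ^ N)\<^sup>2 * u ?n" by simp
  qed
  then show ?thesis using summable_iff_shift[of "\<lambda>j. (y j)\<^sup>2" i] by simp
qed

lemma norm_state_sq_wstate: "(norm (state y j))\<^sup>2 = (norm (wstate y j))\<^sup>2 * (1 / a (j - 1))"
  using a_pos[of "j - 1"] by (simp add: norm_wstate power_mult_distrib)

lemma wstate_block:
  "wstate y (start (Suc n)) = (sqrt (a (start n + N - 1)) / sqrt (a (start n - 1))) *\<^sub>R
      (transfer_product a b N (start n) 0 *v wstate y (start n))
    + (wstate y (start n + N) - wproduct (start n) N (wstate y (start n)))"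
  by (simp add: wproduct_def add_ac)

lemma homogeneous_block:
  assumes "solves (\<lambda>_. 0) y" "n \<ge> 1"
  shows "wstate y (start (Suc n)) = (sqrt (a (start n + N - 1)) / sqrt (a (start n - 1))) *\<^sub>R
      (transfer_product a b N (start n) 0 *v wstate y (start n))"
  using wstate_block[of y n] wstate_deviation[OF assms(1) start_ge_1[OF assms(2)], of N] by simp

text \<open>Bounded weighted states mean \<open>|y|\<^sup>2 = O(1/a)\<close> at the starts of the blocks.\<close>

lemma elliptic_square_summable:
  assumes "discr Ri < 0" and y: "solves (\<lambda>_. 0) y"
  shows "summable (\<lambda>j. (y j)\<^sup>2)"
proof -
  obtain B m where B: "\<And>n. n \<ge> m \<Longrightarrow> norm (wstate y (start n)) \<le> B"
    using elliptic_bounded[OF assms(1), of "\<lambda>n. wstate y (start n)"] homogeneous_block[OF y] by blast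
  show ?thesis
  proof (rule square_summable_if_blocks[OF y])
    show "summable (\<lambda>n. B\<^sup>2 * (1 / a (start n - 1)))"
      using a_pos by (intro summable_mult summable_arith_progression[OF summable_inverse_a _ N]) (simp add: less_imp_le)
    show "0 \<le> B\<^sup>2 * (1 / a (start n - 1))" for n using a_pos[of "start n - 1"] by simp
    show "(norm (state y (start n)))\<^sup>2 \<le> B\<^sup>2 * (1 / a (start n - 1))" if "n \<ge> m" for n
      unfolding norm_state_sq_wstate using a_pos[of "start n - 1"] B[OF that]
      by (intro mult_right_mono power_mono) auto
  qed
qed

text \<open>The Cauchy--Schwarz inequality; the second factor is finite because Carleman's condition fails.\<close>

lemma weighted_sum_le:
  assumes S: "\<And>M. (\<Sum>j<M. (f j)\<^sup>2) \<le> S\<^sup>2" "0 \<le> S" and I: "finite I"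
  shows "(\<Sum>j\<in>I. \<bar>f j\<bar> / sqrt (a j)) \<le> S * sqrt (\<Sum>n. 1 / a n)"
proof -
  obtain M where M: "I \<subseteq> {..<M}" using I finite_nat_iff_bounded by blast
  have "(\<Sum>j\<in>I. \<bar>f j\<bar> / sqrt (a j)) = (\<Sum>j\<in>I. \<bar>f j\<bar> * \<bar>1 / sqrt (a j)\<bar>)"
    using a_pos by (intro sum.cong) (auto simp: less_imp_le)
  also have "\<dots> \<le> L2_set f I * L2_set (\<lambda>j. 1 / sqrt (a j)) I" by (rule L2_set_mult_ineq)
  also have "\<dots> \<le> S * sqrt (\<Sum>n. 1 / a n)"
  proof (rule mult_mono)
    have "(\<Sum>j\<in>I. (f j)\<^sup>2) \<le> (\<Sum>j<M. (f j)\<^sup>2)" using M by (intro sum_mono2) auto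
    then show "L2_set f I \<le> S" unfolding L2_set_def using S by (intro real_le_lsqrt order_trans[OF _ S(1)]) auto
    have "(\<Sum>j\<in>I. (1 / sqrt (a j))\<^sup>2) = (\<Sum>j\<in>I. 1 / a j)"
      using a_pos by (intro sum.cong) (auto simp: power_divide less_imp_le)
    also have "\<dots> \<le> (\<Sum>n. 1 / a n)"
      using a_pos by (intro sum_le_suminf summable_inverse_a I) (auto simp: less_imp_le)
    finally show "L2_set (\<lambda>j. 1 / sqrt (a j)) I \<le> sqrt (\<Sum>n. 1 / a n)"
      unfolding L2_set_def by simp
  qed (use S in auto)
  finally show ?thesis .
qed

text \<open>The case distinction is whether some square summable sequence grows like \<open>prod \<kappa>\<close>. If one does, it
  dominates all homogeneous solutions, which are then square summable. If none does, then
  \<open>bounded_or_growing\<close> leaves only the bounded alternative for every \<open>y\<close> with \<open>y\<close> and \<open>f\<close> square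
  summable, with constants that depend only on the coefficients.\<close>

lemma hyperbolic_dichotomy:
  assumes "discr Ri > 0"
  shows "(\<forall>y. solves (\<lambda>_. 0) y \<longrightarrow> summable (\<lambda>j. (y j)\<^sup>2)) \<or>
    (\<exists>C n1. \<forall>y f S. solves f y \<longrightarrow> 0 \<le> S \<longrightarrow> (\<forall>M. (\<Sum>j<M. (y j)\<^sup>2) \<le> S\<^sup>2) \<longrightarrow>
      (\<forall>M. (\<Sum>j<M. (f j)\<^sup>2) \<le> S\<^sup>2) \<longrightarrow> (\<forall>n\<ge>n1. a n * (y n)\<^sup>2 \<le> C * S\<^sup>2))"
proof -
  obtain T c d \<kappa> \<delta> \<tau> m where H: "hyperbolic_recurrence T c d \<kappa> \<delta> \<tau> ((L\<^sup>2) ^ N) m" and m: "m \<ge> 1"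
    and step: "\<And>n v. n \<ge> m \<Longrightarrow> (sqrt (a (start n + N - 1)) / sqrt (a (start n - 1))) *\<^sub>R
      (transfer_product a b N (start n) 0 *v v) = c n *\<^sub>R v + d n *\<^sub>R T n v"
    using hyperbolic[OF assms] by blast
  interpret H: hyperbolic_recurrence T c d \<kappa> \<delta> \<tau> "(L\<^sup>2) ^ N" m by (rule H)
  have prod_pos: "prod \<kappa> {m..<n} > 0" for n
    using H.\<kappa> by (intro prod_pos) (force intro: less_le_trans[OF zero_less_one])
  show ?thesis
  proof (cases "\<exists>y k e. summable (\<lambda>j. (y j)\<^sup>2) \<and> e > 0 \<and>
      (\<forall>n\<ge>k. norm (wstate y (start n)) \<ge> e * prod \<kappa> {m..<n})")
    case True
    then obtain y k e where y: "summable (\<lambda>j. (y j)\<^sup>2)" and e: "e > 0"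
      and growth: "\<And>n. n \<ge> k \<Longrightarrow> norm (wstate y (start n)) \<ge> e * prod \<kappa> {m..<n}" by blast
    have "summable (\<lambda>j. (h j)\<^sup>2)" if h: "solves (\<lambda>_. 0) h" for h
    proof -
      define q where "q = 4 * (1 + \<tau>) * norm (wstate h (start m)) / e"
      have "norm (wstate h (start n)) \<le> 4 * (1 + \<tau>) * norm (wstate h (start m)) * prod \<kappa> {m..<n}"
        if "n \<ge> m" for n
        by (rule H.homogeneous_upper_bound[OF _ that, of "\<lambda>n. wstate h (start n)"])
          (use homogeneous_block[OF h] step m in auto)
      then have le: "norm (wstate h (start n)) \<le> q * (e * prod \<kappa> {m..<n})" if "n \<ge> m" for n
        using that e by (simp add: q_def mult.assoc)
      have q: "q \<ge> 0" using e H.pos by (simp add: q_def)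
      have le: "norm (wstate h (start n)) \<le> q * norm (wstate y (start n))" if "n \<ge> m" "n \<ge> k" for n
        by (rule order_trans[OF le[OF that(1)] mult_left_mono[OF growth[OF that(2)] q]])
      show ?thesis
      proof (rule square_summable_if_blocks[OF h])
        have "summable (\<lambda>n. (y (start n - 1))\<^sup>2 + (y (start n))\<^sup>2)"
          using summable_arith_progression[OF y _ N, of i] summable_arith_progression[OF y _ N, of "Suc i"]
          by (intro summable_add) auto
        then show "summable (\<lambda>n. q\<^sup>2 * (norm (state y (start n)))\<^sup>2)"
          unfolding norm_state_sq by (rule summable_mult)
        show "(norm (state h (start n)))\<^sup>2 \<le> q\<^sup>2 * (norm (state y (start n)))\<^sup>2" if "n \<ge> max m k" for n
        proof -
          have "norm (state h (start n)) \<le> q * norm (state y (start n))"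
            using le[of n] that sqrt_a_pos(1)[of "start n - 1"] unfolding norm_wstate
            by (simp add: mult.left_commute)
          then show ?thesis unfolding power_mult_distrib[symmetric] by (intro power_mono) auto
        qed
      qed simp
    qed
    then show ?thesis by blast
  next
    case False
    define A where "A = sqrt (\<Sum>n. 1 / a n)"
    define P where "P = (L\<^sup>2) ^ N"
    have P: "P \<ge> 1" unfolding P_def using L_ge_1 by (intro one_le_power) auto
    have A: "A \<ge> 0" unfolding A_def using a_pos by (auto intro!: suminf_nonneg summable_inverse_a simp: less_imp_le)
    define C1 where "C1 = 12 * (2 + \<tau>) * (sqrt (2 * a (start m - 1)) + P * A)"
    define C where "C = (P * (C1 + A))\<^sup>2"
    have "a n * (y n)\<^sup>2 \<le> C * S\<^sup>2"
      if y: "solves f y" and S: "0 \<le> S" and yS: "\<And>M. (\<Sum>j<M. (y j)\<^sup>2) \<le> S\<^sup>2"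
        and fS: "\<And>M. (\<Sum>j<M. (f j)\<^sup>2) \<le> S\<^sup>2" and n: "n \<ge> start m" for y f S n
    proof -
      define g where "g n = wstate y (start n + N) - wproduct (start n) N (wstate y (start n))" for n
      have ys: "(y j)\<^sup>2 \<le> S\<^sup>2" for j
        by (rule order_trans[OF member_le_sum[of j "{..<Suc j}"] yS]) auto
      have summable_y: "summable (\<lambda>j. (y j)\<^sup>2)"
        by (rule summableI_nonneg_bounded[OF _ yS]) simp
      have wsum: "(\<Sum>l=j..<k. \<bar>f l\<bar> / sqrt (a l)) \<le> S * A" for j k
        unfolding A_def by (rule weighted_sum_le[OF fS S]) simp
      have rec: "wstate y (start (Suc n)) = c n *\<^sub>R wstate y (start n) + d n *\<^sub>R T n (wstate y (start n)) + g n"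
        if "n \<ge> m" for n
        unfolding wstate_block[of y n] step[OF that] g_def ..
      have g: "(\<Sum>k=m..<n. norm (g k)) \<le> P * (S * A)" for n
      proof (cases "m \<le> n")
        case True
        have "(\<Sum>k=m..<n. norm (g k)) \<le> (\<Sum>k=m..<n. P * (\<Sum>l=start k..<start k+N. \<bar>f l\<bar> / sqrt (a l)))"
          unfolding g_def P_def using m by (intro sum_mono wstate_deviation[OF y] start_ge_1) auto
        also have "\<dots> = P * (\<Sum>l=start m..<start n. \<bar>f l\<bar> / sqrt (a l))"
          unfolding sum_distrib_left[symmetric] sum_blocks[OF True] ..
        also have "\<dots> \<le> P * (S * A)" using P by (intro mult_left_mono wsum) auto
        finally show ?thesis .
      qed (use P S A in simp)
      have "\<not> (\<exists>k\<ge>m. \<exists>e>0. \<forall>n\<ge>k. norm (wstate y (start n)) \<ge> e * prod \<kappa> {m..<n})"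
        using False summable_y by blast
      with H.bounded_or_growing[where w = "\<lambda>n. wstate y (start n)", OF rec g]
      have bounded: "\<And>n. n \<ge> m \<Longrightarrow> norm (wstate y (start n)) \<le> 12 * (2 + \<tau>) * (norm (wstate y (start m)) + P * (S * A))"
        by blast
      have "norm (state y (start m)) \<le> sqrt 2 * S"
      proof (rule power2_le_imp_le)
        show "(norm (state y (start m)))\<^sup>2 \<le> (sqrt 2 * S)\<^sup>2"
          unfolding norm_state_sq using ys[of "start m - 1"] ys[of "start m"] by (simp add: power_mult_distrib)
      qed (use S in simp)
      then have init: "norm (wstate y (start m)) \<le> sqrt (2 * a (start m - 1)) * S"
        unfolding norm_wstate real_sqrt_mult using mult_left_mono[of _ _ "sqrt (a (start m - 1))"]
        by (simp add: mult_ac less_imp_le[OF sqrt_a_pos(1)])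
      have block: "norm (wstate y (start n)) \<le> C1 * S" if "n \<ge> m" for n
      proof -
        have "norm (wstate y (start n)) \<le> 12 * (2 + \<tau>) * (sqrt (2 * a (start m - 1)) * S + P * (S * A))"
          using init H.pos by (intro order_trans[OF bounded[OF that] mult_left_mono]) auto
        then show ?thesis by (simp add: C1_def algebra_simps)
      qed
      let ?q = "(Suc n - i) div N" and ?l = "(Suc n - i) mod N"
      have sn: "Suc n \<ge> start m" using n by simp
      have "m * N \<le> Suc n - i" using sn by simp
      then have q: "?q \<ge> m" using div_le_mono[of "m * N" "Suc n - i" N] N by simp
      have eq: "Suc n = start ?q + ?l" using sn by simp
      have Pl: "(L\<^sup>2) ^ ?l \<le> P"
        unfolding P_def using L_ge_1 N by (intro power_increasing) (auto intro: less_imp_le)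
      have "norm (wstate y (start ?q + ?l))
          \<le> norm (wproduct (start ?q) ?l (wstate y (start ?q))) + norm (wstate y (start ?q + ?l) - wproduct (start ?q) ?l (wstate y (start ?q)))"
        by (rule norm_triangle_sub)
      also have "\<dots> \<le> (L\<^sup>2) ^ ?l * norm (wstate y (start ?q)) + (L\<^sup>2) ^ ?l * (\<Sum>l=start ?q..<start ?q+?l. \<bar>f l\<bar> / sqrt (a l))"
        using q m by (intro add_mono norm_wproduct_le wstate_deviation[OF y] start_ge_1) auto
      also have "\<dots> \<le> P * (C1 * S) + P * (S * A)"
      proof (intro add_mono mult_mono Pl block q wsum)
        show "0 \<le> (\<Sum>l=start ?q..<start ?q+?l. \<bar>f l\<bar> / sqrt (a l))"
          using a_pos by (intro sum_nonneg divide_nonneg_nonneg) (auto simp: less_imp_le)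
      qed (use P in auto)
      finally have w: "norm (wstate y (Suc n)) \<le> P * (C1 + A) * S"
        unfolding eq[symmetric] by (simp add: algebra_simps)
      have "a n * (y n)\<^sup>2 \<le> (norm (wstate y (Suc n)))\<^sup>2"
        using a_pos[of n] by (simp add: norm_wstate power_mult_distrib norm_state_sq less_imp_le)
      also have "\<dots> \<le> (P * (C1 + A) * S)\<^sup>2" by (intro power_mono w) simp
      finally show ?thesis by (simp add: C_def power_mult_distrib)
    qed
    then show ?thesis by blast
  qed
qed

end

section \<open>Periodic modulation\<close>

lemma tendsto_vector_2:
  fixes f g :: "'b \<Rightarrow> 'a :: {topological_space, zero}"
  assumes "(f \<longlongrightarrow> x) F" "(g \<longlongrightarrow> y) F"
  shows "((\<lambda>n. vector [f n, g n] :: 'a^2) \<longlongrightarrow> vector [x, y]) F"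
proof (rule vec_tendstoI)
  fix i :: 2
  show "((\<lambda>n. (vector [f n, g n] :: 'a^2) $ i) \<longlongrightarrow> (vector [x, y] :: 'a^2) $ i) F"
    using exhaust_2[of i] assms by auto
qed

lemma tendsto_matrix_matrix_mult:
  fixes A :: "'b \<Rightarrow> real^'n^'m" and B :: "'b \<Rightarrow> real^'k^'n"
  assumes "(A \<longlongrightarrow> A') F" "(B \<longlongrightarrow> B') F"
  shows "((\<lambda>n. A n ** B n) \<longlongrightarrow> A' ** B') F"
  unfolding matrix_matrix_mult_def by (intro tendsto_intros assms)

lemma transfer_product_shift:
  "transfer_product a b k (Suc m) x ** transfer_matrix a b m x
    = transfer_matrix a b (m + k) x ** transfer_product a b k m x"
proof (induction k)
  case (Suc k)
  then show ?case by (simp add: matrix_mul_assoc[symmetric])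
qed simp

lemma periodic_mult:
  assumes "\<And>n. g (n + N) = g n" shows "g (n * N + k :: nat) = g k"
proof (induction n)
  case (Suc n)
  have "g (Suc n * N + k) = g (n * N + k + N)" by (simp add: add_ac)
  with Suc assms show ?case by simp
qed simp

lemma periodic_finite_range:
  fixes g :: "nat \<Rightarrow> 'a"
  assumes "\<And>n. g (n + N) = g n" "N \<ge> 1" shows "finite (range g)"
proof (rule finite_subset)
  show "range g \<subseteq> g ` {..<N}"
  proof
    fix z assume "z \<in> range g"
    then obtain n where "z = g n" by blast
    also have "g n = g (n div N * N + n mod N)" by simp
    also have "\<dots> = g (n mod N)" by (rule periodic_mult[of g N, OF assms(1)])
    finally show "z \<in> g ` {..<N}" using assms(2) by auto
  qed
qed simp

lemma bounded_above_if_eventually: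
  fixes x :: "nat \<Rightarrow> real"
  assumes "\<And>n. n \<ge> m \<Longrightarrow> x n \<le> B" shows "\<exists>B. \<forall>n. x n \<le> B"
proof (intro exI allI)
  fix n show "x n \<le> max B (Max (x ` {..m}))"
  proof (cases "n \<ge> m")
    case False
    then have "x n \<le> Max (x ` {..m})" by (intro Max_ge) auto
    then show ?thesis by simp
  qed (use assms in \<open>simp add: le_max_iff_disj\<close>)
qed

text \<open>Only the periodic ratios \<open>q = \<alpha> (n-1) / \<alpha> n\<close> and \<open>r = \<beta> n / \<alpha> n\<close> matter below.\<close>

locale modulated =
  fixes N :: nat and a b q r :: "nat \<Rightarrow> real"
  assumes N: "N \<ge> 1"
    and a_pos: "\<And>n. a n > 0"
    and q_pos: "\<And>n. q n > 0"
    and periodic: "\<And>n. q (n + N) = q n" "\<And>n. r (n + N) = r n"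
    and q: "(\<lambda>n. a (n - 1) / a n - q n) \<longlonglongrightarrow> 0"
    and r: "(\<lambda>n. b n / a n - r n) \<longlonglongrightarrow> 0"

lemma modulated_if_periodically_modulated:
  assumes "periodically_modulated N a b" "N \<ge> 1" "\<And>n. a n > 0"
  shows "\<exists>q r. modulated N a b q r"
proof -
  obtain \<alpha> \<beta> :: "int \<Rightarrow> real" where \<alpha>: "\<And>n. \<alpha> (n + int N) = \<alpha> n" "\<And>n. \<alpha> n > 0"
    and \<beta>: "\<And>n. \<beta> (n + int N) = \<beta> n"
    and lim: "(\<lambda>n. \<bar>a (n - 1) / a n - \<alpha> (int n - 1) / \<alpha> (int n)\<bar>) \<longlonglongrightarrow> 0"
      "(\<lambda>n. \<bar>b n / a n - \<beta> (int n) / \<alpha> (int n)\<bar>) \<longlonglongrightarrow> 0"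
    using assms(1) unfolding periodically_modulated_def by blast
  have shift: "\<alpha> (int (n + N) - 1) = \<alpha> (int n - 1)" for n
    using \<alpha>(1)[of "int n - 1"] by (simp add: algebra_simps)
  have "modulated N a b (\<lambda>n. \<alpha> (int n - 1) / \<alpha> (int n)) (\<lambda>n. \<beta> (int n) / \<alpha> (int n))"
    by unfold_locales
      (use assms \<alpha> \<beta> lim shift in \<open>simp_all add: tendsto_rabs_zero_iff\<close>)
  then show ?thesis by blast
qed

context modulated
begin

lemma ratio_bounds: "\<exists>B. \<forall>n. \<bar>a (n - 1) / a n\<bar> \<le> B \<and> \<bar>b n / a n\<bar> \<le> B \<and> a n / a (n - 1) \<le> B"
proof -
  have fin: "finite (range q)" "finite (range r)"
    using periodic_finite_range[of q N] periodic_finite_range[of r N] periodic N by auto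
  have Q: "\<bar>q n\<bar> \<le> Max (abs ` range q)" and Rb: "\<bar>r n\<bar> \<le> Max (abs ` range r)"
    and qmin: "Min (range q) \<le> q n" for n
    using fin by (auto intro!: Max_ge Min_le)
  have mpos: "Min (range q) > 0" using fin q_pos by (subst Min_gr_iff) auto
  obtain K1 where K1: "\<And>n. norm (a (n - 1) / a n - q n) \<le> K1"
    using LIMSEQ_imp_Bseq[OF q] by (auto simp: Bseq_def)
  obtain K2 where K2: "\<And>n. norm (b n / a n - r n) \<le> K2"
    using LIMSEQ_imp_Bseq[OF r] by (auto simp: Bseq_def)
  have "\<forall>\<^sub>F n in sequentially. a (n - 1) / a n - q n > - (Min (range q) / 2)"
    using q by (rule order_tendstoD(1)) (use mpos in simp)
  then obtain m where m: "\<And>n. n \<ge> m \<Longrightarrow> a (n - 1) / a n - q n > - (Min (range q) / 2)"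
    unfolding eventually_sequentially by blast
  have "a n / a (n - 1) \<le> 2 / Min (range q)" if "n \<ge> m" for n
  proof -
    have "Min (range q) / 2 < a (n - 1) / a n" using m[OF that] qmin[of n] by linarith
    then have "Min (range q) * a n \<le> 2 * a (n - 1)" using a_pos[of n] by (simp add: field_simps)
    then show ?thesis using a_pos[of "n - 1"] mpos by (simp add: field_simps)
  qed
  then obtain K3 where K3: "\<And>n. a n / a (n - 1) \<le> K3"
    using bounded_above_if_eventually[of m "\<lambda>n. a n / a (n - 1)"] by blast
  define B where "B = max (K1 + Max (abs ` range q)) (max (K2 + Max (abs ` range r)) K3)"
  have "\<bar>a (n - 1) / a n\<bar> \<le> K1 + Max (abs ` range q)" for n
    using K1[of n] Q[of n] unfolding real_norm_def by linarith
  moreover have "\<bar>b n / a n\<bar> \<le> K2 + Max (abs ` range r)" for n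
    using K2[of n] Rb[of n] unfolding real_norm_def by linarith
  ultimately show ?thesis
    using K3 by (intro exI[of _ B]) (simp add: B_def le_max_iff_disj)
qed

lemma jacobi_recurrence: "\<exists>L. jacobi_recurrence a b L"
proof -
  obtain B where B: "\<And>n. \<bar>a (n - 1) / a n\<bar> \<le> B" "\<And>n. \<bar>b n / a n\<bar> \<le> B" "\<And>n. a n / a (n - 1) \<le> B"
    using ratio_bounds by blast
  have B0: "B \<ge> 0" using B(1)[of 0] by linarith
  define L where "L = 1 + 2 * B"
  have "jacobi_recurrence a b L"
  proof
    show "a n > 0" for n by (rule a_pos)
    show "L \<ge> 1" using B0 by (simp add: L_def)
    fix j :: nat
    show "norm (transfer_matrix a b j 0 *v v) \<le> L * norm v" for v
    proof -
      have tri: "\<bar>- x - y\<bar> \<le> \<bar>x\<bar> + \<bar>y\<bar>" for x y :: real by linarith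
      have "norm (transfer_matrix a b j 0 *v v)
          \<le> \<bar>v $ 2\<bar> + \<bar>- (a (j - 1) / a j * v $ 1) - b j / a j * v $ 2\<bar>"
        using norm_le_l1_cart[of "transfer_matrix a b j 0 *v v"]
        by (simp add: sum_2 transfer_matrix_def matrix_vector_mult_def)
      also have "\<dots> \<le> \<bar>v $ 2\<bar> + (\<bar>a (j - 1) / a j\<bar> * \<bar>v $ 1\<bar> + \<bar>b j / a j\<bar> * \<bar>v $ 2\<bar>)"
        unfolding abs_mult[symmetric] by (intro add_left_mono tri)
      also have "\<dots> \<le> norm v + (B * norm v + B * norm v)"
        using B0 by (intro add_mono mult_mono B component_le_norm_cart) auto
      finally show ?thesis by (simp add: L_def algebra_simps)
    qed
    have "a j \<le> B * a (j - 1)"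
      using B(3)[of j] a_pos[of "j - 1"] by (simp add: pos_divide_le_eq)
    also have "B * a (j - 1) \<le> L\<^sup>2 * a (j - 1)"
    proof (rule mult_right_mono)
      have "B \<le> L * 1" using B0 by (simp add: L_def)
      also have "\<dots> \<le> L * L" using B0 by (intro mult_left_mono) (auto simp: L_def)
      finally show "B \<le> L\<^sup>2" by (simp add: power2_eq_square)
    qed (use a_pos[of "j - 1"] in simp)
    finally have "sqrt (a j) \<le> sqrt (L\<^sup>2 * a (j - 1))" by simp
    then show "sqrt (a j) \<le> L * sqrt (a (j - 1))" using B0 by (simp add: real_sqrt_mult L_def)
  qed
  then show ?thesis by blast
qed

lemma tendsto_along_residue:
  shows "(\<lambda>n. a (n * N + k - 1) / a (n * N + k)) \<longlonglongrightarrow> q k"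
    and "(\<lambda>n. b (n * N + k) / a (n * N + k)) \<longlonglongrightarrow> r k"
proof -
  have mono: "strict_mono (\<lambda>n. n * N + k)" using N by (intro strict_monoI) simp
  have "(\<lambda>n. a (n * N + k - 1) / a (n * N + k) - q k) \<longlonglongrightarrow> 0"
    using LIMSEQ_subseq_LIMSEQ[OF q mono] periodic_mult[of q N, OF periodic(1)] by (simp add: o_def)
  then show "(\<lambda>n. a (n * N + k - 1) / a (n * N + k)) \<longlonglongrightarrow> q k" by (rule LIM_zero_cancel)
  have "(\<lambda>n. b (n * N + k) / a (n * N + k) - r k) \<longlonglongrightarrow> 0"
    using LIMSEQ_subseq_LIMSEQ[OF r mono] periodic_mult[of r N, OF periodic(2)] by (simp add: o_def)
  then show "(\<lambda>n. b (n * N + k) / a (n * N + k)) \<longlonglongrightarrow> r k" by (rule LIM_zero_cancel)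
qed

text \<open>Moving the block by one index conjugates its product by a transfer matrix, up to an error that tends to
  \<open>0\<close> because the transfer matrices converge along residue classes; a scalar limit is not changed.\<close>

lemma transfer_product_limit_shift:
  assumes "(\<lambda>n. transfer_product a b N (n * N) 0) \<longlonglongrightarrow> \<sigma> *\<^sub>R mat 1"
  shows "(\<lambda>n. transfer_product a b N (n * N + k) 0) \<longlonglongrightarrow> \<sigma> *\<^sub>R mat 1"
proof (induction k)
  case 0
  then show ?case using assms by simp
next
  case (Suc k)
  \<comment> \<open>\<open>E\<close> is the limit of the transfer matrices, \<open>I m\<close> the inverse of the one at \<open>m\<close> and \<open>E'\<close> the inverse of \<open>E\<close>.\<close>
  define E :: "real^2^2" where "E = vector [vector [0, 1], vector [- q k, (0 - r k)]]"
  define E' :: "real^2^2" where "E' = vector [vector [- (r k / q k), - (1 / q k)], vector [1, 0]]"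
  define I :: "nat \<Rightarrow> real^2^2" where "I m =
    vector [vector [- ((b m / a m) / (a (m - 1) / a m)), - (1 / (a (m - 1) / a m))], vector [1, 0]]" for m
  have inv: "transfer_matrix a b m 0 ** I m = mat 1" for m
    using a_pos[of m] a_pos[of "m - 1"]
    by (simp add: I_def transfer_matrix_def vec_eq_iff forall_2 matrix_matrix_mult_def sum_2 mat_def)
  have E: "E ** E' = mat 1"
    using q_pos[of k]
    by (simp add: E_def E'_def vec_eq_iff forall_2 matrix_matrix_mult_def sum_2 mat_def)
  have B: "(\<lambda>n. transfer_matrix a b (n * N + j) 0)
      \<longlonglongrightarrow> vector [vector [0, 1], vector [- q j, (0 - r j)]]" for j
    unfolding transfer_matrix_def diff_divide_distrib div_0
    by (intro tendsto_vector_2 tendsto_intros tendsto_along_residue)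
  have I: "(\<lambda>n. I (n * N + k)) \<longlonglongrightarrow> E'"
    unfolding I_def E'_def
    by (intro tendsto_vector_2 tendsto_intros tendsto_along_residue) (use q_pos[of k] in auto)
  have BN: "(\<lambda>n. transfer_matrix a b (n * N + k + N) 0) \<longlonglongrightarrow> E"
    using B[of "k + N"] by (simp add: E_def periodic add.assoc)
  have "transfer_product a b N (n * N + Suc k) 0
      = transfer_matrix a b (n * N + k + N) 0 ** transfer_product a b N (n * N + k) 0 ** I (n * N + k)" for n
    using arg_cong[OF transfer_product_shift[of a b N "n * N + k" 0], of "\<lambda>M. M ** I (n * N + k)"]
    by (simp add: matrix_mul_assoc[symmetric] inv)
  moreover have "(\<lambda>n. transfer_matrix a b (n * N + k + N) 0 ** transfer_product a b N (n * N + k) 0 ** I (n * N + k))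
      \<longlonglongrightarrow> E ** (\<sigma> *\<^sub>R mat 1) ** E'"
    by (intro tendsto_matrix_matrix_mult BN Suc I)
  moreover have "E ** (\<sigma> *\<^sub>R mat 1) ** E' = \<sigma> *\<^sub>R (E ** E')"
    by (simp add: vec_eq_iff forall_2 matrix_matrix_mult_def sum_2 mat_def algebra_simps)
  ultimately show ?case by (simp add: E)
qed

end


section \<open>From the recurrence to the operator\<close>

context jacobi_recurrence
begin

lemma exists_solution: "\<exists>y. solves (\<lambda>_. 0) y \<and> y 0 = u \<and> y 1 = v"
proof -
  define z where "z = rec_nat (u, v) (\<lambda>n p. (snd p, - (a n * fst p + b (Suc n) * snd p) / a (Suc n)))"
  have z: "z 0 = (u, v)" "z (Suc n) = (snd (z n), - (a n * fst (z n) + b (Suc n) * snd (z n)) / a (Suc n))" for n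
    by (simp_all add: z_def)
  have "a n * fst (z n) + b (Suc n) * fst (z (Suc n)) + a (Suc n) * fst (z (Suc (Suc n))) = 0" for n
    by (simp add: z)
  then have "solves (\<lambda>_. 0) (\<lambda>n. fst (z n))"
    unfolding solves_def by (auto simp: Suc_le_eq gr0_conv_Suc)
  then show ?thesis by (intro exI[of _ "\<lambda>n. fst (z n)"]) (simp add: z)
qed

text \<open>The initial values make the two solutions satisfy the row of index \<open>0\<close> with right sides \<open>0\<close> and
  \<open>1\<close>.\<close>

lemma not_self_adjoint_if_square_summable:
  assumes "\<And>y. solves (\<lambda>_. 0) y \<Longrightarrow> summable (\<lambda>j. (y j)\<^sup>2)"
  shows "\<not> self_adjoint (jacobi_matrix a b)"
proof -
  have ell2: "\<exists>x. coord x = (\<lambda>n. complex_of_real (y n))" if "solves (\<lambda>_. 0) y" for y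
    using Abs_ell2_inverse[of "\<lambda>n. complex_of_real (y n)"] assms[OF that] by auto
  have action: "jacobi_action a b (\<lambda>n. complex_of_real (y n)) n
      = (if n = 0 then complex_of_real (b 0 * y 0 + a 0 * y 1) else 0)" if "solves (\<lambda>_. 0) y" for y n
  proof (cases "n = 0")
    case False
    then have "a (n - 1) * y (n - 1) + b n * y n + a n * y (n + 1) = 0"
      using that by (simp add: solves_def)
    then have "complex_of_real (a (n - 1) * y (n - 1) + b n * y n + a n * y (n + 1)) = 0" by simp
    with False show ?thesis by (simp add: jacobi_action_def)
  qed (simp add: jacobi_action_def)
  obtain p where p: "solves (\<lambda>_. 0) p" "p 0 = 1" "p 1 = - b 0 / a 0" using exists_solution by blast
  obtain h where h: "solves (\<lambda>_. 0) h" "h 0 = 0" "h 1 = 1 / a 0" using exists_solution by blast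
  obtain u where u: "coord u = (\<lambda>n. complex_of_real (p n))" using ell2[OF p(1)] by blast
  obtain v where v: "coord v = (\<lambda>n. complex_of_real (h n))" using ell2[OF h(1)] by blast
  show ?thesis
  proof (rule jacobi_not_self_adjoint)
    show "jacobi_action a b (coord u) n = 0" for n
      unfolding u action[OF p(1)] using p(2,3) by simp
    show "coord u 0 = 1" by (simp add: u p)
    show "jacobi_action a b (coord v) n = (if n = 0 then 1 else 0)" for n
      unfolding v action[OF h(1)] using h(2,3) by simp
  qed
qed

text \<open>The coefficients are real, so real and imaginary parts solve the recurrence separately.\<close>

lemma jacobi_matrix_decay:
  assumes bound: "\<And>y f S n. solves f y \<Longrightarrow> 0 \<le> S \<Longrightarrow> (\<And>M. (\<Sum>j<M. (y j)\<^sup>2) \<le> S\<^sup>2) \<Longrightarrow>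
      (\<And>M. (\<Sum>j<M. (f j)\<^sup>2) \<le> S\<^sup>2) \<Longrightarrow> n \<ge> n1 \<Longrightarrow> a n * (y n)\<^sup>2 \<le> C * S\<^sup>2"
    and A: "(u, f) \<in> jacobi_matrix a b" and n: "n \<ge> n1"
  shows "a n * (cmod (coord u n))\<^sup>2 \<le> 2 * C * ((norm u)\<^sup>2 + (norm f)\<^sup>2)"
proof -
  define S where "S = sqrt ((norm u)\<^sup>2 + (norm f)\<^sup>2)"
  have S: "S \<ge> 0" "S\<^sup>2 = (norm u)\<^sup>2 + (norm f)\<^sup>2" by (simp_all add: S_def)
  have eq: "coord f n = of_real (a (n - 1)) * coord u (n - 1) + of_real (b n) * coord u n
      + of_real (a n) * coord u (n + 1)" if "n \<ge> 1" for n
    using fun_cong[OF jacobi_matrix_action[OF A], of n] that by (simp add: jacobi_action_def)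
  have le: "(\<Sum>j<M. (g (coord x j))\<^sup>2) \<le> S\<^sup>2"
    if "x \<in> {u, f}" "\<And>z. \<bar>g z\<bar> \<le> cmod z" for x M and g :: "complex \<Rightarrow> real"
  proof -
    have "(\<Sum>j<M. (g (coord x j))\<^sup>2) \<le> (\<Sum>j<M. (cmod (coord x j))\<^sup>2)"
      using that(2) by (intro sum_mono) (simp add: abs_le_square_iff[symmetric])
    also have "\<dots> \<le> (norm x)\<^sup>2" by (rule sum_coord_le_norm_sq) simp
    also have "\<dots> \<le> S\<^sup>2" using that(1) by (auto simp: S)
    finally show ?thesis .
  qed
  have "a n * (Re (coord u n))\<^sup>2 \<le> C * S\<^sup>2"
  proof (rule bound[OF _ S(1) _ _ n])
    show "solves (\<lambda>n. Re (coord f n)) (\<lambda>n. Re (coord u n))"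
      unfolding solves_def using eq by simp
  qed (rule le; simp add: abs_Re_le_cmod)+
  moreover have "a n * (Im (coord u n))\<^sup>2 \<le> C * S\<^sup>2"
  proof (rule bound[OF _ S(1) _ _ n])
    show "solves (\<lambda>n. Im (coord f n)) (\<lambda>n. Im (coord u n))"
      unfolding solves_def using eq by simp
  qed (rule le; simp add: abs_Im_le_cmod)+
  ultimately show ?thesis unfolding cmod_power2 S(2)[symmetric] by (simp add: algebra_simps)
qed

end

theorem theoremD:
  fixes N i :: nat and a b \<gamma> :: "nat \<Rightarrow> real" and \<sigma> :: real
    and X :: "nat \<Rightarrow> real \<Rightarrow> real^2^2" and X0 :: "real \<Rightarrow> real^2^2"
    and R :: "nat \<Rightarrow> real^2^2" and Ri :: "real^2^2"
  defines "X \<equiv> transfer_product a b N"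
  defines "R \<equiv> (\<lambda>n. \<gamma> n *\<^sub>R (X (n * N + i) 0 - \<sigma> *\<^sub>R mat 1))"
  assumes N: "N \<ge> 1"
    and a_pos: "\<And>n. a n > 0"
    and modulated: "periodically_modulated N a b"
    and X0: "\<And>x. (\<lambda>n. X (n * N) x) \<longlonglongrightarrow> X0 x"
    and sigma: "\<sigma> \<in> {-1, 1}"
    and X0_zero: "X0 0 = \<sigma> *\<^sub>R mat 1"
    and not_Carleman: "summable (\<lambda>n. 1 / a n)"
    and i: "i \<in> {0..N - 1}"
    and gamma_pos: "\<And>n. \<gamma> n > 0"
    and gamma_div: "\<not> summable (\<lambda>n. 1 / \<gamma> n)"
    and R_lim: "R \<longlonglongrightarrow> Ri"
    and Ri_nonzero: "Ri \<noteq> 0"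
    and R_D1: "(\<lambda>n. mat_op (R n)) \<in> D1"
  shows "(discr Ri < 0 \<longrightarrow> \<not> self_adjoint (jacobi_matrix a b)) \<and>
         (discr Ri > 0 \<longrightarrow> self_adjoint (jacobi_matrix a b) \<longrightarrow>
            essential_spectrum (jacobi_matrix a b) = {})"
proof -
  obtain q r where "modulated N a b q r"
    using modulated_if_periodically_modulated[OF modulated N a_pos] by blast
  then interpret M: modulated N a b q r .
  obtain L where "jacobi_recurrence a b L" using M.jacobi_recurrence by blast
  then interpret J: jacobi_recurrence a b L .
  have "(\<lambda>n. transfer_product a b N (n * N) 0) \<longlonglongrightarrow> \<sigma> *\<^sub>R mat 1"
    using X0[of 0] X0_zero by (simp add: X_def)
  then interpret B: jacobi_blocks a b L N i \<gamma> \<sigma> R Ri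
    by unfold_locales
      (use N gamma_pos sigma R_lim not_Carleman D1_imp_summable_variation[OF R_D1]
        M.transfer_product_limit_shift in \<open>auto simp: R_def X_def\<close>)
  show ?thesis
  proof (intro conjI impI)
    assume "discr Ri < 0"
    then show "\<not> self_adjoint (jacobi_matrix a b)"
      by (intro J.not_self_adjoint_if_square_summable B.elliptic_square_summable)
  next
    assume "discr Ri > 0" and sa: "self_adjoint (jacobi_matrix a b)"
    with B.hyperbolic_dichotomy J.not_self_adjoint_if_square_summable
    obtain C n1 where C: "\<forall>y f S. J.solves f y \<longrightarrow> 0 \<le> S \<longrightarrow> (\<forall>M. (\<Sum>j<M. (y j)\<^sup>2) \<le> S\<^sup>2) \<longrightarrow>
      (\<forall>M. (\<Sum>j<M. (f j)\<^sup>2) \<le> S\<^sup>2) \<longrightarrow> (\<forall>n\<ge>n1. a n * (y n)\<^sup>2 \<le> C * S\<^sup>2)"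
      by blast
    have decay: "a n * (cmod (coord u n))\<^sup>2 \<le> 2 * C * ((norm u)\<^sup>2 + (norm f)\<^sup>2)"
      if "(u, f) \<in> jacobi_matrix a b" "n \<ge> n1" for u f n
      by (rule J.jacobi_matrix_decay[OF _ that]) (use C in blast)
    interpret self_adjoint_coordinate_bound "jacobi_matrix a b"
      by unfold_locales (rule sa, rule jacobi_norm_bound[OF a_pos not_Carleman decay])
    show "essential_spectrum (jacobi_matrix a b) = {}" by (rule essential_spectrum_empty)
  qed
qed

end
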